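(* Let $K$ be an \'ez field and let $f:K^m\to K^n$ be a definable function. Then there is a dense Zariski open subset $U$ of $K^m$ such that the restriction of $f$ to $U$ is continuous with respect to the \'etale open topologies on $K^m$ and $K^n$.
   Context: $K$ is large if every $K$-curve with a smooth $K$-point has infinitely many $K$-points. The \'etale open ($\mathscr{E}_K$-) topology on $V(K)$, for a $K$-variety $V$ (separated reduced $K$-scheme of finite type), has as basis the images of $X(K)\to V(K)$ for \'etale morphisms $X\to V$ of $K$-varieties; here $K^m=\mathbb{A}^m(K)$. Definable means first-order definable in the language of rings with parameters from $K$. An \'ez subset of $K^m$ is a finite union of definable sets each of which is an \'etale open subset of a Zariski closed subset $V'(K)$ of $K^m$ (with the \'etale open topology of $V'(K)$, $V'$ a closed subvariety). $K$ is an \'ez field if $K$ is large and every definable subset of every $K^m$ is \'ez. *)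

theory Defs
  imports
    "HOL-Analysis.Abstract_Topology"
    "HOL-Library.Extended_Nat"
    "HOL-Library.Poly_Mapping"
    "HOL-Algebra.Ideal"
    "Jordan_Normal_Form.Determinant"
begin

text \<open>
  The field \<open>K\<close> is a type \<open>'k\<close> of class \<^class>\<open>field\<close>, and \<open>K\<^sup>n\<close> is \<open>carrier_vec n\<close>.
\<close>

section \<open>Multivariate polynomials\<close>

text \<open>
  All polynomial rings \<open>K[x\<^sub>0, \<dots>, x\<^bsub>n-1\<^esub>]\<close> live inside one type of polynomials in countably
  many variables: a monomial is an exponent vector, a polynomial a finitely supported family of
  coefficients.
\<close>

type_synonym 'k mpoly = "(nat \<Rightarrow>\<^sub>0 nat) \<Rightarrow>\<^sub>0 'k"

definition mp_const :: "'k::comm_ring_1 \<Rightarrow> 'k mpoly" where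
  "mp_const c = Poly_Mapping.single 0 c"

definition mp_var :: "nat \<Rightarrow> 'k::comm_ring_1 mpoly" where
  "mp_var i = Poly_Mapping.single (Poly_Mapping.single i 1) 1"

definition polys :: "nat \<Rightarrow> 'k::comm_ring_1 mpoly set" where
  "polys n = {p. \<forall>t \<in> Poly_Mapping.keys p. Poly_Mapping.keys t \<subseteq> {..<n}}"

definition poly_ring :: "nat \<Rightarrow> 'k::comm_ring_1 mpoly ring" where
  "poly_ring n = \<lparr>carrier = polys n, monoid.mult = (*), one = 1, zero = 0, add = (+)\<rparr>"

definition mp_extend :: "('k::comm_ring_1 \<Rightarrow> 'r::comm_ring_1) \<Rightarrow> (nat \<Rightarrow> 'r) \<Rightarrow> 'k mpoly \<Rightarrow> 'r" where
  "mp_extend c \<sigma> p =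
     (\<Sum>t \<in> Poly_Mapping.keys p. c (Poly_Mapping.lookup p t) *
        (\<Prod>i \<in> Poly_Mapping.keys t. \<sigma> i ^ Poly_Mapping.lookup t i))"

definition mp_value :: "'k::comm_ring_1 vec \<Rightarrow> 'k mpoly \<Rightarrow> 'k" where
  "mp_value a p = mp_extend (\<lambda>c. c) (\<lambda>i. a $ i) p"

definition mp_subst :: "(nat \<Rightarrow> 'k mpoly) \<Rightarrow> 'k::comm_ring_1 mpoly \<Rightarrow> 'k mpoly" where
  "mp_subst \<sigma> p = mp_extend mp_const \<sigma> p"

definition mp_deriv :: "nat \<Rightarrow> 'k::comm_ring_1 mpoly \<Rightarrow> 'k mpoly" where
  "mp_deriv i p =
     (\<Sum>t \<in> Poly_Mapping.keys p.
        Poly_Mapping.single (t - Poly_Mapping.single i 1)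
          (of_nat (Poly_Mapping.lookup t i) * Poly_Mapping.lookup p t))"


section \<open>Affine schemes of finite type over \<open>K\<close>\<close>

text \<open>
  The pair \<open>(n, I)\<close> with \<open>I\<close> an ideal of \<open>K[x\<^sub>0, \<dots>, x\<^bsub>n-1\<^esub>]\<close> stands for the closed subscheme
  \<open>Spec K[x\<^sub>0, \<dots>, x\<^bsub>n-1\<^esub>]/I\<close> of affine \<open>n\<close>-space. It is reduced iff \<open>I\<close> is radical.
\<close>

type_synonym 'k affine = "nat \<times> 'k mpoly set"

definition affine_space :: "nat \<Rightarrow> 'k::field affine" where
  "affine_space n = (n, {0})"

fun affine_variety :: "'k::field affine \<Rightarrow> bool" where
  "affine_variety (n, I) \<longleftrightarrow>
     ideal I (poly_ring n) \<and> (\<forall>p \<in> polys n. \<forall>k::nat. p ^ k \<in> I \<longrightarrow> p \<in> I)"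

text \<open>The underlying set of the scheme: the primes of the coordinate ring, pulled back to
  the polynomial ring.\<close>

fun spec :: "'k::field affine \<Rightarrow> 'k mpoly set set" where
  "spec (n, I) = {P. primeideal P (poly_ring n) \<and> I \<subseteq> P}"

fun affine_points :: "'k::field affine \<Rightarrow> 'k vec set" where
  "affine_points (n, I) = {a \<in> carrier_vec n. \<forall>p \<in> I. mp_value a p = 0}"

text \<open>The scheme point underlying a \<open>K\<close>-rational point \<open>a\<close> of affine \<open>n\<close>-space.\<close>

definition point_ideal :: "nat \<Rightarrow> 'k::field vec \<Rightarrow> 'k mpoly set" where
  "point_ideal n a = {p \<in> polys n. mp_value a p = 0}"

text \<open>A morphism to \<open>(m, J)\<close> is given by the images \<open>\<phi> $ i\<close> of the coordinates \<open>x\<^sub>i\<close>, \<open>i < m\<close>; it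
  matters only modulo the ideal of the source.\<close>

fun affine_morphism :: "'k::field affine \<Rightarrow> 'k affine \<Rightarrow> 'k mpoly vec \<Rightarrow> bool" where
  "affine_morphism (n, I) (m, J) \<phi> \<longleftrightarrow>
     \<phi> \<in> carrier_vec m \<and> (\<forall>i < m. \<phi> $ i \<in> polys n) \<and> (\<forall>p \<in> J. mp_subst (($) \<phi>) p \<in> I)"

definition morphism_value :: "'k::field mpoly vec \<Rightarrow> 'k vec \<Rightarrow> 'k vec" where
  "morphism_value \<phi> a = map_vec (mp_value a) \<phi>"

fun affine_iso :: "'k::field affine \<Rightarrow> 'k affine \<Rightarrow> 'k mpoly vec \<Rightarrow> bool" where
  "affine_iso (n, I) (m, J) \<phi> \<longleftrightarrow>
     affine_morphism (n, I) (m, J) \<phi> \<and>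
     (\<exists>\<psi>. affine_morphism (m, J) (n, I) \<psi> \<and>
        (\<forall>i < n. mp_subst (($) \<phi>) (\<psi> $ i) - mp_var i \<in> I) \<and>
        (\<forall>i < m. mp_subst (($) \<psi>) (\<phi> $ i) - mp_var i \<in> J))"

text \<open>The principal open subscheme \<open>h \<noteq> 0\<close>; the new coordinate \<open>x\<^sub>n\<close> is the inverse of \<open>h\<close>.\<close>

fun basic_open :: "'k::field affine \<Rightarrow> 'k mpoly \<Rightarrow> 'k affine" where
  "basic_open (n, I) h =
     (Suc n, Idl\<^bsub>poly_ring (Suc n)\<^esub> (I \<union> {mp_var n * h - 1}))"

text \<open>In the next definition \<open>\<phi> @\<^sub>v vec 1 (\<lambda>_. mp_var n)\<close> is the restriction of \<open>\<phi>\<close> to the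
  inverse image of \<open>h \<noteq> 0\<close>.\<close>

fun open_immersion :: "'k::field affine \<Rightarrow> 'k affine \<Rightarrow> 'k mpoly vec \<Rightarrow> bool" where
  "open_immersion (n, I) (m, J) \<phi> \<longleftrightarrow>
     affine_morphism (n, I) (m, J) \<phi> \<and>
     (\<forall>P \<in> spec (n, I). \<exists>h \<in> polys m. mp_subst (($) \<phi>) h \<notin> P \<and>
        affine_iso (basic_open (n, I) (mp_subst (($) \<phi>) h)) (basic_open (m, J) h)
          (\<phi> @\<^sub>v vec 1 (\<lambda>_. mp_var n)))"


section \<open>Smooth and etale morphisms\<close>

text \<open>
  The subscheme of \<open>V \<times> \<A>\<^bsup>r+d\<^esup>\<close> cut out by \<open>r\<close> equations \<open>g\<close>. The coordinates are those of
  \<open>V = (m, J)\<close>, followed by \<open>r + d\<close> new ones.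
\<close>

fun relative_zeros :: "nat \<Rightarrow> 'k::field affine \<Rightarrow> 'k mpoly vec \<Rightarrow> 'k affine" where
  "relative_zeros d (m, J) g =
     (let N = m + dim_vec g + d
      in (N, Idl\<^bsub>poly_ring N\<^esub> (J \<union> {g $ i | i. i < dim_vec g})))"

text \<open>
  It is standard smooth over \<open>V\<close> of relative dimension \<open>d\<close> if the Jacobian determinant of \<open>g\<close> with
  respect to the first \<open>r\<close> new coordinates is a unit of its coordinate ring.
\<close>

fun standard_smooth :: "nat \<Rightarrow> 'k::field affine \<Rightarrow> 'k mpoly vec \<Rightarrow> bool" where
  "standard_smooth d (m, J) g \<longleftrightarrow>
     (let r = dim_vec g; N = m + r + d
      in (\<forall>i < r. g $ i \<in> polys N) \<and>
         (\<exists>u \<in> polys N. u * det (mat r r (\<lambda>(i, j). mp_deriv (m + j) (g $ i))) - 1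
            \<in> snd (relative_zeros d (m, J) g)))"

text \<open>
  Smoothness at a point \<open>P\<close> of the source is the Jacobian condition on a neighbourhood of \<open>P\<close>: some
  principal open neighbourhood of \<open>P\<close> is isomorphic over \<open>V\<close> to a standard smooth \<open>V\<close>-scheme.
  Etale means smooth of relative dimension \<open>0\<close>. This is the definition of D. Mumford, The Red
  Book, III.5, and of Bosch, Luetkebohmert and Raynaud, Neron Models, 2.2.
\<close>

fun smooth_at :: "nat \<Rightarrow> 'k::field affine \<Rightarrow> 'k affine \<Rightarrow> 'k mpoly vec \<Rightarrow> 'k mpoly set \<Rightarrow> bool" where
  "smooth_at d (n, I) (m, J) \<phi> P \<longleftrightarrow>
     (\<exists>h \<in> polys n. h \<notin> P \<and>
       (\<exists>g \<alpha>. standard_smooth d (m, J) g \<and>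
          affine_iso (basic_open (n, I) h) (relative_zeros d (m, J) g) \<alpha> \<and>
          (\<forall>i < m. \<alpha> $ i - \<phi> $ i \<in> snd (basic_open (n, I) h))))"

definition etale_affine :: "'k::field affine \<Rightarrow> 'k affine \<Rightarrow> 'k mpoly vec \<Rightarrow> bool" where
  "etale_affine X V \<phi> \<longleftrightarrow> affine_morphism X V \<phi> \<and> (\<forall>P \<in> spec X. smooth_at 0 X V \<phi> P)"


section \<open>Varieties\<close>

text \<open>
  A \<open>K\<close>-variety is given by a finite affine open cover by charts \<open>X\<^sub>i\<close>. As the variety is separated,
  the intersection of \<open>X\<^sub>i\<close> and \<open>X\<^sub>j\<close> is a closed subvariety \<open>R\<^bsub>ij\<^esub>\<close> of \<open>X\<^sub>i \<times> X\<^sub>j\<close> (first the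
  coordinates of \<open>X\<^sub>i\<close>, then those of \<open>X\<^sub>j\<close>). Conversely, \<open>R\<^bsub>ij\<^esub>\<close> glue the charts to a separated
  scheme as soon as their union is an equivalence relation on the disjoint union of the charts that
  is the diagonal on each chart, and whose projections to the charts are open immersions. The data
  are the list of the \<open>X\<^sub>i\<close> and the family of the ideals of the \<open>R\<^bsub>ij\<^esub>\<close>.
\<close>

type_synonym 'k gluing = "'k affine list \<times> (nat \<Rightarrow> nat \<Rightarrow> 'k mpoly set)"

definition n_charts :: "'k::field gluing \<Rightarrow> nat" where
  "n_charts X = length (fst X)"

definition chart :: "'k::field gluing \<Rightarrow> nat \<Rightarrow> 'k affine" where
  "chart X i = fst X ! i"

definition overlap :: "'k::field gluing \<Rightarrow> nat \<Rightarrow> nat \<Rightarrow> 'k mpoly set" where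
  "overlap X = snd X"

definition chart_dim :: "'k::field gluing \<Rightarrow> nat \<Rightarrow> nat" where
  "chart_dim X i = fst (chart X i)"

definition overlap_scheme :: "'k::field gluing \<Rightarrow> nat \<Rightarrow> nat \<Rightarrow> 'k affine" where
  "overlap_scheme X i j = (chart_dim X i + chart_dim X j, overlap X i j)"

definition variety :: "'k::field gluing \<Rightarrow> bool" where
  "variety X \<longleftrightarrow>
     (\<forall>i < n_charts X. affine_variety (chart X i)) \<and>
     (\<forall>i < n_charts X. \<forall>j < n_charts X.
        affine_variety (overlap_scheme X i j) \<and>
        open_immersion (overlap_scheme X i j) (chart X i) (vec (chart_dim X i) mp_var) \<and>
        open_immersion (overlap_scheme X i j) (chart X j)
          (vec (chart_dim X j) (\<lambda>k. mp_var (chart_dim X i + k)))) \<and>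
     \<comment> \<open>reflexivity\<close>
     (\<forall>i < n_charts X. let n = chart_dim X i in
        overlap X i i =
          {p \<in> polys (n + n). mp_subst (\<lambda>k. mp_var (if k < n then k else k - n)) p
             \<in> snd (chart X i)}) \<and>
     \<comment> \<open>symmetry\<close>
     (\<forall>i < n_charts X. \<forall>j < n_charts X. let n = chart_dim X i; m = chart_dim X j in
        \<forall>p \<in> overlap X i j.
          mp_subst (\<lambda>k. mp_var (if k < n then m + k else k - n)) p \<in> overlap X j i) \<and>
     \<comment> \<open>transitivity: the fibre product of \<open>R\<^bsub>ij\<^esub>\<close> and \<open>R\<^bsub>jl\<^esub>\<close> over \<open>X\<^sub>j\<close> maps into \<open>R\<^bsub>il\<^esub>\<close>\<close>
     (\<forall>i < n_charts X. \<forall>j < n_charts X. \<forall>l < n_charts X.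
        let n = chart_dim X i; m = chart_dim X j; q = chart_dim X l in
        \<forall>p \<in> overlap X i l.
          mp_subst (\<lambda>k. mp_var (if k < n then k else m + k)) p
            \<in> Idl\<^bsub>poly_ring (n + m + q)\<^esub>
                 (overlap X i j \<union> mp_subst (\<lambda>k. mp_var (n + k)) ` overlap X j l))"

definition glued_points :: "'k::field gluing \<Rightarrow> (nat \<times> 'k vec) set" where
  "glued_points X = {(i, a). i < n_charts X \<and> a \<in> affine_points (chart X i)}"

definition glue_rel :: "'k::field gluing \<Rightarrow> ((nat \<times> 'k vec) \<times> (nat \<times> 'k vec)) set" where
  "glue_rel X = {((i, a), (j, b)). (i, a) \<in> glued_points X \<and> (j, b) \<in> glued_points X \<and>
     a @\<^sub>v b \<in> affine_points (overlap_scheme X i j)}"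

definition K_points :: "'k::field gluing \<Rightarrow> (nat \<times> 'k vec) set set" where
  "K_points X = glued_points X // glue_rel X"

text \<open>Smoothness over \<open>K\<close> of the point represented by \<open>(i, a)\<close>.\<close>

definition smooth_K_point :: "'k::field gluing \<Rightarrow> nat \<times> 'k vec \<Rightarrow> bool" where
  "smooth_K_point X x \<longleftrightarrow> x \<in> glued_points X \<and>
     (\<exists>d. smooth_at d (chart X (fst x)) (affine_space 0) (vec 0 mp_var)
        (point_ideal (chart_dim X (fst x)) (snd x)))"

text \<open>An etale morphism from \<open>X\<close> to an affine \<open>V\<close>, given by its restrictions to the charts.\<close>

definition etale_morphism :: "'k::field gluing \<Rightarrow> 'k affine \<Rightarrow> (nat \<Rightarrow> 'k mpoly vec) \<Rightarrow> bool" where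
  "etale_morphism X V \<Phi> \<longleftrightarrow>
     (\<forall>i < n_charts X. etale_affine (chart X i) V (\<Phi> i)) \<and>
     (\<forall>i < n_charts X. \<forall>j < n_charts X. \<forall>k < fst V.
        \<Phi> i $ k - mp_subst (\<lambda>l. mp_var (chart_dim X i + l)) (\<Phi> j $ k) \<in> overlap X i j)"

definition K_image :: "'k::field gluing \<Rightarrow> (nat \<Rightarrow> 'k mpoly vec) \<Rightarrow> 'k vec set" where
  "K_image X \<Phi> = (\<lambda>(i, a). morphism_value (\<Phi> i) a) ` glued_points X"


section \<open>Topologies\<close>

definition zariski_topology :: "nat \<Rightarrow> 'k::field vec topology" where
  "zariski_topology n =
     topology_generated_by {{a \<in> carrier_vec n. mp_value a p \<noteq> 0} | p. p \<in> polys n}"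

definition etale_topology :: "'k::field affine \<Rightarrow> 'k vec topology" where
  "etale_topology V =
     topology_generated_by {K_image X \<Phi> | X \<Phi>. variety X \<and> etale_morphism X V \<Phi>}"


section \<open>Large fields\<close>

fun krull_dim :: "'k::field affine \<Rightarrow> enat" where
  "krull_dim (n, I) = Sup {enat d | d. \<exists>c :: nat \<Rightarrow> 'k mpoly set.
     (\<forall>i \<le> d. c i \<in> spec (n, I)) \<and> (\<forall>i < d. c i \<subset> c (Suc i))}"

fun irreducible_component :: "'k::field affine \<Rightarrow> 'k affine \<Rightarrow> bool" where
  "irreducible_component (n, I) (m, P) \<longleftrightarrow>
     m = n \<and> P \<in> spec (n, I) \<and> (\<forall>Q \<in> spec (n, I). Q \<subseteq> P \<longrightarrow> Q = P)"

text \<open>Curves have pure dimension one: without this, every field with a curve that has no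
  \<open>K\<close>-points would fail to be large, because of the disjoint union of that curve and a point.\<close>

definition curve :: "'k::field gluing \<Rightarrow> bool" where
  "curve X \<longleftrightarrow> variety X \<and>
     (\<forall>i < n_charts X. \<forall>Z. irreducible_component (chart X i) Z \<longrightarrow> krull_dim Z = 1)"

definition large_field :: "'k::field itself \<Rightarrow> bool" where
  "large_field _ \<longleftrightarrow>
     (\<forall>X :: 'k gluing. curve X \<and> (\<exists>x. smooth_K_point X x) \<longrightarrow> infinite (K_points X))"


section \<open>Definable sets\<close>

datatype 'k ring_term =
    TVar nat
  | TParam 'k
  | TAdd "'k ring_term" "'k ring_term"
  | TMult "'k ring_term" "'k ring_term"
  | TMinus "'k ring_term"

datatype 'k ring_formula =
    FEq "'k ring_term" "'k ring_term"
  | FNot "'k ring_formula"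
  | FAnd "'k ring_formula" "'k ring_formula"
  | FEx nat "'k ring_formula"

primrec term_value :: "(nat \<Rightarrow> 'k::field) \<Rightarrow> 'k ring_term \<Rightarrow> 'k" where
  "term_value e (TVar i) = e i"
| "term_value e (TParam c) = c"
| "term_value e (TAdd s t) = term_value e s + term_value e t"
| "term_value e (TMult s t) = term_value e s * term_value e t"
| "term_value e (TMinus t) = - term_value e t"

primrec sat :: "(nat \<Rightarrow> 'k::field) \<Rightarrow> 'k ring_formula \<Rightarrow> bool" where
  "sat e (FEq s t) \<longleftrightarrow> term_value e s = term_value e t"
| "sat e (FNot A) \<longleftrightarrow> \<not> sat e A"
| "sat e (FAnd A B) \<longleftrightarrow> sat e A \<and> sat e B"
| "sat e (FEx i A) \<longleftrightarrow> (\<exists>c. sat (e(i := c)) A)"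

primrec term_vars :: "'k ring_term \<Rightarrow> nat set" where
  "term_vars (TVar i) = {i}"
| "term_vars (TParam c) = {}"
| "term_vars (TAdd s t) = term_vars s \<union> term_vars t"
| "term_vars (TMult s t) = term_vars s \<union> term_vars t"
| "term_vars (TMinus t) = term_vars t"

primrec free_vars :: "'k ring_formula \<Rightarrow> nat set" where
  "free_vars (FEq s t) = term_vars s \<union> term_vars t"
| "free_vars (FNot A) = free_vars A"
| "free_vars (FAnd A B) = free_vars A \<union> free_vars B"
| "free_vars (FEx i A) = free_vars A - {i}"

definition definable :: "nat \<Rightarrow> 'k::field vec set \<Rightarrow> bool" where
  "definable n S \<longleftrightarrow>
     (\<exists>A. free_vars A \<subseteq> {..<n} \<and> S = {a \<in> carrier_vec n. sat (($) a) A})"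

definition definable_function :: "nat \<Rightarrow> nat \<Rightarrow> ('k::field vec \<Rightarrow> 'k vec) \<Rightarrow> bool" where
  "definable_function m n f \<longleftrightarrow>
     f \<in> carrier_vec m \<rightarrow> carrier_vec n \<and>
     definable (m + n) {a @\<^sub>v f a | a. a \<in> carrier_vec m}"


section \<open>Ez fields\<close>

definition ez_set :: "nat \<Rightarrow> 'k::field vec set \<Rightarrow> bool" where
  "ez_set n S \<longleftrightarrow>
     (\<exists>\<D>. finite \<D> \<and> S = \<Union>\<D> \<and>
        (\<forall>D \<in> \<D>. definable n D \<and>
           (\<exists>I. affine_variety (n, I) \<and> openin (etale_topology (n, I)) D)))"

definition ez_field :: "'k::field itself \<Rightarrow> bool" where
  "ez_field T \<longleftrightarrow>
     large_field T \<and> (\<forall>n (S :: 'k vec set). definable n S \<longrightarrow> ez_set n S)"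

end

theory Submission
  imports Defs "HOL-Computational_Algebra.Polynomial_Factorial"
begin

text \<open>
  Call \<open>U \<subseteq> K\<^sup>m\<close> etale open if it is a union of sets of the form
  \<open>{a. \<exists>b. g(a, b) = 0 \<and> det (\<partial>g/\<partial>y)(a, b) \<noteq> 0}\<close> for square systems \<open>g\<close> in the variables \<open>y\<close>.
  The coordinate ring of such a system is reduced near each of its points: Newton iteration shows that
  a nilpotent lies in \<open>(g) + \<mm>\<^sup>k\<close> for all \<open>k\<close>, where \<open>\<mm>\<close> is the maximal ideal of the point, and Krull's
  intersection theorem applies. Hence the systems define etale morphisms of varieties,
  and the open sets of the etale topology on a closed subvariety of \<open>K\<^sup>m\<close> are exactly the
  intersections of its points with etale open sets of \<open>K\<^sup>m\<close>.

  If \<open>{0}\<close> is etale open in \<open>K\<close>, every topology in sight is discrete. Otherwise \<open>K\<close> is infinite, and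
  perfect since the \<open>p\<close>-th powers form an ez set. The graph of \<open>f\<close> is a finite union of relatively open
  pieces of varieties. By Noetherian induction on the vanishing ideal of a piece, one may assume that it
  is prime and that the first \<open>m\<close> coordinates are algebraically independent modulo it. Up to a
  Frobenius power every further coordinate is then free or a root of a polynomial that is separable over
  the preceding ones, so that the projection of the piece to \<open>K\<^sup>m\<close> is an open map where the leading
  coefficients and derivatives of these polynomials do not vanish. An open projection from the graph means
  that \<open>f\<close> is continuous at the points below it, and the points over which one of the finitely many
  pieces is bad lie in a proper Zariski closed subset of \<open>K\<^sup>m\<close>.
\<close>

section \<open>Polynomials and their values\<close>

text \<open>Charts of a variety must have radical ideals, whereas the ideal of a square system is
  given by bare equations. The remedy is local: the radical is shown to agree with the ideal after
  inverting one polynomial that is nonzero at the chosen point, which suffices because open sets are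
  unions of small images. The discrete case is split off since it absorbs two kinds of fields for
  which the generic argument breaks down. Over a finite field a nonzero polynomial may vanish at
  every point, so nonempty Zariski open sets need not be dense. Over an imperfect field a piece of
  the graph may be inseparable over K^m. Over a perfect field of characteristic p the map
  \<open>x \<mapsto> x ^ q\<close>, q a power of p, is bijective and carries etale open sets to
  etale open sets, although for q > 1 it is no etale morphism. An equation A(w^q) = 0 can therefore
  be solved for w^q, in which it is separable.\<close>

lemma comm_ring_homI:
  assumes "h 1 = 1" "\<And>x y. h (x + y) = h x + h y" "\<And>x y. h (x * y) = h x * h y"
  shows "comm_ring_hom (h :: 'a::comm_ring_1 \<Rightarrow> 'b::comm_ring_1)"
proof -
  have "h 0 + h 0 = h 0 + 0" using assms(2)[of 0 0] by simp
  then have "h 0 = 0" by (metis add_left_cancel)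
  then show ?thesis using assms by unfold_locales auto
qed

lemma comm_ring_hom_id: "comm_ring_hom (\<lambda>x :: 'a::comm_ring_1. x)"
  by (rule comm_ring_homI) auto

lemma comm_ring_hom_comp:
  "comm_ring_hom f \<Longrightarrow> comm_ring_hom g \<Longrightarrow> comm_ring_hom (\<lambda>x. f (g x))"
proof -
  assume "comm_ring_hom f" "comm_ring_hom g"
  then interpret f: comm_ring_hom f + g: comm_ring_hom g by simp_all
  show ?thesis by (rule comm_ring_homI) (auto simp: f.hom_add g.hom_add f.hom_mult g.hom_mult)
qed

lemma comm_ring_hom_const: "comm_ring_hom mp_const"
  by (rule comm_ring_homI) (simp_all add: mp_const_def single_add mult_single)

section \<open>Monomials and the universal property of the polynomial ring\<close>

definition mp_mono :: "(nat \<Rightarrow> 'r::comm_ring_1) \<Rightarrow> (nat \<Rightarrow>\<^sub>0 nat) \<Rightarrow> 'r" where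
  "mp_mono \<sigma> t = (\<Prod>i \<in> Poly_Mapping.keys t. \<sigma> i ^ Poly_Mapping.lookup t i)"

lemma mp_mono_superset:
  assumes "finite S" "Poly_Mapping.keys t \<subseteq> S"
  shows "mp_mono \<sigma> t = (\<Prod>i\<in>S. \<sigma> i ^ Poly_Mapping.lookup t i)"
  unfolding mp_mono_def using assms
  by (intro prod.mono_neutral_left) (auto simp: in_keys_iff)

lemma mp_mono_0 [simp]: "mp_mono \<sigma> 0 = 1"
  by (simp add: mp_mono_def)

lemma mp_mono_add: "mp_mono \<sigma> (s + t) = mp_mono \<sigma> s * mp_mono \<sigma> t"
proof -
  let ?S = "Poly_Mapping.keys s \<union> Poly_Mapping.keys t"
  have "Poly_Mapping.keys (s + t) \<subseteq> ?S" by (rule keys_add)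
  then show ?thesis
    by (simp add: mp_mono_superset[of ?S] lookup_add power_add prod.distrib)
qed

lemma mp_mono_single [simp]: "mp_mono \<sigma> (Poly_Mapping.single i k) = \<sigma> i ^ k"
  by (cases "k = 0") (simp_all add: mp_mono_def)

text \<open>The supports of p, q and p + q differ, so sums indexed by \<open>keys\<close> cannot be
  compared term by term. Over a common finite superset they can, as the extra terms have coefficient
  0.\<close>

lemma mp_extend_superset:
  assumes "finite S" "Poly_Mapping.keys p \<subseteq> S" "c 0 = 0"
  shows "mp_extend c \<sigma> p = (\<Sum>t\<in>S. c (Poly_Mapping.lookup p t) * mp_mono \<sigma> t)"
  unfolding mp_extend_def mp_mono_def using assms
  by (intro sum.mono_neutral_left) (auto simp: in_keys_iff)

lemma mp_extend_single:
  "c 0 = 0 \<Longrightarrow> mp_extend c \<sigma> (Poly_Mapping.single t a) = c a * mp_mono \<sigma> t"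
  by (subst mp_extend_superset[of "{t}"]) auto

lemma sum_single_lookup: "(\<Sum>t\<in>Poly_Mapping.keys p. Poly_Mapping.single t (Poly_Mapping.lookup p t)) = p"
  by (rule poly_mapping_eqI)
    (auto simp: lookup_sum lookup_single when_def in_keys_iff sum.delta)

lemma mpoly_induct [case_names single add]:
  fixes p :: "'k::comm_ring_1 mpoly"
  assumes "\<And>t a. P (Poly_Mapping.single t a)" "\<And>p q. P p \<Longrightarrow> P q \<Longrightarrow> P (p + q)"
  shows "P p"
proof -
  have *: "P (\<Sum>t\<in>S. Poly_Mapping.single t (f t))" if "finite S" for S :: "(nat \<Rightarrow>\<^sub>0 nat) set" and f :: "_ \<Rightarrow> 'k"
    using that
  proof (induction S)
    case empty
    show ?case using assms(1)[of 0 0] by simp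
  qed (simp add: assms)
  from *[of "Poly_Mapping.keys p" "Poly_Mapping.lookup p"] show ?thesis
    by (simp add: sum_single_lookup)
qed

lemma comm_ring_hom_mp_extend:
  assumes "comm_ring_hom c"
  shows "comm_ring_hom (mp_extend c \<sigma>)"
proof -
  interpret c: comm_ring_hom c by fact
  have add: "mp_extend c \<sigma> (p + q) = mp_extend c \<sigma> p + mp_extend c \<sigma> q" for p q
  proof -
    let ?S = "Poly_Mapping.keys p \<union> Poly_Mapping.keys q"
    have "Poly_Mapping.keys (p + q) \<subseteq> ?S" by (rule keys_add)
    then show ?thesis
      by (simp add: mp_extend_superset[of ?S] lookup_add c.hom_add distrib_right sum.distrib)
  qed
  have mult: "mp_extend c \<sigma> (p * q) = mp_extend c \<sigma> p * mp_extend c \<sigma> q" for p q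
  proof (induction p rule: mpoly_induct)
    case (single t a)
    show ?case
    proof (induction q rule: mpoly_induct)
      case (single s b)
      show ?case
        by (simp add: mult_single mp_extend_single mp_mono_add c.hom_mult ac_simps)
    qed (simp add: add distrib_left)
  qed (simp add: add distrib_right)
  show ?thesis
    by (rule comm_ring_homI)
      (auto simp: add mult mp_extend_single simp flip: single_one)
qed

lemma mp_extend_const: "comm_ring_hom c \<Longrightarrow> mp_extend c \<sigma> (mp_const a) = c a"
proof -
  assume "comm_ring_hom c"
  then interpret c: comm_ring_hom c .
  show ?thesis by (simp add: mp_const_def mp_extend_single)
qed

lemma mp_extend_var: "comm_ring_hom c \<Longrightarrow> mp_extend c \<sigma> (mp_var i) = \<sigma> i"
proof -
  assume "comm_ring_hom c"
  then interpret c: comm_ring_hom c .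
  show ?thesis by (simp add: mp_var_def mp_extend_single)
qed

section \<open>Evaluation and substitution\<close>

definition ev :: "(nat \<Rightarrow> 'k::comm_ring_1) \<Rightarrow> 'k mpoly \<Rightarrow> 'k" where
  "ev e = mp_extend (\<lambda>c. c) e"

lemma mp_value_ev: "mp_value a p = ev (($) a) p"
  by (simp add: mp_value_def ev_def)

lemma comm_ring_hom_ev: "comm_ring_hom (ev e)"
  unfolding ev_def by (rule comm_ring_hom_mp_extend[OF comm_ring_hom_id])

interpretation ev: comm_ring_hom "ev e" for e :: "nat \<Rightarrow> 'k::comm_ring_1"
  by (rule comm_ring_hom_ev)

lemma comm_ring_hom_subst: "comm_ring_hom (mp_subst \<sigma>)"
  unfolding mp_subst_def[abs_def] by (rule comm_ring_hom_mp_extend[OF comm_ring_hom_const])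

interpretation subst: comm_ring_hom "mp_subst \<sigma>" for \<sigma> :: "nat \<Rightarrow> 'k::comm_ring_1 mpoly"
  by (rule comm_ring_hom_subst)

interpretation mpc: comm_ring_hom mp_const
  by (rule comm_ring_hom_const)

lemma ev_const [simp]: "ev e (mp_const a) = a"
  unfolding ev_def by (rule mp_extend_const[OF comm_ring_hom_id])

lemma ev_var [simp]: "ev e (mp_var i) = e i"
  unfolding ev_def by (rule mp_extend_var[OF comm_ring_hom_id])

lemma subst_const [simp]: "mp_subst \<sigma> (mp_const a) = mp_const a"
  unfolding mp_subst_def by (rule mp_extend_const[OF comm_ring_hom_const])

lemma subst_var [simp]: "mp_subst \<sigma> (mp_var i) = \<sigma> i"
  unfolding mp_subst_def by (rule mp_extend_var[OF comm_ring_hom_const])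

section \<open>The subrings of polynomials in the first n variables\<close>

lemma polys_add: "p \<in> polys n \<Longrightarrow> q \<in> polys n \<Longrightarrow> p + q \<in> polys n"
  using keys_add[of p q] by (fastforce simp: polys_def)

lemma polys_mult: "p \<in> polys n \<Longrightarrow> q \<in> polys n \<Longrightarrow> p * q \<in> polys n"
proof -
  assume pq: "p \<in> polys n" "q \<in> polys n"
  show "p * q \<in> polys n" unfolding polys_def
  proof safe
    fix t i assume t: "t \<in> Poly_Mapping.keys (p * q)" and i: "i \<in> Poly_Mapping.keys t"
    then obtain a b where ab: "t = a + b" "a \<in> Poly_Mapping.keys p" "b \<in> Poly_Mapping.keys q"
      using keys_mult[of p q] by blast
    then have "i \<in> Poly_Mapping.keys a \<union> Poly_Mapping.keys b"
      using i keys_add[of a b] by blast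
    then show "i < n" using pq ab by (auto simp: polys_def)
  qed
qed

lemma polys_const [simp]: "mp_const c \<in> polys n"
  by (auto simp: polys_def mp_const_def split: if_splits)

lemma polys_0 [simp]: "0 \<in> polys n"
  by (auto simp: polys_def)

lemma polys_1 [simp]: "1 \<in> polys n"
  by (auto simp: polys_def)

lemma polys_var [simp]: "mp_var i \<in> polys n \<longleftrightarrow> i < n"
  by (auto simp: polys_def mp_var_def)

lemma polys_uminus: "p \<in> polys n \<Longrightarrow> - p \<in> polys n"
  using polys_mult[OF polys_const[of "-1"], of p n] by (simp add: mpc.hom_uminus)

lemma polys_diff: "p \<in> polys n \<Longrightarrow> q \<in> polys n \<Longrightarrow> p - q \<in> polys n"
  using polys_add[of p n "-q"] polys_uminus[of q n] by simp

lemma polys_power: "p \<in> polys n \<Longrightarrow> p ^ k \<in> polys n"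
  by (induction k) (auto intro: polys_mult)

lemma polys_sum: "(\<And>i. i \<in> A \<Longrightarrow> f i \<in> polys n) \<Longrightarrow> sum f A \<in> polys n"
  by (induction A rule: infinite_finite_induct) (auto intro: polys_add)

lemma polys_prod: "(\<And>i. i \<in> A \<Longrightarrow> f i \<in> polys n) \<Longrightarrow> prod f A \<in> polys n"
  by (induction A rule: infinite_finite_induct) (auto intro: polys_mult)

lemma polys_mono: "p \<in> polys n \<Longrightarrow> n \<le> m \<Longrightarrow> p \<in> polys m"
  by (fastforce simp: polys_def)

lemmas polys_intros = polys_add polys_mult polys_uminus polys_diff polys_power polys_sum polys_prod

lemma single_eq_mono: "Poly_Mapping.single t b = mp_const b * mp_mono mp_var t"
proof -
  have pow: "mp_var i ^ k = (Poly_Mapping.single (Poly_Mapping.single i k) 1 :: 'a mpoly)" for i k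
    by (induction k) (simp_all add: mp_var_def mult_single flip: single_add)
  have "(\<Prod>i\<in>S. mp_var i ^ f i) = (Poly_Mapping.single (\<Sum>i\<in>S. Poly_Mapping.single i (f i)) 1 :: 'a mpoly)"
    if "finite S" for S and f :: "nat \<Rightarrow> nat"
    using that by (induction S) (simp_all add: pow mult_single)
  then show ?thesis by (simp add: mp_mono_def mp_const_def mult_single sum_single_lookup)
qed

lemma polys_induct [consumes 1, case_names const var add mult]:
  fixes p :: "'k::comm_ring_1 mpoly"
  assumes p: "p \<in> polys n"
    and c: "\<And>c. P (mp_const c)" and v: "\<And>i. i < n \<Longrightarrow> P (mp_var i)"
    and a: "\<And>p q. p \<in> polys n \<Longrightarrow> q \<in> polys n \<Longrightarrow> P p \<Longrightarrow> P q \<Longrightarrow> P (p + q)"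
    and m: "\<And>p q. p \<in> polys n \<Longrightarrow> q \<in> polys n \<Longrightarrow> P p \<Longrightarrow> P q \<Longrightarrow> P (p * q)"
  shows "P p"
proof -
  let ?Q = "\<lambda>p. p \<in> polys n \<and> P p"
  have pow: "?Q (mp_var i ^ k)" if "i < n" for i k
    using that c[of 1] by (induction k) (auto intro!: v m polys_power polys_mult)
  have prod: "?Q (\<Prod>i\<in>S. mp_var i ^ f i)" if "finite S" "S \<subseteq> {..<n}" for S and f :: "nat \<Rightarrow> nat"
    using that
  proof (induction S)
    case empty then show ?case using c[of 1] by simp
  next
    case (insert i S)
    then have "?Q (mp_var i ^ f i)" "?Q (\<Prod>i\<in>S. mp_var i ^ f i)" using pow by auto
    then show ?case using insert by (auto intro!: m polys_mult)
  qed
  have "?Q (\<Sum>t\<in>S. Poly_Mapping.single t (f t))"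
    if "finite S" "\<And>t. t \<in> S \<Longrightarrow> Poly_Mapping.keys t \<subseteq> {..<n}" for S f
    using that
  proof (induction S)
    case empty then show ?case using c[of 0] by simp
  next
    case (insert t S)
    have "?Q (mp_mono mp_var t)" unfolding mp_mono_def using insert by (intro prod) auto
    then have "?Q (Poly_Mapping.single t (f t))" unfolding single_eq_mono by (auto intro!: m c polys_mult)
    then show ?case using insert by (auto intro!: a polys_add)
  qed
  from this[of "Poly_Mapping.keys p" "Poly_Mapping.lookup p"]
  have "?Q (\<Sum>t\<in>Poly_Mapping.keys p. Poly_Mapping.single t (Poly_Mapping.lookup p t))"
    using p by (auto simp: polys_def)
  then show ?thesis by (simp add: sum_single_lookup)
qed

text \<open>Uniqueness in the universal property: later identities between evaluations,
  substitutions and expansions are reduced by it to constants and variables.\<close>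

lemma polys_hom_eq:
  assumes "p \<in> polys n" "comm_ring_hom f" "comm_ring_hom g"
    and "\<And>c. f (mp_const c) = g (mp_const c)" "\<And>i. i < n \<Longrightarrow> f (mp_var i) = g (mp_var i)"
  shows "f p = g p"
proof -
  interpret f: comm_ring_hom f by fact
  interpret g: comm_ring_hom g by fact
  show ?thesis using assms(1)
    by (induction rule: polys_induct) (auto simp: assms f.hom_add f.hom_mult g.hom_add g.hom_mult)
qed

lemma ex_polys: "\<exists>n. p \<in> polys n"
proof -
  have "finite (\<Union>t\<in>Poly_Mapping.keys p. Poly_Mapping.keys t)" by simp
  then obtain n where "(\<Union>t\<in>Poly_Mapping.keys p. Poly_Mapping.keys t) \<subseteq> {..<n}"
    using finite_nat_iff_bounded by blast
  then show ?thesis by (auto simp: polys_def)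
qed

lemma mpoly_hom_eq:
  assumes "comm_ring_hom f" "comm_ring_hom g"
    and "\<And>c. f (mp_const c) = g (mp_const c)" "\<And>i. f (mp_var i) = g (mp_var i)"
  shows "f p = g p"
  using ex_polys[of p] polys_hom_eq assms by blast

lemma ev_cong: "p \<in> polys n \<Longrightarrow> (\<And>i. i < n \<Longrightarrow> e i = e' i) \<Longrightarrow> ev e p = ev e' p"
  by (rule polys_hom_eq) (auto intro: comm_ring_hom_ev)

lemma subst_cong: "p \<in> polys n \<Longrightarrow> (\<And>i. i < n \<Longrightarrow> \<sigma> i = \<tau> i) \<Longrightarrow> mp_subst \<sigma> p = mp_subst \<tau> p"
  by (rule polys_hom_eq) (auto intro: comm_ring_hom_subst)

lemma subst_id: "p \<in> polys n \<Longrightarrow> (\<And>i. i < n \<Longrightarrow> \<sigma> i = mp_var i) \<Longrightarrow> mp_subst \<sigma> p = p"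
  by (rule polys_hom_eq[where g = "\<lambda>x. x"]) (auto intro: comm_ring_hom_subst comm_ring_hom_id)

lemma ev_subst: "ev e (mp_subst \<sigma> p) = ev (\<lambda>i. ev e (\<sigma> i)) p"
  by (rule mpoly_hom_eq) (auto intro: comm_ring_hom_ev comm_ring_hom_subst comm_ring_hom_comp)

lemma subst_subst: "mp_subst \<sigma> (mp_subst \<tau> p) = mp_subst (\<lambda>i. mp_subst \<sigma> (\<tau> i)) p"
  by (rule mpoly_hom_eq) (auto intro: comm_ring_hom_subst comm_ring_hom_comp)

lemma polys_subst: "p \<in> polys n \<Longrightarrow> (\<And>i. i < n \<Longrightarrow> \<sigma> i \<in> polys m) \<Longrightarrow> mp_subst \<sigma> p \<in> polys m"
  by (induction rule: polys_induct) (auto simp: subst.hom_add subst.hom_mult intro: polys_intros)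

subsection \<open>Derivatives\<close>

lemma deriv_superset:
  assumes "finite S" "Poly_Mapping.keys p \<subseteq> S"
  shows "mp_deriv i p = (\<Sum>t\<in>S. Poly_Mapping.single (t - Poly_Mapping.single i 1)
          (of_nat (Poly_Mapping.lookup t i) * Poly_Mapping.lookup p t))"
  unfolding mp_deriv_def using assms
  by (intro sum.mono_neutral_left) (auto simp: in_keys_iff)

lemma deriv_single:
  "mp_deriv i (Poly_Mapping.single t a) =
    Poly_Mapping.single (t - Poly_Mapping.single i 1) (of_nat (Poly_Mapping.lookup t i) * a)"
  by (subst deriv_superset[of "{t}"]) auto

lemma deriv_add: "mp_deriv i (p + q) = mp_deriv i p + mp_deriv i q"
proof -
  let ?S = "Poly_Mapping.keys p \<union> Poly_Mapping.keys q"
  have "Poly_Mapping.keys (p + q) \<subseteq> ?S" by (rule keys_add)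
  then show ?thesis
    by (simp add: deriv_superset[of ?S] lookup_add distrib_left single_add sum.distrib)
qed

lemma deriv_mult: "mp_deriv i (p * q) = mp_deriv i p * q + p * mp_deriv i q"
proof (induction p rule: mpoly_induct)
  case (single t a)
  show ?case
  proof (induction q rule: mpoly_induct)
    case (single s b)
    \<comment> \<open>Subtraction of exponents is truncated, so it commutes with adding s only if
      x_i occurs in t. Otherwise the factor \<open>lookup t i = 0\<close> removes the term, whence
      the case split below.\<close>
    have 1: "s + t - Poly_Mapping.single i (Suc 0) = s + (t - Poly_Mapping.single i (Suc 0))"
      if "0 < Poly_Mapping.lookup t i" for s t :: "nat \<Rightarrow>\<^sub>0 nat"
      using that by (intro poly_mapping_eqI) (auto simp: lookup_add lookup_minus lookup_single when_def)
    have 2: "t + (s - Poly_Mapping.single i (Suc 0)) = s + (t - Poly_Mapping.single i (Suc 0))"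
      if "0 < Poly_Mapping.lookup t i" "0 < Poly_Mapping.lookup s i"
      using 1[of s t] 1[of t s] that by (simp add: add.commute)
    show ?case
      using 1[of s t] 1[of t s] 2
      by (cases "Poly_Mapping.lookup t i = 0"; cases "Poly_Mapping.lookup s i = 0")
        (simp_all add: mult_single deriv_single lookup_add algebra_simps flip: single_add)
  qed (simp add: deriv_add algebra_simps)
qed (simp add: deriv_add algebra_simps)

lemma deriv_const [simp]: "mp_deriv i (mp_const c) = 0"
  by (simp add: mp_const_def deriv_single)

lemma deriv_var: "mp_deriv i (mp_var j) = (if i = j then 1 else 0)"
  by (simp add: mp_var_def deriv_single lookup_single)

lemma deriv_1 [simp]: "mp_deriv i 1 = 0"
  using deriv_const[of i 1] by simp

lemma deriv_0 [simp]: "mp_deriv i 0 = 0"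
  using deriv_const[of i 0] by simp

lemma deriv_uminus: "mp_deriv i (- p) = - mp_deriv i p"
  using deriv_add[of i p "-p"] by (simp add: eq_neg_iff_add_eq_0 add.commute)

lemma deriv_diff: "mp_deriv i (p - q) = mp_deriv i p - mp_deriv i q"
  using deriv_add[of i p "-q"] by (simp add: deriv_uminus)

lemma deriv_polys: "p \<in> polys n \<Longrightarrow> mp_deriv i p \<in> polys n"
  by (induction rule: polys_induct) (auto simp: deriv_add deriv_mult deriv_var intro: polys_intros)

text \<open>This produces the zero block in the Jacobian matrix of a concatenated system, whose
  first equations do not involve the later variables.\<close>

lemma deriv_polys_0: "p \<in> polys n \<Longrightarrow> n \<le> i \<Longrightarrow> mp_deriv i p = 0"
  by (induction rule: polys_induct) (auto simp: deriv_add deriv_mult deriv_var)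

section \<open>Noetherian subrings\<close>

definition subring_set :: "'a::comm_ring_1 set \<Rightarrow> bool" where
  "subring_set R \<longleftrightarrow> 0 \<in> R \<and> 1 \<in> R \<and> (\<forall>a\<in>R. \<forall>b\<in>R. a + b \<in> R \<and> a * b \<in> R) \<and> (\<forall>a\<in>R. - a \<in> R)"

text \<open>The ideal generated by S in the subring R, built by adding one multiple at a time:
  linear combinations are handled by rule induction instead of indexed sums. Subrings are plain sets
  because all \<open>polys n\<close> share one type.\<close>

inductive_set gen :: "'a::comm_ring_1 set \<Rightarrow> 'a set \<Rightarrow> 'a set" for R S where
  zero [simp]: "0 \<in> gen R S"
| step: "r \<in> R \<Longrightarrow> s \<in> S \<Longrightarrow> p \<in> gen R S \<Longrightarrow> r * s + p \<in> gen R S"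

definition idl :: "'a::comm_ring_1 set \<Rightarrow> 'a set \<Rightarrow> bool" where
  "idl R I \<longleftrightarrow> I \<subseteq> R \<and> 0 \<in> I \<and> (\<forall>a\<in>I. \<forall>b\<in>I. a + b \<in> I) \<and> (\<forall>r\<in>R. \<forall>a\<in>I. r * a \<in> I)"

definition noeth :: "'a::comm_ring_1 set \<Rightarrow> bool" where
  "noeth R \<longleftrightarrow> (\<forall>I. idl R I \<longrightarrow> (\<exists>F. finite F \<and> F \<subseteq> I \<and> I \<subseteq> gen R F))"

lemma subring_polys: "subring_set (polys n)"
  by (auto simp: subring_set_def intro: polys_intros)

lemma subring_setD:
  assumes "subring_set R"
  shows "0 \<in> R" "1 \<in> R" "a \<in> R \<Longrightarrow> b \<in> R \<Longrightarrow> a + b \<in> R"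
    "a \<in> R \<Longrightarrow> b \<in> R \<Longrightarrow> a * b \<in> R" "a \<in> R \<Longrightarrow> - a \<in> R"
  using assms by (auto simp: subring_set_def)

lemma idlD:
  assumes "idl R I"
  shows "I \<subseteq> R" "0 \<in> I" "a \<in> I \<Longrightarrow> b \<in> I \<Longrightarrow> a + b \<in> I" "r \<in> R \<Longrightarrow> a \<in> I \<Longrightarrow> r * a \<in> I"
  using assms by (auto simp: idl_def)

lemma gen_base: "subring_set R \<Longrightarrow> s \<in> S \<Longrightarrow> s \<in> gen R S"
  using gen.step[of 1 R s S 0] by (auto simp: subring_set_def)

lemma gen_add: "p \<in> gen R S \<Longrightarrow> q \<in> gen R S \<Longrightarrow> p + q \<in> gen R S"
  by (induction rule: gen.induct) (auto simp: add.assoc intro: gen.step)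

lemma gen_mult:
  assumes "subring_set R" "p \<in> gen R S" "r \<in> R"
  shows "r * p \<in> gen R S"
  using assms(2)
proof (induction rule: gen.induct)
  case (step r' s p)
  then have "r * r' * s + r * p \<in> gen R S"
    using assms by (intro gen.step) (auto simp: subring_set_def)
  then show ?case by (simp add: distrib_left mult.assoc)
qed simp

lemma gen_subset:
  assumes "subring_set R" "S \<subseteq> R"
  shows "gen R S \<subseteq> R"
proof
  fix p assume "p \<in> gen R S"
  then show "p \<in> R" by (induction rule: gen.induct) (use assms in \<open>auto simp: subring_set_def\<close>)
qed

lemma gen_least: "idl R I \<Longrightarrow> S \<subseteq> I \<Longrightarrow> gen R S \<subseteq> I"
proof
  fix p assume "p \<in> gen R S" "idl R I" "S \<subseteq> I"
  then show "p \<in> I" by (induction rule: gen.induct) (auto simp: idl_def)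
qed

lemma gen_mono: "S \<subseteq> T \<Longrightarrow> gen R S \<subseteq> gen R T"
proof
  fix p assume "p \<in> gen R S" "S \<subseteq> T"
  then show "p \<in> gen R T" by (induction rule: gen.induct) (auto intro: gen.step)
qed

lemma idl_gen: "subring_set R \<Longrightarrow> S \<subseteq> R \<Longrightarrow> idl R (gen R S)"
  by (auto simp: idl_def gen_add gen_mult dest: gen_subset)

lemma idl_uminus: "subring_set R \<Longrightarrow> idl R I \<Longrightarrow> a \<in> I \<Longrightarrow> - a \<in> I"
proof -
  assume "subring_set R" "idl R I" "a \<in> I"
  then have "- 1 * a \<in> I" unfolding idl_def subring_set_def by blast
  then show ?thesis by simp
qed

lemma idl_diff: "subring_set R \<Longrightarrow> idl R I \<Longrightarrow> a \<in> I \<Longrightarrow> b \<in> I \<Longrightarrow> a - b \<in> I"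
  using idl_uminus[of R I b] unfolding idl_def by (metis add_uminus_conv_diff)

lemma idl_sum: "idl R I \<Longrightarrow> (\<And>i. i \<in> A \<Longrightarrow> f i \<in> I) \<Longrightarrow> sum f A \<in> I"
  by (induction A rule: infinite_finite_induct) (auto simp: idl_def)

text \<open>The union of the chain is an ideal. Each of its finitely many generators lies in some
  member of the chain, hence all of them lie in a single one.\<close>

lemma noeth_chain:
  assumes R: "noeth R" "subring_set R" and I: "\<And>k. idl R (I k)" "\<And>k. I k \<subseteq> I (Suc k)"
  shows "\<exists>k. \<forall>j. I j \<subseteq> I k"
proof -
  have mono: "i \<le> j \<Longrightarrow> I i \<subseteq> I j" for i j
    by (rule lift_Suc_mono_le[of I]) (use I in auto)
  have "idl R (\<Union>k. I k)"
    unfolding idl_def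
  proof safe
    fix a b i j assume "a \<in> I i" "b \<in> I j"
    then have "a \<in> I (max i j)" "b \<in> I (max i j)"
      using mono[of i "max i j"] mono[of j "max i j"] by auto
    then have "a + b \<in> I (max i j)" using I(1) by (auto simp: idl_def)
    then show "a + b \<in> (\<Union>k. I k)" by blast
  next
    fix r a i assume "r \<in> R" "a \<in> I i"
    then have "r * a \<in> I i" using I(1)[of i] by (simp add: idl_def)
    then show "r * a \<in> (\<Union>k. I k)" by blast
  next
    fix x i assume "x \<in> I i"
    then show "x \<in> R" using I(1)[of i] by (auto simp: idl_def)
  next
    show "0 \<in> (\<Union>k. I k)" using I(1)[of 0] by (auto simp: idl_def)
  qed
  then obtain F where F: "finite F" "F \<subseteq> (\<Union>k. I k)" "(\<Union>k. I k) \<subseteq> gen R F"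
    using R(1) unfolding noeth_def by blast
  have "\<exists>k. F \<subseteq> I k" using F(1,2)
  proof (induction F)
    case (insert x F)
    then obtain k j where "F \<subseteq> I k" "x \<in> I j" by auto
    then have "insert x F \<subseteq> I (max k j)"
      using mono[of k "max k j"] mono[of j "max k j"] by auto
    then show ?case ..
  qed auto
  then obtain k where "F \<subseteq> I k" ..
  then have "gen R F \<subseteq> I k" using I(1) by (intro gen_least)
  then show ?thesis using F(3) by blast
qed

text \<open>The relation is oriented so that larger ideals count as smaller: induction assumes the
  claim for all strictly larger ideals, and minimal elements are ideals maximal with a given
  property.\<close>

lemma noeth_wf:
  assumes "noeth R" "subring_set R"
  shows "wf {(J, I). idl R I \<and> idl R J \<and> I \<subset> J}"
  unfolding wf_iff_no_infinite_down_chain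
proof (rule notI, elim exE)
  fix f assume f: "\<forall>i. (f (Suc i), f i) \<in> {(J, I). idl R I \<and> idl R J \<and> I \<subset> J}"
  then have "\<exists>k. \<forall>j. f j \<subseteq> f k" by (intro noeth_chain[OF assms]) auto
  then show False using f by blast
qed

lemma noeth_max:
  assumes "noeth R" "subring_set R" "idl R I" "P I"
  shows "\<exists>J. idl R J \<and> P J \<and> (\<forall>J'. idl R J' \<longrightarrow> J \<subset> J' \<longrightarrow> \<not> P J')"
proof -
  obtain J where "J \<in> {J. idl R J \<and> P J}"
    "\<And>J'. (J', J) \<in> {(J, I). idl R I \<and> idl R J \<and> I \<subset> J} \<Longrightarrow> J' \<notin> {J. idl R J \<and> P J}"
    using wfE_min[OF noeth_wf[OF assms(1,2)], of I "{J. idl R J \<and> P J}"] assms(3,4) by auto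
  then show ?thesis by (intro exI[of _ J]) auto
qed

subsection \<open>Hilbert's basis theorem\<close>

text \<open>Univariate polynomials with coefficients in a subset. Evaluation at
  \<open>mp_var n\<close> maps \<open>poly_over (polys n)\<close> onto \<open>polys (Suc n)\<close>,
  so the induction on the number of variables stays within one type.\<close>

definition poly_over :: "'a::comm_ring_1 set \<Rightarrow> 'a poly set" where
  "poly_over R = {C. \<forall>i. coeff C i \<in> R}"

lemma subring_poly_over: "subring_set R \<Longrightarrow> subring_set (poly_over R)"
  unfolding subring_set_def poly_over_def
proof (safe, goal_cases)
  case (2 i)
  then show ?case by (cases i) (auto simp: one_pCons)
next
  case (4 a b i)
  have "sum f A \<in> R" if "\<And>x. x \<in> A \<Longrightarrow> f x \<in> R" for f :: "nat \<Rightarrow> 'a" and A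
    using that 4 by (induction A rule: infinite_finite_induct) auto
  then show ?case using 4 unfolding coeff_mult by auto
qed auto

lemma poly_over_monom: "subring_set R \<Longrightarrow> r \<in> R \<Longrightarrow> monom r k \<in> poly_over R"
  by (auto simp: poly_over_def subring_set_def)

text \<open>If I were not finitely generated, one could keep choosing f k of minimal degree in I
  outside the ideal of its predecessors. The ideals of leading coefficients stabilise, so the
  leading term of some f n can be cancelled by its predecessors, against the minimality of its
  degree.\<close>

lemma noeth_poly_over:
  assumes R: "noeth R" "subring_set R"
  shows "noeth (poly_over R)"
  unfolding noeth_def
proof (safe, rule ccontr)
  let ?P = "poly_over R"
  have sP: "subring_set ?P" using R by (intro subring_poly_over)
  fix I assume I: "idl ?P I" and "\<nexists>F. finite F \<and> F \<subseteq> I \<and> I \<subseteq> gen ?P F"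
  then have nfg: "\<exists>g. g \<in> I - gen ?P F" if "finite F" "F \<subseteq> I" for F using that by blast
  let ?Q = "\<lambda>(f :: nat \<Rightarrow> 'a poly) k r. r \<in> I - gen ?P (f ` {..<k}) \<and> (\<forall>g \<in> I - gen ?P (f ` {..<k}). degree r \<le> degree g)"
  have "\<exists>f. \<forall>k. ?Q f k (f k)"
  proof (rule dependent_wellorder_choice[where P = ?Q])
    fix r k and f g :: "nat \<Rightarrow> 'a poly" assume "\<And>y. y < k \<Longrightarrow> f y = g y"
    then have "f ` {..<k} = g ` {..<k}" by auto
    then show "?Q f k r = ?Q g k r" by simp
  next
    fix k and f :: "nat \<Rightarrow> 'a poly" assume "\<And>y. y < k \<Longrightarrow> ?Q f y (f y)"
    then have "\<exists>g. g \<in> I - gen ?P (f ` {..<k})" by (intro nfg) auto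
    then obtain g where g: "g \<in> I - gen ?P (f ` {..<k})" ..
    show "\<exists>r. ?Q f k r"
      using ex_has_least_nat[of "\<lambda>g. g \<in> I - gen ?P (f ` {..<k})" g degree] g by blast
  qed
  then obtain f where f0: "\<And>k. ?Q f k (f k)" by (elim exE) (rule that, erule spec)
  have f: "f k \<in> I" "f k \<notin> gen ?P (f ` {..<k})"
    "g \<in> I \<Longrightarrow> g \<notin> gen ?P (f ` {..<k}) \<Longrightarrow> degree (f k) \<le> degree g" for k g
    using f0[of k] by auto
  let ?a = "\<lambda>k. lead_coeff (f k)"
  have fP: "f k \<in> ?P" for k using f(1) I by (auto simp: idl_def)
  have a: "?a k \<in> R" for k using fP by (auto simp: poly_over_def)
  have "\<exists>k. \<forall>j. gen R (?a ` {..<j}) \<subseteq> gen R (?a ` {..<k})"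
  proof (rule noeth_chain[OF R, of "\<lambda>j. gen R (?a ` {..<j})"])
    show "idl R (gen R (?a ` {..<k}))" for k using a by (intro idl_gen R) auto
    show "gen R (?a ` {..<k}) \<subseteq> gen R (?a ` {..<Suc k})" for k by (intro gen_mono) auto
  qed
  then obtain n where n: "\<And>j. gen R (?a ` {..<j}) \<subseteq> gen R (?a ` {..<n})" by blast
  have "?a n \<in> gen R (?a ` {..<Suc n})" using R(2) by (intro gen_base) auto
  then have an: "?a n \<in> gen R (?a ` {..<n})" using n by blast
  let ?d = "degree (f n)"
  \<comment> \<open>Earlier elements were chosen from a larger set, so degrees increase with the
    index and every f i can be shifted up to degree \<open>?d\<close>.\<close>
  have deg: "degree (f i) \<le> ?d" if "i < n" for i
  proof (rule f(3))
    have "f ` {..<i} \<subseteq> f ` {..<n}" using that by auto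
    from gen_mono[OF this, of ?P] show "f n \<notin> gen ?P (f ` {..<i})" using f(2)[of n] by blast
  qed (rule f)
  have "\<exists>q \<in> gen ?P (f ` {..<n}). coeff q ?d = p \<and> degree q \<le> ?d" if "p \<in> gen R (?a ` {..<n})" for p
    using that
  proof (induction rule: gen.induct)
    case zero
    show ?case by (rule bexI[of _ 0]) auto
  next
    case (step r s p)
    then obtain q i where q: "q \<in> gen ?P (f ` {..<n})" "coeff q ?d = p" "degree q \<le> ?d"
      and i: "i < n" "s = ?a i" by auto
    let ?q = "monom r (?d - degree (f i)) * f i + q"
    have "?q \<in> gen ?P (f ` {..<n})"
      using q i step R by (intro gen.step) (auto intro: poly_over_monom)
    moreover have "degree (monom r (?d - degree (f i)) * f i) \<le> ?d"
      using degree_mult_le[of "monom r (?d - degree (f i))" "f i"] degree_monom_le[of r "?d - degree (f i)"] deg[OF i(1)]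
      by linarith
    then have "degree ?q \<le> ?d" using q by (intro degree_add_le)
    moreover have "coeff ?q ?d = r * s + p"
      using q i deg[OF i(1)] by (simp add: coeff_monom_mult)
    ultimately show ?case by blast
  qed
  from this[OF an] obtain q where q: "q \<in> gen ?P (f ` {..<n})" "coeff q ?d = ?a n" "degree q \<le> ?d"
    by blast
  have "q \<in> I" using gen_least[OF I, of "f ` {..<n}"] f(1) q by auto
  then have "f n - q \<in> I" using f(1) by (intro idl_diff[OF sP I])
  moreover have ng: "f n - q \<notin> gen ?P (f ` {..<n})"
    using gen_add[of "f n - q" ?P "f ` {..<n}" q] q f(2)[of n] by auto
  ultimately have "?d \<le> degree (f n - q)" by (rule f(3))
  moreover have "degree (f n - q) \<le> ?d" using q by (intro degree_diff_le) auto
  ultimately have "degree (f n - q) = ?d" by simp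
  then have "lead_coeff (f n - q) = 0" using q by simp
  then have "f n - q = 0" by (simp only: leading_coeff_0_iff)
  then show False using ng by simp
qed

lemma polys_0E: "p \<in> polys 0 \<Longrightarrow> \<exists>c. p = mp_const c"
  by (induction rule: polys_induct) (auto simp flip: mpc.hom_add mpc.hom_mult)

lemma polys_Suc_poly:
  fixes p :: "'k::comm_ring_1 mpoly"
  assumes "p \<in> polys (Suc n)"
  shows "\<exists>C \<in> poly_over (polys n). p = poly C (mp_var n)"
proof -
  have s: "subring_set (poly_over (polys n :: 'k mpoly set))" by (intro subring_poly_over subring_polys)
  show ?thesis using assms
  proof (induction rule: polys_induct)
    case (const c)
    show ?case by (rule bexI[of _ "[:mp_const c:]"]) (auto simp: poly_over_def coeff_pCons split: nat.splits)
  next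
    case (var i)
    show ?case
    proof (cases "i = n")
      case True
      then show ?thesis
        by (intro bexI[of _ "[:0, 1:]"]) (auto simp: poly_over_def coeff_pCons split: nat.splits)
    next
      case False
      then show ?thesis using var
        by (intro bexI[of _ "[:mp_var i:]"]) (auto simp: poly_over_def coeff_pCons split: nat.splits)
    qed
  next
    case (add p q)
    then obtain A B where "A \<in> poly_over (polys n)" "p = poly A (mp_var n)"
      "B \<in> poly_over (polys n)" "q = poly B (mp_var n)" by blast
    then show ?case using s by (intro bexI[of _ "A + B"]) (simp_all add: subring_setD)
  next
    case (mult p q)
    then obtain A B where "A \<in> poly_over (polys n)" "p = poly A (mp_var n)"
      "B \<in> poly_over (polys n)" "q = poly B (mp_var n)" by blast
    then show ?case using s by (intro bexI[of _ "A * B"]) (simp_all add: subring_setD)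
  qed
qed

lemma poly_over_polys_Suc: "C \<in> poly_over (polys n) \<Longrightarrow> poly C (mp_var n) \<in> polys (Suc n)"
  unfolding poly_altdef by (intro polys_intros) (auto simp: poly_over_def intro: polys_mono)

text \<open>Constants form a field, which settles the base. In the step an ideal is pulled back
  along evaluation at the last variable and its generators are pushed forward.\<close>

theorem noeth_polys: "noeth (polys n :: 'k::field mpoly set)"
proof (induction n)
  case 0
  show ?case unfolding noeth_def
  proof safe
    fix I :: "'k mpoly set" assume I: "idl (polys 0) I"
    show "\<exists>F. finite F \<and> F \<subseteq> I \<and> I \<subseteq> gen (polys 0) F"
    proof (cases "I \<subseteq> {0}")
      case True
      then show ?thesis by (intro exI[of _ "{}"]) auto
    next
      case False
      then obtain q where q: "q \<in> I" "q \<noteq> 0" by auto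
      then obtain c where c: "q = mp_const c" using I polys_0E by (fastforce simp: idl_def)
      then have "c \<noteq> 0" using q by auto
      have "p \<in> gen (polys 0) {q}" if "p \<in> I" for p
      proof -
        have e: "p * mp_const (1 / c) * q + 0 = p"
          using \<open>c \<noteq> 0\<close> by (simp add: c mult.assoc flip: mpc.hom_mult)
        have "p * mp_const (1 / c) * q + 0 \<in> gen (polys 0) {q}"
          using that I by (intro gen.step polys_mult) (auto simp: idl_def)
        then show ?thesis unfolding e .
      qed
      then show ?thesis using q by (intro exI[of _ "{q}"]) auto
    qed
  qed
next
  case (Suc n)
  let ?P = "poly_over (polys n) :: 'k mpoly poly set"
  show ?case unfolding noeth_def
  proof safe
    fix I :: "'k mpoly set" assume I: "idl (polys (Suc n)) I"
    let ?J = "{C \<in> ?P. poly C (mp_var n) \<in> I}"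
    have sP: "subring_set ?P" by (intro subring_poly_over subring_polys)
    have "idl ?P ?J"
      unfolding idl_def
    proof (intro conjI ballI)
      fix A B assume "A \<in> ?J" "B \<in> ?J"
      then show "A + B \<in> ?J" using sP I by (simp add: idlD subring_setD)
    next
      fix r A assume "r \<in> ?P" "A \<in> ?J"
      then show "r * A \<in> ?J" using sP I by (simp add: idlD subring_setD poly_over_polys_Suc)
    next
      show "0 \<in> ?J" using sP I by (simp add: idlD subring_setD)
    qed blast
    with noeth_poly_over[OF Suc subring_polys, unfolded noeth_def]
    have "\<exists>F. finite F \<and> F \<subseteq> ?J \<and> ?J \<subseteq> gen ?P F" by (elim allE[of _ ?J] impE)
    then obtain F where F: "finite F" "F \<subseteq> ?J" "?J \<subseteq> gen ?P F" by (elim exE conjE)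
    have *: "poly C (mp_var n) \<in> gen (polys (Suc n)) ((\<lambda>C. poly C (mp_var n)) ` F)"
      if "C \<in> gen ?P F" for C using that
      by (induction rule: gen.induct) (auto intro!: gen.step poly_over_polys_Suc)
    have "I \<subseteq> gen (polys (Suc n)) ((\<lambda>C. poly C (mp_var n)) ` F)"
    proof
      fix p assume p: "p \<in> I"
      then obtain C where "C \<in> ?P" "p = poly C (mp_var n)"
        using I polys_Suc_poly unfolding idl_def by blast
      then show "p \<in> gen (polys (Suc n)) ((\<lambda>C. poly C (mp_var n)) ` F)"
        using p F(3) * by blast
    qed
    then show "\<exists>F. finite F \<and> F \<subseteq> I \<and> I \<subseteq> gen (polys (Suc n)) F"
      using F by (intro exI[of _ "(\<lambda>C. poly C (mp_var n)) ` F"]) auto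
  qed
qed

section \<open>Etale algebras over polynomial rings are reduced\<close>

text \<open>\<open>expand c p\<close> is p(c + T x) as a polynomial in T. Its coefficient at T^j is
  the homogeneous part of degree j in the Taylor expansion of p at c.\<close>

definition expand :: "(nat \<Rightarrow> 'k::comm_ring_1) \<Rightarrow> 'k mpoly \<Rightarrow> 'k mpoly poly" where
  "expand c = mp_extend (\<lambda>a. [:mp_const a:]) (\<lambda>i. [:mp_const (c i), mp_var i:])"

lemma comm_ring_hom_pCons_const: "comm_ring_hom (\<lambda>a. [:mp_const a:])"
  by (rule comm_ring_homI) (auto simp: mpc.hom_add mpc.hom_mult)

lemma comm_ring_hom_expand: "comm_ring_hom (expand c)"
  unfolding expand_def by (rule comm_ring_hom_mp_extend[OF comm_ring_hom_pCons_const])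

interpretation expand: comm_ring_hom "expand c" for c :: "nat \<Rightarrow> 'k::comm_ring_1"
  by (rule comm_ring_hom_expand)

lemma expand_const [simp]: "expand c (mp_const a) = [:mp_const a:]"
  unfolding expand_def by (rule mp_extend_const[OF comm_ring_hom_pCons_const])

lemma expand_var [simp]: "expand c (mp_var i) = [:mp_const (c i), mp_var i:]"
  unfolding expand_def by (rule mp_extend_var[OF comm_ring_hom_pCons_const])

text \<open>Plays the part of the k-th power of the maximal ideal of c. Stated by divisibility by
  T^k instead of generators, the order of vanishing is the order of a univariate polynomial at 0,
  which is additive on products over a domain.\<close>

definition vanishing :: "nat \<Rightarrow> (nat \<Rightarrow> 'k::comm_ring_1) \<Rightarrow> nat \<Rightarrow> 'k mpoly set" where
  "vanishing N c k = {p \<in> polys N. monom 1 k dvd expand c p}"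

lemma idl_vanishing: "idl (polys N) (vanishing N c k)"
  by (auto simp: idl_def vanishing_def expand.hom_add expand.hom_mult intro: polys_intros)

lemma vanishing_mult:
  "p \<in> vanishing N c j \<Longrightarrow> q \<in> vanishing N c k \<Longrightarrow> p * q \<in> vanishing N c (j + k)"
  using mult_dvd_mono[of "monom 1 j" "expand c p" "monom 1 k" "expand c q"]
  by (auto simp: vanishing_def expand.hom_mult mult_monom intro: polys_mult)

lemma vanishing_mono: "j \<le> k \<Longrightarrow> vanishing N c k \<subseteq> vanishing N c j"
  by (auto simp: vanishing_def monom_1_dvd_iff')

lemma vanishing_one: "p \<in> vanishing N c 1 \<longleftrightarrow> p \<in> polys N \<and> ev c p = 0"
proof -
  have "poly (expand c p) 0 = mp_const (ev c p)" for p
    by (rule mpoly_hom_eq)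
      (auto intro!: comm_ring_homI simp: expand.hom_add expand.hom_mult ev.hom_add ev.hom_mult mpc.hom_add mpc.hom_mult)
  then have "coeff (expand c p) 0 = mp_const (ev c p)" by (simp add: poly_0_coeff_0)
  moreover have "mp_const a = 0 \<longleftrightarrow> a = 0" for a :: 'a
  proof
    assume "mp_const a = 0"
    then have "ev c (mp_const a) = ev c 0" by (simp only:)
    then show "a = 0" by simp
  qed simp
  ultimately show ?thesis by (auto simp: vanishing_def monom_1_dvd_iff')
qed

lemmas vanishing_1 = vanishing_one vanishing_one[unfolded One_nat_def]

lemma order_power: "p \<noteq> 0 \<Longrightarrow> order a (p ^ n) = n * order a (p :: 'a::idom poly)"
  by (induction n) (simp_all add: order_mult)

text \<open>Orders at T = 0 are additive because the coefficients form a domain: e ord(p) \<ge> d >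
  e (k - 1) forces ord(p) \<ge> k.\<close>

lemma vanishing_root:
  fixes c :: "nat \<Rightarrow> 'k::field"
  assumes p: "p \<in> polys N" "p ^ e \<in> vanishing N c d" and d: "e * (k - 1) < d" and k: "k > 0"
  shows "p \<in> vanishing N c k"
proof (cases "expand c p = 0")
  case False
  have *: "monom 1 j dvd q \<longleftrightarrow> q = 0 \<or> j \<le> order 0 q" for j and q :: "'k mpoly poly"
    using order_divides[of 0 j q] by (simp add: monom_altdef)
  have "d \<le> e * order 0 (expand c p)"
    using p False by (simp add: vanishing_def * expand.hom_power order_power)
  then have "e * (k - 1) < e * order 0 (expand c p)" using d by linarith
  then have "k \<le> order 0 (expand c p)" using k by auto
  then show ?thesis using p by (simp add: vanishing_def *)
qed (use p in \<open>simp add: vanishing_def\<close>)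

text \<open>Pigeonhole: in a monomial of degree greater than N k in the N differences x_i - c_i,
  some exponent is at least k.\<close>

lemma vanishing_subset:
  fixes c :: "nat \<Rightarrow> 'k::field"
  assumes Q: "idl (polys N) Q" and k: "\<And>i. i < N \<Longrightarrow> (mp_var i - mp_const (c i)) ^ k \<in> Q"
  shows "vanishing N c (N * k + 1) \<subseteq> Q"
proof
  fix p assume p: "p \<in> vanishing N c (N * k + 1)"
  \<comment> \<open>Move c to the origin, where \<open>expand\<close> merely sorts the monomials by
    total degree.\<close>
  define q where "q = mp_subst (\<lambda>i. mp_var i + mp_const (c i)) p"
  have q: "q \<in> polys N" unfolding q_def using p
    by (intro polys_subst) (auto simp: vanishing_def intro: polys_intros)
  have pq: "p = mp_subst (\<lambda>i. mp_var i - mp_const (c i)) q"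
    unfolding q_def subst_subst using p
    by (intro subst_id[symmetric]) (auto simp: subst.hom_add vanishing_def)
  have "expand c p = expand (\<lambda>_. 0) q" unfolding q_def
    by (rule mpoly_hom_eq) (auto intro!: comm_ring_homI simp: expand.hom_add expand.hom_mult subst.hom_add subst.hom_mult)
  then have dvd: "monom 1 (N * k + 1) dvd expand (\<lambda>_. 0) q" using p by (simp add: vanishing_def)
  define deg where "deg = (\<lambda>t :: nat \<Rightarrow>\<^sub>0 nat. \<Sum>i\<in>Poly_Mapping.keys t. Poly_Mapping.lookup t i)"
  have mono: "(\<Prod>i\<in>S. [:0, mp_var i:] ^ f i) = monom (\<Prod>i\<in>S. mp_var i ^ f i :: 'k mpoly) (\<Sum>i\<in>S. f i)"
    if "finite S" for S and f :: "nat \<Rightarrow> nat"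
  proof -
    have "[:0, x:] = monom x 1" for x :: "'k mpoly" by (simp add: monom_Suc monom_0)
    then have "[:0, x:] ^ j = monom (x ^ j) j" for x :: "'k mpoly" and j by (simp only: monom_power) simp
    note pow = this
    show ?thesis using that by (induction S) (simp_all add: mult_monom pow)
  qed
  have single: "expand (\<lambda>_. 0) (Poly_Mapping.single t a) = monom (Poly_Mapping.single t a) (deg t)" for t and a :: 'k
    unfolding single_eq_mono mp_mono_def expand.hom_mult expand.hom_prod expand.hom_power
    by (simp add: mono deg_def smult_monom)
  have "Poly_Mapping.lookup (coeff (expand (\<lambda>_. 0) r) j) t = (if deg t = j then Poly_Mapping.lookup r t else 0)"
    for r :: "'k mpoly" and j t
    by (induction r rule: mpoly_induct)
      (auto simp: single lookup_single when_def expand.hom_add lookup_add)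
  then have deg: "N * k < deg t" if "t \<in> Poly_Mapping.keys q" for t
  proof (rule_tac ccontr)
    assume *: "\<And>(r :: 'k mpoly) j t. Poly_Mapping.lookup (coeff (expand (\<lambda>_. 0) r) j) t = (if deg t = j then Poly_Mapping.lookup r t else 0)"
      and "\<not> N * k < deg t"
    then have "coeff (expand (\<lambda>_. 0) q) (deg t) = 0" using dvd by (simp add: monom_1_dvd_iff')
    then have "Poly_Mapping.lookup q t = 0" using *[of q "deg t" t] by simp
    then show False using that by (simp add: in_keys_iff)
  qed
  have "mp_subst (\<lambda>i. mp_var i - mp_const (c i)) (Poly_Mapping.single t a) \<in> Q"
    if t: "t \<in> Poly_Mapping.keys q" for t a
  proof -
    have tN: "Poly_Mapping.keys t \<subseteq> {..<N}" using q t by (auto simp: polys_def)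
    have "\<exists>i\<in>Poly_Mapping.keys t. k \<le> Poly_Mapping.lookup t i"
    proof (rule ccontr)
      assume "\<not> ?thesis"
      then have "deg t \<le> (\<Sum>i\<in>Poly_Mapping.keys t. k)" unfolding deg_def by (intro sum_mono) auto
      also have "\<dots> \<le> N * k" using card_mono[OF _ tN] by simp
      finally show False using deg[OF t] by simp
    qed
    then obtain i where i: "i \<in> Poly_Mapping.keys t" "k \<le> Poly_Mapping.lookup t i" ..
    let ?y = "\<lambda>i. mp_var i - mp_const (c i)"
    have y: "?y j \<in> polys N" if "j < N" for j using that by (intro polys_intros) auto
    have e: "?y i ^ Poly_Mapping.lookup t i = ?y i ^ (Poly_Mapping.lookup t i - k) * ?y i ^ k"
      using i(2) by (simp flip: power_add)
    have "?y i ^ Poly_Mapping.lookup t i \<in> Q"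
      unfolding e using i tN by (intro idlD(4)[OF Q] polys_power y k) auto
    then have "mp_const a * (\<Prod>j\<in>Poly_Mapping.keys t - {i}. ?y j ^ Poly_Mapping.lookup t j)
        * ?y i ^ Poly_Mapping.lookup t i \<in> Q"
      using i tN by (intro idlD(4)[OF Q] polys_mult polys_prod polys_power y) auto
    also have "mp_const a * (\<Prod>j\<in>Poly_Mapping.keys t - {i}. ?y j ^ Poly_Mapping.lookup t j)
        * ?y i ^ Poly_Mapping.lookup t i = mp_subst ?y (Poly_Mapping.single t a)"
      unfolding single_eq_mono mp_mono_def subst.hom_mult subst.hom_prod subst.hom_power
      using i by (simp add: prod.remove[of _ i] ac_simps)
    finally show ?thesis .
  qed
  then have "(\<Sum>t\<in>Poly_Mapping.keys q. mp_subst (\<lambda>i. mp_var i - mp_const (c i)) (Poly_Mapping.single t (Poly_Mapping.lookup q t))) \<in> Q"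
    by (intro idl_sum[OF Q])
  then show "p \<in> Q" by (simp add: pq sum_single_lookup flip: subst.hom_sum)
qed

subsection \<open>Krull's intersection theorem\<close>

definition isum :: "'a::comm_ring_1 set \<Rightarrow> 'a set \<Rightarrow> 'a set" where
  "isum I J = {a + b | a b. a \<in> I \<and> b \<in> J}"

lemma isumI: "a \<in> I \<Longrightarrow> b \<in> J \<Longrightarrow> a + b \<in> isum I J"
  by (auto simp: isum_def)

lemma idl_isum:
  assumes "subring_set R" "idl R I" "idl R J"
  shows "idl R (isum I J)"
  unfolding idl_def
proof (intro conjI ballI)
  show "isum I J \<subseteq> R" using assms idlD(1)[of R] by (auto simp: isum_def intro!: subring_setD)
  show "0 \<in> isum I J" using isumI[of 0 I 0 J] assms by (simp add: idlD)
  fix x y assume "x \<in> isum I J" "y \<in> isum I J"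
  then obtain a b a' b' where "x = a + b" "a \<in> I" "b \<in> J" "y = a' + b'" "a' \<in> I" "b' \<in> J"
    by (auto simp: isum_def)
  then have "x + y = (a + a') + (b + b')" "a + a' \<in> I" "b + b' \<in> J"
    using assms by (auto simp: idlD)
  then show "x + y \<in> isum I J" by (metis isumI)
next
  fix r x assume r: "r \<in> R" "x \<in> isum I J"
  then obtain a b where "x = a + b" "a \<in> I" "b \<in> J" by (auto simp: isum_def)
  then have "r * x = r * a + r * b" "r * a \<in> I" "r * b \<in> J"
    using assms r by (auto simp: idlD distrib_left)
  then show "r * x \<in> isum I J" by (metis isumI)
qed

lemma isum_left: "idl R J \<Longrightarrow> I \<subseteq> isum I J"
  using isumI[of _ I 0 J] by (auto simp: idlD)

lemma isum_right: "idl R I \<Longrightarrow> J \<subseteq> isum I J"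
  using isumI[of 0 I _ J] by (auto simp: idlD)

lemma isum_least: "idl R Q \<Longrightarrow> I \<subseteq> Q \<Longrightarrow> J \<subseteq> Q \<Longrightarrow> isum I J \<subseteq> Q"
  by (auto simp: isum_def subset_iff idlD)

lemma idl_scale:
  assumes "subring_set R" "idl R I" "p \<in> R"
  shows "idl R ((\<lambda>u. u * p) ` I)"
  unfolding idl_def
proof (intro conjI ballI)
  show "(\<lambda>u. u * p) ` I \<subseteq> R" using assms idlD(1)[OF assms(2)] by (auto intro!: subring_setD)
  show "0 \<in> (\<lambda>u. u * p) ` I" using idlD(2)[OF assms(2)] by force
  fix x y assume "x \<in> (\<lambda>u. u * p) ` I" "y \<in> (\<lambda>u. u * p) ` I"
  then obtain a b where "x = a * p" "y = b * p" "a \<in> I" "b \<in> I" by auto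
  then have "x + y = (a + b) * p" "a + b \<in> I" using assms by (auto simp: idlD distrib_right)
  then show "x + y \<in> (\<lambda>u. u * p) ` I" by blast
next
  fix r x assume "r \<in> R" "x \<in> (\<lambda>u. u * p) ` I"
  then obtain a where "x = a * p" "a \<in> I" by auto
  then have "r * x = (r * a) * p" "r * a \<in> I" using assms \<open>r \<in> R\<close> by (auto simp: idlD mult.assoc)
  then show "r * x \<in> (\<lambda>u. u * p) ` I" by blast
qed

lemma idl_self: "subring_set R \<Longrightarrow> idl R R"
  by (auto simp: idl_def subring_setD)

text \<open>Let m be the maximal ideal of c. From p \<in> A + m p one gets p = a + u p with u(c) =
  0, and h = 1 - u does the job. The membership is obtained from an ideal Q that is maximal among
  those containing A + m p but not p: such a Q contains a power of m, and then the hypothesis puts p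
  into Q.\<close>

lemma krull_intersection:
  fixes c :: "nat \<Rightarrow> 'k::field"
  assumes A: "idl (polys N) A" and p: "p \<in> polys N" "\<And>k. p \<in> isum A (vanishing N c k)"
  shows "\<exists>h \<in> polys N. ev c h \<noteq> 0 \<and> h * p \<in> A"
proof -
  let ?R = "polys N :: 'k mpoly set"
  let ?m = "vanishing N c 1"
  have R: "noeth ?R" "subring_set ?R" by (rule noeth_polys subring_polys)+
  define B where "B = isum A ((\<lambda>u. u * p) ` ?m)"
  have mp: "idl ?R ((\<lambda>u. u * p) ` ?m)" using R p by (intro idl_scale idl_vanishing)
  have B: "idl ?R B" unfolding B_def using R A mp by (intro idl_isum)
  have "p \<in> B"
  proof (rule ccontr)
    assume "p \<notin> B"
    then have "\<exists>Q. idl ?R Q \<and> (B \<subseteq> Q \<and> p \<notin> Q) \<and>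
        (\<forall>J. idl ?R J \<longrightarrow> Q \<subset> J \<longrightarrow> \<not> (B \<subseteq> J \<and> p \<notin> J))"
      by (intro noeth_max[OF R B]) simp
    then obtain Q where Q: "idl ?R Q" "B \<subseteq> Q" "p \<notin> Q"
      and max: "\<And>J. idl ?R J \<Longrightarrow> Q \<subset> J \<Longrightarrow> \<not> (B \<subseteq> J \<and> p \<notin> J)"
      by (elim exE conjE) (rule that, assumption+, simp)
    have up: "u * p \<in> Q" if "u \<in> ?m" for u
      using that Q(2) isum_right[OF A, of "(\<lambda>u. u * p) ` ?m"] unfolding B_def by blast
    \<comment> \<open>Every u in m is nilpotent modulo Q. The ideals of all r with u^j r \<in> Q
      stabilise at some j = k, and unless u^k is in Q, maximality puts p into Q + (u^k).\<close>
    have pow: "\<exists>k. u ^ k \<in> Q" if u: "u \<in> ?m" for u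
    proof -
      have uR: "u ^ j \<in> ?R" for j using u by (auto simp: vanishing_def intro: polys_power)
      define I where "I = (\<lambda>j. {r \<in> ?R. u ^ j * r \<in> Q})"
      have "\<exists>k. \<forall>j. I j \<subseteq> I k"
      proof (rule noeth_chain[OF R])
        show "idl ?R (I j)" for j unfolding idl_def
        proof (intro conjI ballI)
          fix a b assume "a \<in> I j" "b \<in> I j"
          then show "a + b \<in> I j" using Q(1) by (auto simp: I_def distrib_left idlD intro: polys_add)
        next
          fix r a assume "r \<in> ?R" "a \<in> I j"
          then show "r * a \<in> I j" using idlD(4)[OF Q(1), of r "u ^ j * a"]
            by (auto simp: I_def ac_simps intro: polys_mult)
        qed (use Q(1) in \<open>auto simp: I_def idlD\<close>)
        show "I j \<subseteq> I (Suc j)" for j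
          using idlD(4)[OF Q(1) uR[of 1]] by (auto simp: I_def mult.assoc)
      qed
      then obtain k where k: "\<And>j. I j \<subseteq> I k" by blast
      have "u ^ k \<in> Q"
      proof (rule ccontr)
        assume nk: "u ^ k \<notin> Q"
        define J where "J = isum Q ((\<lambda>r. r * u ^ k) ` ?R)"
        have uk: "idl ?R ((\<lambda>r. r * u ^ k) ` ?R)" using R uR by (intro idl_scale idl_self)
        have J: "idl ?R J" unfolding J_def using R Q uk by (intro idl_isum)
        have QJ: "Q \<subseteq> J" unfolding J_def using uk by (rule isum_left)
        have "u ^ k \<in> (\<lambda>r. r * u ^ k) ` ?R" by (rule image_eqI[of _ _ 1]) simp_all
        then have ukJ: "u ^ k \<in> J" unfolding J_def by (rule subsetD[OF isum_right[OF Q(1)]])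
        have "Q \<subset> J" using QJ ukJ nk by auto
        then have "p \<in> J" using max[OF J] QJ Q(2) by auto
        then obtain q r where qr: "p = q + r * u ^ k" "q \<in> Q" "r \<in> ?R" by (auto simp: J_def isum_def)
        \<comment> \<open>As u p and u q lie in Q, so does r u^(k+1). By stabilisation r u^k lies in
          Q, and with it p.\<close>
        have "u * q \<in> Q" using idlD(4)[OF Q(1) uR[of 1]] qr by simp
        then have "u * p - u * q \<in> Q" using up[OF u] Q R by (intro idl_diff[of ?R])
        then have "r \<in> I (Suc k)" using qr by (simp add: I_def algebra_simps)
        then have "r * u ^ k \<in> Q" using k[of "Suc k"] by (auto simp: I_def ac_simps)
        then show False using qr Q by (auto simp: idlD)
      qed
      then show ?thesis ..
    qed
    have "\<exists>k. \<forall>i<N. (mp_var i - mp_const (c i)) ^ k \<in> Q"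
    proof -
      have "\<exists>k. (mp_var i - mp_const (c i)) ^ k \<in> Q" if "i < N" for i
        using that by (intro pow) (auto simp: vanishing_1 ev.hom_minus intro: polys_diff)
      then obtain f where f: "\<And>i. i < N \<Longrightarrow> (mp_var i - mp_const (c i)) ^ f i \<in> Q" by metis
      define k where "k = (\<Sum>i<N. f i)"
      have "(mp_var i - mp_const (c i)) ^ k \<in> Q" if "i < N" for i
      proof -
        have "f i \<le> k" unfolding k_def using that by (intro member_le_sum) auto
        then have "(mp_var i - mp_const (c i)) ^ k = (mp_var i - mp_const (c i)) ^ (k - f i) * (mp_var i - mp_const (c i)) ^ f i"
          by (simp flip: power_add)
        then show ?thesis using f[OF that] that
          by (auto intro!: idlD(4)[OF Q(1)] polys_power polys_diff)
      qed
      then show ?thesis by blast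
    qed
    then obtain k where "\<And>i. i < N \<Longrightarrow> (mp_var i - mp_const (c i)) ^ k \<in> Q" by blast
    then have "vanishing N c (N * k + 1) \<subseteq> Q" by (rule vanishing_subset[OF Q(1)])
    moreover have "A \<subseteq> Q" using Q(2) isum_left[OF mp, of A] unfolding B_def by blast
    ultimately have "p \<in> Q" using p(2)[of "N * k + 1"] isum_least[OF Q(1)] by blast
    then show False using Q by simp
  qed
  then obtain a b where ab: "p = a + b" "a \<in> A" "b \<in> (\<lambda>u. u * p) ` ?m"
    unfolding B_def isum_def by blast
  then obtain u where u: "b = u * p" "u \<in> ?m" by (elim imageE) (rule that)
  have "p = a + u * p" using ab(1) unfolding u(1) .
  then have "p - u * p = a + u * p - u * p" by (rule arg_cong)
  then have "(1 - u) * p \<in> A" using ab(2) by (simp add: left_diff_distrib)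
  moreover have "ev c (1 - u) \<noteq> 0" "1 - u \<in> ?R" using u
    by (auto simp: vanishing_1 ev.hom_minus intro: polys_diff)
  ultimately show ?thesis by blast
qed

subsection \<open>Newton approximation\<close>

lemma subst_diff_idl:
  assumes p: "p \<in> polys N" and I: "idl (polys M) I"
    and \<sigma>: "\<And>i. i < N \<Longrightarrow> \<sigma> i \<in> polys M" "\<And>i. i < N \<Longrightarrow> \<tau> i \<in> polys M"
    and d: "\<And>i. i < N \<Longrightarrow> \<sigma> i - \<tau> i \<in> I"
  shows "mp_subst \<sigma> p - mp_subst \<tau> p \<in> I"
  using p
proof (induction rule: polys_induct)
  case (add p q)
  then show ?case using idlD(3)[OF I, of "mp_subst \<sigma> p - mp_subst \<tau> p" "mp_subst \<sigma> q - mp_subst \<tau> q"]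
    by (simp add: subst.hom_add algebra_simps)
next
  case (mult p q)
  have "mp_subst \<sigma> p * (mp_subst \<sigma> q - mp_subst \<tau> q) + mp_subst \<tau> q * (mp_subst \<sigma> p - mp_subst \<tau> p) \<in> I"
    using mult \<sigma> by (intro idlD(3,4)[OF I] polys_subst) auto
  then show ?case by (simp add: subst.hom_mult algebra_simps)
qed (use d I in \<open>auto simp: idlD\<close>)

text \<open>Splits the Taylor remainder of a product into multiples of the remainders of the factors
  and products of an element vanishing at c with a first order increment. All four summands visibly
  lie in the ideal J of the next lemma.\<close>

lemma product_rule_remainder:
  "x * y - x' * y' - (a * dy + b * dx) = x * (y - y' - dy) + (x - a) * dy + (y' * (x - x' - dx) + (y' - b) * dx)"
  for x :: "'a::comm_ring_1"
  by (simp add: algebra_simps)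

text \<open>First order Taylor expansion: \<open>I\<close> stands for the ideal of the increments, \<open>J\<close> for its product
  with the maximal ideal of \<open>c\<close>.\<close>

lemma subst_taylor:
  fixes c :: "nat \<Rightarrow> 'k::comm_ring_1"
  assumes p: "p \<in> polys N" and I: "idl (polys N) I" and J: "idl (polys N) J"
    and IJ: "\<And>u v. u \<in> vanishing N c 1 \<Longrightarrow> v \<in> I \<Longrightarrow> u * v \<in> J"
    and \<sigma>: "\<And>i. i < N \<Longrightarrow> \<sigma> i \<in> polys N" "\<And>i. i < N \<Longrightarrow> \<tau> i \<in> polys N"
    and c: "\<And>i. i < N \<Longrightarrow> ev c (\<sigma> i) = c i" "\<And>i. i < N \<Longrightarrow> ev c (\<tau> i) = c i"
    and d: "\<And>i. i < N \<Longrightarrow> \<sigma> i - \<tau> i \<in> I"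
  shows "mp_subst \<sigma> p - mp_subst \<tau> p - (\<Sum>i<N. mp_const (ev c (mp_deriv i p)) * (\<sigma> i - \<tau> i)) \<in> J"
    (is "?T p \<in> J")
  using p
proof (induction rule: polys_induct)
  case (const a)
  then show ?case using J by (simp add: idlD)
next
  case (var i)
  have "(\<Sum>j<N. mp_const (ev c (mp_deriv j (mp_var i))) * (\<sigma> j - \<tau> j)) = (\<Sum>j<N. if j = i then \<sigma> j - \<tau> j else 0)"
    by (intro sum.cong) (auto simp: deriv_var)
  then show ?case using J var by (simp add: idlD)
next
  case (add p q)
  have "?T (p + q) = ?T p + ?T q"
    by (simp add: subst.hom_add deriv_add ev.hom_add mpc.hom_add distrib_right sum.distrib)
  then show ?case using add idlD(3)[OF J] by simp
next
  case (mult p q)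
  let ?D = "\<lambda>p. \<Sum>i<N. mp_const (ev c (mp_deriv i p)) * (\<sigma> i - \<tau> i)"
  have D: "?D r \<in> I" for r using d by (intro idl_sum[OF I] idlD(4)[OF I]) auto
  have ev: "ev c (mp_subst \<sigma> r) = ev c r" "ev c (mp_subst \<tau> r) = ev c r" if "r \<in> polys N" for r
    using that c by (auto simp: ev_subst intro: ev_cong)
  have m: "mp_subst \<sigma> r - mp_const (ev c r) \<in> vanishing N c 1" "mp_subst \<tau> r - mp_const (ev c r) \<in> vanishing N c 1"
    if "r \<in> polys N" for r
    using that ev \<sigma> by (auto simp: vanishing_1 ev.hom_minus intro!: polys_diff polys_subst)
  have "?D (p * q) = mp_const (ev c p) * ?D q + mp_const (ev c q) * ?D p"
    unfolding sum_distrib_left sum.distrib[symmetric]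
    by (intro sum.cong) (auto simp: deriv_mult ev.hom_add ev.hom_mult mpc.hom_add mpc.hom_mult algebra_simps)
  then have "?T (p * q) = mp_subst \<sigma> p * ?T q + (mp_subst \<sigma> p - mp_const (ev c p)) * ?D q
      + (mp_subst \<tau> q * ?T p + (mp_subst \<tau> q - mp_const (ev c q)) * ?D p)"
    unfolding subst.hom_mult by (simp only: product_rule_remainder)
  also have "\<dots> \<in> J"
    using mult \<sigma> by (intro idlD(3)[OF J] idlD(4)[OF J] IJ m D polys_subst) auto
  finally show ?case .
qed

section \<open>Radicals of generated ideals\<close>

definition rad_gen :: "nat \<Rightarrow> 'k::comm_ring_1 mpoly set \<Rightarrow> 'k mpoly set" where
  "rad_gen N G = {p \<in> polys N. \<exists>e. p ^ e \<in> gen (polys N) G}"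

lemma idl_rad_gen:
  fixes G :: "'k::comm_ring_1 mpoly set"
  assumes "G \<subseteq> polys N"
  shows "idl (polys N) (rad_gen N G)"
proof -
  let ?A = "gen (polys N) G"
  have A: "idl (polys N) ?A" using assms by (intro idl_gen subring_polys)
  show ?thesis
    unfolding idl_def
  proof (intro conjI ballI)
    show "0 \<in> rad_gen N G" using A by (auto simp: rad_gen_def intro!: exI[of _ 1])
    fix p q assume "p \<in> rad_gen N G" "q \<in> rad_gen N G"
    then obtain e f where pq: "p \<in> polys N" "q \<in> polys N" "p ^ e \<in> ?A" "q ^ f \<in> ?A"
      by (auto simp: rad_gen_def)
    \<comment> \<open>With exponent e + f, each term of the binomial expansion has k \<ge> e or n -
      k \<ge> f.\<close>
    have "of_nat (n choose k) * p ^ k * q ^ (n - k) \<in> ?A" if n: "n = e + f" for k n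
    proof (cases "e \<le> k")
      case True
      have "of_nat (n choose k) * p ^ (k - e) * q ^ (n - k) * p ^ e \<in> ?A"
        using pq by (intro idlD(4)[OF A] polys_mult polys_power) (auto simp flip: mpc.hom_of_nat)
      also have "of_nat (n choose k) * p ^ (k - e) * q ^ (n - k) * p ^ e = of_nat (n choose k) * (p ^ (k - e) * p ^ e) * q ^ (n - k)"
        by (simp add: ac_simps)
      finally show ?thesis using True by (simp flip: power_add)
    next
      case False
      have "of_nat (n choose k) * p ^ k * q ^ (n - k - f) * q ^ f \<in> ?A"
        using pq by (intro idlD(4)[OF A] polys_mult polys_power) (auto simp flip: mpc.hom_of_nat)
      also have "of_nat (n choose k) * p ^ k * q ^ (n - k - f) * q ^ f = of_nat (n choose k) * p ^ k * (q ^ (n - k - f) * q ^ f)"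
        by (simp add: ac_simps)
      finally show ?thesis using False n by (simp flip: power_add)
    qed
    then have "(p + q) ^ (e + f) \<in> ?A" unfolding binomial_ring by (intro idl_sum[OF A]) auto
    then show "p + q \<in> rad_gen N G" using pq by (auto simp: rad_gen_def intro: polys_add)
  next
    fix r p :: "'k mpoly" assume "r \<in> polys N" "p \<in> rad_gen N G"
    then obtain e where e: "r \<in> polys N" "p \<in> polys N" "p ^ e \<in> ?A" by (auto simp: rad_gen_def)
    then have "(r * p) ^ e \<in> ?A"
      unfolding power_mult_distrib by (intro idlD(4)[OF A] polys_power)
    then show "r * p \<in> rad_gen N G" using e by (auto simp: rad_gen_def intro: polys_mult)
  qed (auto simp: rad_gen_def)
qed

text \<open>A square system at a zero c, normalised so that its Jacobian matrix in the variables
  from M on is the identity at c. Newton's method can then use the derivative at c throughout and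
  needs no matrix inverse, at the price of gaining only one order per step.\<close>

locale nondegenerate =
  fixes N M :: nat and c :: "nat \<Rightarrow> 'k::field" and g :: "nat \<Rightarrow> 'k mpoly"
  assumes g: "\<And>k. M \<le> k \<Longrightarrow> k < N \<Longrightarrow> g k \<in> polys N"
    and g_0: "\<And>k. M \<le> k \<Longrightarrow> k < N \<Longrightarrow> ev c (g k) = 0"
    and g_deriv: "\<And>k l. M \<le> k \<Longrightarrow> k < N \<Longrightarrow> M \<le> l \<Longrightarrow> l < N \<Longrightarrow>
      ev c (mp_deriv l (g k)) = (if k = l then 1 else 0)"
begin

abbreviation "R \<equiv> polys N :: 'k mpoly set"
abbreviation "G \<equiv> g ` {M..<N}"
abbreviation "A \<equiv> gen R G"

text \<open>The Newton iterates that solve \<open>g = 0\<close> for the variables \<open>M, \<dots>, N - 1\<close>.\<close>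

primrec Y :: "nat \<Rightarrow> nat \<Rightarrow> 'k mpoly" where
  "Y 0 i = (if i < M then mp_var i else mp_const (c i))"
| "Y (Suc d) i = (if i < M then mp_var i else Y d i - mp_subst (Y d) (g i))"

lemma G: "G \<subseteq> R"
  using g by auto

lemma idl_A: "idl R A"
  using G by (intro idl_gen subring_polys)

lemma Y_polys: "i < N \<Longrightarrow> Y d i \<in> R"
  by (induction d arbitrary: i) (auto intro!: polys_diff polys_subst g)

lemma Y_less: "i < M \<Longrightarrow> Y d i = mp_var i"
  by (cases d) auto

lemma Y_c: "i < N \<Longrightarrow> ev c (Y d i) = c i"
proof (induction d arbitrary: i)
  case (Suc d)
  have "ev c (mp_subst (Y d) (g i)) = ev c (g i)" if "M \<le> i"
    unfolding ev_subst using Suc that by (intro ev_cong[OF g]) auto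
  then show ?case using Suc by (auto simp: ev.hom_minus g_0)
qed auto

text \<open>The first M increments vanish and the Jacobian matrix at c is the identity, so the
  linear part of the expansion of g k is the k-th increment alone.\<close>

lemma g_taylor:
  assumes I: "idl R I" and J: "idl R J"
    and IJ: "\<And>u v. u \<in> vanishing N c 1 \<Longrightarrow> v \<in> I \<Longrightarrow> u * v \<in> J"
    and \<sigma>: "\<And>i. i < N \<Longrightarrow> \<sigma> i \<in> R" "\<And>i. i < N \<Longrightarrow> \<tau> i \<in> R"
    and c: "\<And>i. i < N \<Longrightarrow> ev c (\<sigma> i) = c i" "\<And>i. i < N \<Longrightarrow> ev c (\<tau> i) = c i"
    and d: "\<And>i. i < N \<Longrightarrow> \<sigma> i - \<tau> i \<in> I" "\<And>i. i < M \<Longrightarrow> \<sigma> i = \<tau> i"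
    and k: "M \<le> k" "k < N"
  shows "mp_subst \<sigma> (g k) - mp_subst \<tau> (g k) - (\<sigma> k - \<tau> k) \<in> J"
proof -
  have "(\<Sum>i<N. mp_const (ev c (mp_deriv i (g k))) * (\<sigma> i - \<tau> i)) = (\<Sum>i<N. if i = k then \<sigma> i - \<tau> i else 0)"
  proof (intro sum.cong refl)
    fix i assume "i \<in> {..<N}"
    then show "mp_const (ev c (mp_deriv i (g k))) * (\<sigma> i - \<tau> i) = (if i = k then \<sigma> i - \<tau> i else 0)"
      using k d(2)[of i] g_deriv[of k i] by (cases "i < M") auto
  qed
  then show ?thesis
    using subst_taylor[OF g[OF k] I J IJ \<sigma> c d(1)] k by simp
qed

text \<open>The old correction is minus g at the old iterate. Hence the new correction is minus the
  Taylor remainder between the two iterates and vanishes to one more order.\<close>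

lemma Y_step: "i < N \<Longrightarrow> Y (Suc d) i - Y d i \<in> vanishing N c (Suc d)"
proof (induction d arbitrary: i)
  case 0
  have "mp_subst (Y 0) (g i) \<in> vanishing N c 1" if "\<not> i < M"
  proof -
    have "ev c (mp_subst (Y 0) (g i)) = ev c (g i)"
      unfolding ev_subst using that 0 by (intro ev_cong[OF g] Y_c) auto
    moreover have "mp_subst (Y 0) (g i) \<in> R" using that 0 by (intro polys_subst[OF g] Y_polys) auto
    ultimately show ?thesis using that 0 by (simp add: vanishing_1 g_0)
  qed
  then show ?case using idlD(2)[OF idl_vanishing] idl_uminus[OF subring_polys idl_vanishing]
    by (auto simp: Y_less)
next
  case (Suc d)
  show ?case
  proof (cases "i < M")
    case False
    have "mp_subst (Y (Suc d)) (g i) - mp_subst (Y d) (g i) - (Y (Suc d) i - Y d i) \<in> vanishing N c (Suc (Suc d))"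
      using False Suc.prems vanishing_mult[of _ N c 1 _ "Suc d"]
      by (intro g_taylor[OF idl_vanishing idl_vanishing _ Y_polys Y_polys Y_c Y_c Suc.IH]) (auto simp: Y_less simp del: Y.simps)
    then have "- (mp_subst (Y (Suc d)) (g i) - mp_subst (Y d) (g i) - (Y (Suc d) i - Y d i)) \<in> vanishing N c (Suc (Suc d))"
      by (intro idl_uminus[OF subring_polys idl_vanishing])
    then show ?thesis using False by (simp add: algebra_simps)
  qed (use idlD(2)[OF idl_vanishing] in \<open>auto simp: Y_less\<close>)
qed

text \<open>Modulo A the variables themselves solve g = 0. Comparing this tautological solution with
  the iterates by Taylor expansion shows that the two agree to increasing order.\<close>

lemma var_minus_Y: "i < N \<Longrightarrow> mp_var i - Y d i \<in> isum A (vanishing N c (Suc d))"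
proof (induction d arbitrary: i)
  case 0
  have "mp_var i - Y 0 i \<in> vanishing N c 1"
    unfolding vanishing_1 using 0 Y_c[OF 0, of 0] Y_polys[OF 0, of 0]
    by (auto simp: ev.hom_minus simp del: Y.simps intro: polys_diff)
  from subsetD[OF isum_right[OF idl_A] this] show ?case by (simp only: One_nat_def)
next
  case (Suc d)
  let ?J = "\<lambda>d. isum A (vanishing N c d)"
  have J: "idl R (?J d)" for d by (intro idl_isum subring_polys idl_A idl_vanishing)
  show ?case
  proof (cases "i < M")
    case False
    have IJ: "u * v \<in> ?J (Suc (Suc d))" if u: "u \<in> vanishing N c 1" and v: "v \<in> ?J (Suc d)" for u v
    proof -
      obtain a b where v: "v = a + b" "a \<in> A" "b \<in> vanishing N c (Suc d)" using v by (auto simp: isum_def)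
      have "u * a \<in> A" "u * b \<in> vanishing N c (Suc (Suc d))"
        using u v vanishing_mult[of u N c 1 b "Suc d"] by (auto intro!: idlD(4)[OF idl_A] simp: vanishing_1)
      then show ?thesis using v by (auto simp: distrib_left intro: isumI)
    qed
    have "mp_subst mp_var (g i) - mp_subst (Y d) (g i) - (mp_var i - Y d i) \<in> ?J (Suc (Suc d))"
      using False Suc
      by (intro g_taylor[OF J J IJ _ Y_polys _ Y_c Suc.IH]) (auto simp: Y_less)
    moreover have "mp_subst mp_var (g i) = g i" using False Suc.prems by (intro subst_id[OF g]) auto
    ultimately have T: "g i - mp_subst (Y d) (g i) - (mp_var i - Y d i) \<in> ?J (Suc (Suc d))" by simp
    have "g i \<in> ?J (Suc (Suc d))"
      using False Suc.prems isum_left[OF idl_vanishing, of A N c "Suc (Suc d)"] gen_base[OF subring_polys, of "g i" G N]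
      by auto
    from idl_diff[OF subring_polys J this T]
    show ?thesis using False by (simp add: algebra_simps)
  qed (use idlD(2)[OF J] in \<open>auto simp: Y_less\<close>)
qed

text \<open>Substituting the iterate maps A into a high power of the maximal ideal, so p(Y)^e
  vanishes to high order and, orders being additive, so does p(Y). But p and p(Y) agree modulo A up
  to high order.\<close>

lemma nilpotent_approx:
  assumes p: "p \<in> rad_gen N G"
  shows "p \<in> isum A (vanishing N c k)"
proof (cases "k = 0")
  case True
  have "p \<in> vanishing N c 0" using p by (auto simp: vanishing_def rad_gen_def)
  then show ?thesis using True isum_right[OF idl_A] by auto
next
  case False
  obtain e where e: "p \<in> R" "p ^ e \<in> A" using p by (auto simp: rad_gen_def)
  \<comment> \<open>Large enough for two bounds: e (k - 1) < d + 1 for extracting the e-th root, and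
    k \<le> d + 1 for absorbing the error term b.\<close>
  define d where "d = e * k + k"
  have J: "idl R (isum A (vanishing N c (Suc d)))"
    by (intro idl_isum subring_polys idl_A idl_vanishing)
  have "mp_subst mp_var p - mp_subst (Y d) p \<in> isum A (vanishing N c (Suc d))"
    using e var_minus_Y by (intro subst_diff_idl[OF _ J] Y_polys) auto
  then have "p - mp_subst (Y d) p \<in> isum A (vanishing N c (Suc d))"
    using e by (simp add: subst_id)
  then obtain a b where ab: "p - mp_subst (Y d) p = a + b" "a \<in> A" "b \<in> vanishing N c (Suc d)"
    by (auto simp: isum_def)
  have gY: "mp_subst (Y d) (g i) \<in> vanishing N c (Suc d)" if "M \<le> i" "i < N" for i
    using Y_step[of i d] that idl_uminus[OF subring_polys idl_vanishing, of "- mp_subst (Y d) (g i)" N c "Suc d"]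
    by simp
  have "mp_subst (Y d) q \<in> vanishing N c (Suc d)" if "q \<in> A" for q using that
    by (induction rule: gen.induct)
      (auto simp: subst.hom_add subst.hom_mult intro!: idlD[OF idl_vanishing] polys_subst Y_polys gY)
  from this[OF e(2)] have pow: "mp_subst (Y d) p ^ e \<in> vanishing N c (Suc d)" by (simp add: subst.hom_power)
  have "e * (k - 1) \<le> e * k" by (intro mult_le_mono2) simp
  then have less: "e * (k - 1) < Suc d" unfolding d_def by linarith
  have "mp_subst (Y d) p \<in> R" using e(1) by (rule polys_subst) (rule Y_polys)
  then have "mp_subst (Y d) p \<in> vanishing N c k"
    using False by (intro vanishing_root[OF _ pow less]) simp_all
  moreover have "b \<in> vanishing N c k" using ab vanishing_mono[of k "Suc d" N c] by (auto simp: d_def)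
  ultimately have "mp_subst (Y d) p + b \<in> vanishing N c k" by (intro idlD(3)[OF idl_vanishing])
  then have "a + (mp_subst (Y d) p + b) \<in> isum A (vanishing N c k)" using ab by (intro isumI)
  moreover have "a + (mp_subst (Y d) p + b) = p" using ab(1) by (simp add: algebra_simps)
  ultimately show ?thesis by simp
qed

text \<open>Krull's theorem gives one h for each p. As the radical is finitely generated, the
  product of finitely many of them serves for all of it.\<close>

lemma reduced: "\<exists>h \<in> R. ev c h \<noteq> 0 \<and> (\<forall>p \<in> rad_gen N G. h * p \<in> A)"
proof -
  have "idl R (rad_gen N G)" using G by (rule idl_rad_gen)
  then obtain F where F: "finite F" "F \<subseteq> rad_gen N G" "rad_gen N G \<subseteq> gen R F"
    using noeth_polys[of N, where ?'k = 'k] unfolding noeth_def by blast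
  have "\<exists>h \<in> R. ev c h \<noteq> 0 \<and> (\<forall>p \<in> F. h * p \<in> A)" using F(1,2)
  proof (induction F)
    case empty
    show ?case by (rule bexI[of _ 1]) auto
  next
    case (insert p F)
    then obtain h where h: "h \<in> R" "ev c h \<noteq> 0" "\<forall>p\<in>F. h * p \<in> A" by auto
    have "p \<in> R" using insert by (auto simp: rad_gen_def)
    moreover have "p \<in> isum A (vanishing N c k)" for k using insert by (intro nilpotent_approx) auto
    ultimately obtain h' where h': "h' \<in> R" "ev c h' \<noteq> 0" "h' * p \<in> A"
      using krull_intersection[OF idl_A] by blast
    have "h * h' * q \<in> A" if "q \<in> insert p F" for q
    proof (cases "q = p")
      case True
      then show ?thesis using idlD(4)[OF idl_A h(1) h'(3)] by (simp add: mult.assoc)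
    next
      case False
      then have "h' * (h * q) \<in> A" using h(3) that by (intro idlD(4)[OF idl_A h'(1)]) auto
      then show ?thesis by (simp add: ac_simps)
    qed
    then show ?case using h h' by (intro bexI[of _ "h * h'"]) (auto simp: ev.hom_mult intro: polys_mult)
  qed
  then obtain h where h: "h \<in> R" "ev c h \<noteq> 0" "\<And>p. p \<in> F \<Longrightarrow> h * p \<in> A"
    by (elim bexE conjE) (rule that, assumption+, elim bspec)
  have "h * p \<in> A" if "p \<in> gen R F" for p using that
  proof (induction rule: gen.induct)
    case (step r s p)
    have "r * (h * s) \<in> A" using step(1) h(3)[OF step(2)] by (rule idlD(4)[OF idl_A])
    then have "r * (h * s) + h * p \<in> A" using step.IH by (rule idlD(3)[OF idl_A])
    then show ?case by (simp add: algebra_simps)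
  qed auto
  then show ?thesis using h F(3) by blast
qed

end

section \<open>Jacobian matrices and reducedness near a nondegenerate zero\<close>

definition jacobian :: "nat \<Rightarrow> 'k::comm_ring_1 mpoly vec \<Rightarrow> 'k mpoly mat" where
  "jacobian m g = mat (dim_vec g) (dim_vec g) (\<lambda>(i, j). mp_deriv (m + j) (g $ i))"

lemma det_polys:
  assumes "A \<in> carrier_mat n n" "\<And>i j. i < n \<Longrightarrow> j < n \<Longrightarrow> A $$ (i, j) \<in> polys N"
  shows "det A \<in> polys N"
proof -
  have "of_int k \<in> polys N" for k
    using polys_const[of "of_int k" N] unfolding mpc.hom_of_int .
  then show ?thesis
    unfolding det_def'[OF assms(1)] using assms(2)
    by (intro polys_sum polys_mult polys_prod) (auto simp: permutes_in_image)
qed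

lemma det_jacobian_polys:
  "(\<And>i. i < dim_vec g \<Longrightarrow> g $ i \<in> polys N) \<Longrightarrow> det (jacobian m g) \<in> polys N"
  by (rule det_polys[of _ "dim_vec g"]) (auto simp: jacobian_def intro: deriv_polys)

lemma inverse_matrix:
  fixes J :: "'k::field mat"
  assumes J: "J \<in> carrier_mat r r" and "det J \<noteq> 0"
  obtains B where "\<And>i l. i < r \<Longrightarrow> l < r \<Longrightarrow> (\<Sum>j<r. B i j * J $$ (j, l)) = (if i = l then 1 else 0)"
    "\<And>i l. i < r \<Longrightarrow> l < r \<Longrightarrow> (\<Sum>j<r. J $$ (i, j) * B j l) = (if i = l then 1 else 0)"
proof
  let ?B = "\<lambda>i j. adj_mat J $$ (i, j) / det J"
  note adj = adj_mat[OF J]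
  fix i l assume il: "i < r" "l < r"
  have "(\<Sum>j<r. adj_mat J $$ (i, j) * J $$ (j, l)) = (adj_mat J * J) $$ (i, l)"
    using il adj(1) J by (simp add: scalar_prod_def atLeast0LessThan)
  also have "\<dots> = det J * (if i = l then 1 else 0)" using il by (simp add: adj)
  finally show "(\<Sum>j<r. ?B i j * J $$ (j, l)) = (if i = l then 1 else 0)"
    using \<open>det J \<noteq> 0\<close> by (simp flip: sum_divide_distrib)
  have "(\<Sum>j<r. J $$ (i, j) * adj_mat J $$ (j, l)) = (J * adj_mat J) $$ (i, l)"
    using il adj(1) J by (simp add: scalar_prod_def atLeast0LessThan)
  also have "\<dots> = det J * (if i = l then 1 else 0)" using il by (simp add: adj)
  finally show "(\<Sum>j<r. J $$ (i, j) * ?B j l) = (if i = l then 1 else 0)"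
    using \<open>det J \<noteq> 0\<close> by (simp flip: sum_divide_distrib)
qed

lemma deriv_sum: "mp_deriv i (sum f A) = (\<Sum>a\<in>A. mp_deriv i (f a))"
  by (induction A rule: infinite_finite_induct) (simp_all add: deriv_add)

text \<open>Multiplying the equations by the inverse of their Jacobian matrix at c normalises the
  system. This is an invertible matrix of constants, so the ideal does not change.\<close>

lemma etale_locally_reduced:
  fixes g :: "'k::field mpoly vec"
  assumes g: "\<And>i. i < dim_vec g \<Longrightarrow> g $ i \<in> polys (m + dim_vec g)"
    and g0: "\<And>i. i < dim_vec g \<Longrightarrow> ev c (g $ i) = 0"
    and det: "ev c (det (jacobian m g)) \<noteq> 0"
  shows "\<exists>h \<in> polys (m + dim_vec g). ev c h \<noteq> 0 \<and>
    (\<forall>p \<in> rad_gen (m + dim_vec g) (set\<^sub>v g). h * p \<in> gen (polys (m + dim_vec g)) (set\<^sub>v g))"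
proof -
  let ?r = "dim_vec g"
  let ?N = "m + ?r"
  let ?R = "polys ?N :: 'k mpoly set"
  let ?A = "gen ?R (set\<^sub>v g)"
  define J where "J = map_mat (ev c) (jacobian m g)"
  have J: "J \<in> carrier_mat ?r ?r" "\<And>i l. i < ?r \<Longrightarrow> l < ?r \<Longrightarrow> J $$ (i, l) = ev c (mp_deriv (m + l) (g $ i))"
    by (auto simp: J_def jacobian_def)
  have "det J \<noteq> 0" using det by (simp add: J_def)
  then obtain B where
    B: "\<And>i l. i < ?r \<Longrightarrow> l < ?r \<Longrightarrow> (\<Sum>j<?r. B i j * J $$ (j, l)) = (if i = l then 1 else 0)"
      "\<And>i l. i < ?r \<Longrightarrow> l < ?r \<Longrightarrow> (\<Sum>j<?r. J $$ (i, j) * B j l) = (if i = l then 1 else 0)"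
    using inverse_matrix[OF J(1)] by blast
  define g' where "g' = (\<lambda>k. \<Sum>j<?r. mp_const (B (k - m) j) * g $ j)"
  have g'_A: "g' k \<in> ?A" for k unfolding g'_def
  proof (rule idl_sum[OF idl_gen[OF subring_polys]])
    show "set\<^sub>v g \<subseteq> ?R" using g by (auto simp: vec_set_def)
    fix j assume "j \<in> {..<?r}"
    then have "g $ j \<in> ?A" by (intro gen_base subring_polys) (auto simp: vec_set_def)
    then show "mp_const (B (k - m) j) * g $ j \<in> ?A" by (intro gen_mult subring_polys polys_const)
  qed
  interpret nd: nondegenerate ?N m c g'
  proof
    fix k assume "m \<le> k" "k < ?N"
    then show "g' k \<in> ?R" using g by (auto simp: g'_def intro!: polys_sum polys_mult)
    show "ev c (g' k) = 0" using g0 by (simp add: g'_def ev.hom_sum ev.hom_mult)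
    fix l assume l: "m \<le> l" "l < ?N"
    have "ev c (mp_deriv l (g' k)) = (\<Sum>j<?r. B (k - m) j * ev c (mp_deriv l (g $ j)))"
      by (simp add: g'_def deriv_sum deriv_mult ev.hom_sum ev.hom_mult)
    also have "\<dots> = (\<Sum>j<?r. B (k - m) j * J $$ (j, l - m))"
      using l by (intro sum.cong) (auto simp: J(2))
    also have "\<dots> = (if k = l then 1 else 0)"
      using l \<open>m \<le> k\<close> \<open>k < ?N\<close> by (subst B(1)) auto
    finally show "ev c (mp_deriv l (g' k)) = (if k = l then 1 else 0)" .
  qed
  \<comment> \<open>Multiplication by the Jacobian matrix at c recovers the original
    equations.\<close>
  have g_A: "g $ i \<in> nd.A" if "i < ?r" for i
  proof -
    have "(\<Sum>k<?r. mp_const (J $$ (i, k)) * g' (m + k)) = (\<Sum>k<?r. \<Sum>j<?r. mp_const (J $$ (i, k) * B k j) * g $ j)"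
      by (simp add: g'_def sum_distrib_left mpc.hom_mult mult.assoc)
    also have "\<dots> = (\<Sum>j<?r. \<Sum>k<?r. mp_const (J $$ (i, k) * B k j) * g $ j)"
      by (rule sum.swap)
    also have "\<dots> = (\<Sum>j<?r. mp_const (\<Sum>k<?r. J $$ (i, k) * B k j) * g $ j)"
      by (simp add: mpc.hom_sum sum_distrib_right)
    also have "\<dots> = (\<Sum>j<?r. if j = i then g $ j else 0)"
      using that by (intro sum.cong) (auto simp: B(2))
    also have "\<dots> = g $ i" using that by simp
    finally have "g $ i = (\<Sum>k<?r. mp_const (J $$ (i, k)) * g' (m + k))" ..
    also have "\<dots> \<in> nd.A"
      by (intro idl_sum[OF nd.idl_A] gen_mult subring_polys gen_base polys_const) auto
    finally show ?thesis .
  qed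
  have "?A \<subseteq> nd.A" using g_A by (intro gen_least nd.idl_A) (auto simp: vec_set_def)
  moreover have "nd.A \<subseteq> ?A" using g g'_A
    by (intro gen_least idl_gen subring_polys) (auto simp: vec_set_def)
  ultimately have "nd.A = ?A" by blast
  then show ?thesis using nd.reduced unfolding rad_gen_def by simp
qed

section \<open>The etale topology on points\<close>

lemma append_vec_assoc: "(a @\<^sub>v b) @\<^sub>v c = a @\<^sub>v (b @\<^sub>v c)"
  by (rule eq_vecI) (auto simp: index_append_vec)

lemma split_vec:
  assumes "c \<in> carrier_vec (m + n)"
  obtains a b where "c = a @\<^sub>v b" "a \<in> carrier_vec m" "b \<in> carrier_vec n"
proof
  show "c = vec m (\<lambda>i. c $ i) @\<^sub>v vec n (\<lambda>i. c $ (m + i))"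
    using assms by (intro eq_vecI) (auto simp: index_append_vec)
qed auto

lemma mp_value_cong: "p \<in> polys n \<Longrightarrow> (\<And>i. i < n \<Longrightarrow> a $ i = b $ i) \<Longrightarrow> mp_value a p = mp_value b p"
  unfolding mp_value_ev by (rule ev_cong)

lemma mp_value_append: "p \<in> polys m \<Longrightarrow> a \<in> carrier_vec m \<Longrightarrow> mp_value (a @\<^sub>v b) p = mp_value a p"
  by (rule mp_value_cong) (auto simp: index_append_vec)

section \<open>Square systems and the open sets they define\<close>

definition system :: "nat \<Rightarrow> 'k::comm_ring_1 mpoly vec \<Rightarrow> bool" where
  "system m g \<longleftrightarrow> (\<forall>i < dim_vec g. g $ i \<in> polys (m + dim_vec g))"

definition etale_zero :: "nat \<Rightarrow> 'k::comm_ring_1 mpoly vec \<Rightarrow> 'k vec \<Rightarrow> bool" where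
  "etale_zero m g c \<longleftrightarrow> (\<forall>i < dim_vec g. mp_value c (g $ i) = 0) \<and> mp_value c (det (jacobian m g)) \<noteq> 0"

definition etale_set :: "nat \<Rightarrow> 'k::field mpoly vec \<Rightarrow> 'k vec set" where
  "etale_set m g = {a \<in> carrier_vec m. \<exists>b \<in> carrier_vec (dim_vec g). etale_zero m g (a @\<^sub>v b)}"

definition etale_open :: "nat \<Rightarrow> 'k::field vec set \<Rightarrow> bool" where
  "etale_open m U \<longleftrightarrow> U \<subseteq> carrier_vec m \<and>
     (\<forall>a \<in> U. \<exists>g. system m g \<and> a \<in> etale_set m g \<and> etale_set m g \<subseteq> U)"

lemma etale_openD: "etale_open m U \<Longrightarrow> U \<subseteq> carrier_vec m"
  by (simp add: etale_open_def)

lemma etale_open_Union: "(\<And>U. U \<in> \<U> \<Longrightarrow> etale_open m U) \<Longrightarrow> etale_open m (\<Union>\<U>)"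
proof -
  assume U: "\<And>U. U \<in> \<U> \<Longrightarrow> etale_open m U"
  show ?thesis unfolding etale_open_def
  proof safe
    fix a U assume aU: "a \<in> U" "U \<in> \<U>"
    with U have "\<exists>g. system m g \<and> a \<in> etale_set m g \<and> etale_set m g \<subseteq> U" by (auto simp: etale_open_def)
    then show "\<exists>g. system m g \<and> a \<in> etale_set m g \<and> etale_set m g \<subseteq> \<Union>\<U>" using aU by blast
  qed (use U in \<open>auto dest: etale_openD\<close>)
qed

lemma etale_openI:
  assumes "\<And>a. a \<in> U \<Longrightarrow> \<exists>W. etale_open m W \<and> a \<in> W \<and> W \<subseteq> U"
  shows "etale_open m U"
proof -
  have "U = \<Union>{W. etale_open m W \<and> W \<subseteq> U}" using assms by blast
  moreover have "etale_open m (\<Union>{W. etale_open m W \<and> W \<subseteq> U})" by (rule etale_open_Union) auto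
  ultimately show ?thesis by simp
qed

lemma etale_open_etale_set: "system m g \<Longrightarrow> etale_open m (etale_set m g)"
  by (auto simp: etale_open_def etale_set_def)

text \<open>The equations g do not contain the unknowns of g', so the matrix is block
  triangular.\<close>

lemma det_jacobian_append:
  fixes g g' :: "'k::field mpoly vec"
  assumes "system m g"
  shows "det (jacobian m (g @\<^sub>v g')) = det (jacobian m g) * det (jacobian (m + dim_vec g) g')"
proof -
  let ?r = "dim_vec g" and ?s = "dim_vec g'"
  define X where "X = mat ?s ?r (\<lambda>(i, j). mp_deriv (m + j) (g' $ i))"
  have "jacobian m (g @\<^sub>v g') = four_block_mat (jacobian m g) (0\<^sub>m ?r ?s) X (jacobian (m + ?r) g')"
    by (rule eq_matI)
      (use assms in \<open>auto simp: jacobian_def X_def index_append_vec system_def deriv_polys_0\<close>)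
  then show ?thesis
    by (simp add: det_four_block_mat_upper_right_zero[of _ ?r _ ?s] jacobian_def X_def)
qed

lemma etale_zero_append:
  fixes g g' :: "'k::field mpoly vec"
  assumes g: "system m g" and "a \<in> carrier_vec (m + dim_vec g)"
  shows "etale_zero m (g @\<^sub>v g') (a @\<^sub>v b) \<longleftrightarrow> etale_zero m g a \<and> etale_zero (m + dim_vec g) g' (a @\<^sub>v b)"
proof -
  have "mp_value (a @\<^sub>v b) (g $ i) = mp_value a (g $ i)" if "i < dim_vec g" for i
    using that assms by (intro mp_value_append) (auto simp: system_def)
  moreover have "mp_value (a @\<^sub>v b) (det (jacobian m g)) = mp_value a (det (jacobian m g))"
    using assms by (intro mp_value_append det_jacobian_polys) (auto simp: system_def)
  moreover have all: "(\<forall>i < dim_vec (g @\<^sub>v g'). P ((g @\<^sub>v g') $ i)) \<longleftrightarrow> (\<forall>i < dim_vec g. P (g $ i)) \<and> (\<forall>i < dim_vec g'. P (g' $ i))" for P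
  proof safe
    fix i assume "\<forall>i < dim_vec (g @\<^sub>v g'). P ((g @\<^sub>v g') $ i)" "i < dim_vec g'"
    then show "P (g' $ i)" by (elim allE[of _ "dim_vec g + i"]) (simp add: index_append_vec)
  next
    fix i assume "\<forall>i < dim_vec (g @\<^sub>v g'). P ((g @\<^sub>v g') $ i)" "i < dim_vec g"
    then show "P (g $ i)" by (elim allE[of _ i]) (simp add: index_append_vec)
  qed (auto simp: index_append_vec)
  ultimately show ?thesis
    unfolding etale_zero_def det_jacobian_append[OF g] all[of "\<lambda>q. mp_value (a @\<^sub>v b) q = 0"]
    by (auto simp: mp_value_ev ev.hom_mult)
qed

text \<open>Etale maps compose: a system over the total space of g is appended to g.\<close>

lemma etale_open_image:
  assumes g: "system m g" and U: "etale_open (m + dim_vec g) U"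
  shows "etale_open m {a \<in> carrier_vec m. \<exists>b \<in> carrier_vec (dim_vec g). etale_zero m g (a @\<^sub>v b) \<and> a @\<^sub>v b \<in> U}"
  (is "etale_open m ?W")
  unfolding etale_open_def
proof safe
  fix a b assume a: "a \<in> carrier_vec m" and b: "b \<in> carrier_vec (dim_vec g)"
    and ab: "etale_zero m g (a @\<^sub>v b)" "a @\<^sub>v b \<in> U"
  obtain g' where g': "system (m + dim_vec g) g'" "a @\<^sub>v b \<in> etale_set (m + dim_vec g) g'"
    "etale_set (m + dim_vec g) g' \<subseteq> U" using U ab(2) by (auto simp: etale_open_def)
  have sys: "system m (g @\<^sub>v g')"
    using g g' by (auto simp: system_def index_append_vec add.assoc intro: polys_mono)
  have "a \<in> etale_set m (g @\<^sub>v g')"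
  proof -
    obtain b' where b': "b' \<in> carrier_vec (dim_vec g')" "etale_zero (m + dim_vec g) g' ((a @\<^sub>v b) @\<^sub>v b')"
      using g' by (auto simp: etale_set_def)
    then have "etale_zero m (g @\<^sub>v g') ((a @\<^sub>v b) @\<^sub>v b')"
      using a b ab by (subst etale_zero_append[OF g]) auto
    then show ?thesis using a b b' unfolding etale_set_def append_vec_assoc
      by (auto intro!: bexI[of _ "b @\<^sub>v b'"])
  qed
  moreover have "etale_set m (g @\<^sub>v g') \<subseteq> ?W"
  proof
    fix a assume "a \<in> etale_set m (g @\<^sub>v g')"
    then obtain c where a: "a \<in> carrier_vec m" and c: "c \<in> carrier_vec (dim_vec g + dim_vec g')" "etale_zero m (g @\<^sub>v g') (a @\<^sub>v c)"
      by (auto simp: etale_set_def)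
    obtain b b' where b: "c = b @\<^sub>v b'" "b \<in> carrier_vec (dim_vec g)" "b' \<in> carrier_vec (dim_vec g')"
      using c(1) by (rule split_vec)
    have "etale_zero m g (a @\<^sub>v b)" "etale_zero (m + dim_vec g) g' ((a @\<^sub>v b) @\<^sub>v b')"
      using c(2) a b by (simp_all add: etale_zero_append[OF g] flip: append_vec_assoc)
    moreover from this have "a @\<^sub>v b \<in> etale_set (m + dim_vec g) g'"
      using a b by (auto simp: etale_set_def)
    ultimately show "a \<in> ?W" using a b g'(3) by auto
  qed
  ultimately show "\<exists>g. system m g \<and> a \<in> etale_set m g \<and> etale_set m g \<subseteq> ?W" using sys by blast
qed

text \<open>Base change. Substituting polynomials for the base variables does not touch the
  unknowns, so the Jacobian determinant undergoes the same substitution. In effect polynomial maps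
  are continuous.\<close>

lemma etale_open_vimage:
  assumes \<phi>: "\<And>i. i < k \<Longrightarrow> \<phi> i \<in> polys m" and U: "etale_open k U"
  shows "etale_open m {a \<in> carrier_vec m. vec k (\<lambda>i. mp_value a (\<phi> i)) \<in> U}"
  unfolding etale_open_def
proof safe
  fix a assume a: "a \<in> carrier_vec m" "vec k (\<lambda>i. mp_value a (\<phi> i)) \<in> U"
  obtain g where g: "system k g" "vec k (\<lambda>i. mp_value a (\<phi> i)) \<in> etale_set k g" "etale_set k g \<subseteq> U"
    using U a(2) by (auto simp: etale_open_def)
  let ?r = "dim_vec g"
  define \<sigma> where "\<sigma> = (\<lambda>i. if i < k then \<phi> i else mp_var (m + (i - k)))"
  define g' where "g' = map_vec (mp_subst \<sigma>) g"
  have \<sigma>: "\<sigma> i \<in> polys (m + ?r)" if "i < k + ?r" for i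
    using that polys_mono[OF \<phi>, of i "m + ?r"] by (auto simp: \<sigma>_def)
  have dim: "dim_vec g' = ?r" by (simp add: g'_def)
  have sys: "system m g'"
    using g(1) \<sigma> by (auto simp: system_def g'_def intro!: polys_subst)
  have d: "mp_deriv (m + j) (mp_subst \<sigma> p) = mp_subst \<sigma> (mp_deriv (k + j) p)" if "p \<in> polys (k + ?r)" for p j
    using that
  proof (induction rule: polys_induct)
    case (var i)
    then show ?case using \<phi>[of i] deriv_polys_0[of "\<phi> i" m "m + j"] by (auto simp: \<sigma>_def deriv_var)
  qed (auto simp: subst.hom_add subst.hom_mult deriv_add deriv_mult)
  have "jacobian m g' = map_mat (mp_subst \<sigma>) (jacobian k g)"
    by (rule eq_matI) (use g(1) in \<open>auto simp: jacobian_def g'_def d system_def\<close>)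
  then have det: "det (jacobian m g') = mp_subst \<sigma> (det (jacobian k g))" by simp
  have val: "mp_value (a @\<^sub>v b) (mp_subst \<sigma> p) = mp_value (vec k (\<lambda>i. mp_value a (\<phi> i)) @\<^sub>v b) p"
    if "p \<in> polys (k + ?r)" "a \<in> carrier_vec m" "b \<in> carrier_vec ?r" for p a b
    unfolding mp_value_ev ev_subst using that(1)
  proof (rule ev_cong)
    fix i assume i: "i < k + ?r"
    show "ev (($) (a @\<^sub>v b)) (\<sigma> i) = (vec k (\<lambda>i. ev (($) a) (\<phi> i)) @\<^sub>v b) $ i"
      using i that(2,3) mp_value_append[OF \<phi>, of i a b]
      by (auto simp: \<sigma>_def index_append_vec mp_value_ev)
  qed
  have iff: "etale_zero m g' (a @\<^sub>v b) \<longleftrightarrow> etale_zero k g (vec k (\<lambda>i. mp_value a (\<phi> i)) @\<^sub>v b)"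
    if "a \<in> carrier_vec m" "b \<in> carrier_vec ?r" for a b
    unfolding etale_zero_def det using g(1) that
    by (auto simp: g'_def val system_def det_jacobian_polys)
  have *: "a \<in> etale_set m g' \<longleftrightarrow> vec k (\<lambda>i. mp_value a (\<phi> i)) \<in> etale_set k g" if "a \<in> carrier_vec m" for a
    using that by (simp add: etale_set_def dim iff)
  have "a \<in> etale_set m g'" using * a(1) g(2) by simp
  moreover have "etale_set m g' \<subseteq> {a \<in> carrier_vec m. vec k (\<lambda>i. mp_value a (\<phi> i)) \<in> U}"
  proof
    fix x assume x: "x \<in> etale_set m g'"
    then have "x \<in> carrier_vec m" by (simp add: etale_set_def)
    then show "x \<in> {a \<in> carrier_vec m. vec k (\<lambda>i. mp_value a (\<phi> i)) \<in> U}" using x g(3) * by blast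
  qed
  ultimately show "\<exists>g. system m g \<and> a \<in> etale_set m g \<and> etale_set m g \<subseteq> {a \<in> carrier_vec m. vec k (\<lambda>i. mp_value a (\<phi> i)) \<in> U}"
    using sys by blast
qed

text \<open>The equation y q = 1 in the unknown y has Jacobian q, which is nonzero at every
  solution.\<close>

lemma etale_open_nonzero:
  assumes q: "q \<in> polys m"
  shows "etale_open m {a \<in> carrier_vec m. mp_value a q \<noteq> (0 :: 'k::field)}"
proof -
  define g :: "'k mpoly vec" where "g = vec 1 (\<lambda>_. mp_var m * q - 1)"
  have sys: "system m g" using q by (auto simp: system_def g_def intro!: polys_diff polys_mult intro: polys_mono)
  have d: "mp_deriv m q = 0" using q by (rule deriv_polys_0) simp
  have det: "det (jacobian m g) = q"
    by (subst det_single) (auto simp: jacobian_def g_def deriv_diff deriv_mult deriv_var d)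
  have "etale_set m g = {a \<in> carrier_vec m. mp_value a q \<noteq> 0}"
  proof safe
    fix a assume "a \<in> etale_set m g"
    then show "a \<in> carrier_vec m" "mp_value a q = 0 \<Longrightarrow> False"
      using q by (auto simp: etale_set_def etale_zero_def det mp_value_append)
  next
    fix a assume a: "a \<in> carrier_vec m" "mp_value a q \<noteq> 0"
    then have "etale_zero m g (a @\<^sub>v vec 1 (\<lambda>_. 1 / mp_value a q))"
      unfolding etale_zero_def det using mp_value_append[OF q a(1)]
      by (auto simp: g_def mp_value_ev ev.hom_minus ev.hom_mult index_append_vec)
    then show "a \<in> etale_set m g" using a
      by (auto simp: etale_set_def g_def intro!: bexI[of _ "vec 1 (\<lambda>_. 1 / mp_value a q)"])
  qed
  with etale_open_etale_set[OF sys] show ?thesis by simp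
qed

lemma etale_open_carrier: "etale_open m (carrier_vec m)"
  using etale_open_nonzero[of 1 m] by (simp add: mp_value_ev)

lemma vec_take:
  assumes "a \<in> carrier_vec m" "m \<le> n" "\<And>i. i < m \<Longrightarrow> c $ i = a $ i"
  shows "vec m (\<lambda>i. mp_value c (mp_var i)) = a"
  by (rule eq_vecI) (use assms in \<open>auto simp: mp_value_ev\<close>)

text \<open>A fibre product: V is pulled back to the total space of a system for U, and the result
  is projected down.\<close>

lemma etale_open_Int:
  assumes U: "etale_open m U" and V: "etale_open m V"
  shows "etale_open m (U \<inter> V)"
proof (rule etale_openI)
  fix a assume a: "a \<in> U \<inter> V"
  then obtain g where g: "system m g" "a \<in> etale_set m g" "etale_set m g \<subseteq> U" using U by (auto simp: etale_open_def)
  define V' where "V' = {c \<in> carrier_vec (m + dim_vec g). vec m (\<lambda>i. mp_value c (mp_var i)) \<in> V}"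
  have V': "etale_open (m + dim_vec g) V'" unfolding V'_def by (intro etale_open_vimage V) auto
  let ?W = "{a \<in> carrier_vec m. \<exists>b \<in> carrier_vec (dim_vec g). etale_zero m g (a @\<^sub>v b) \<and> a @\<^sub>v b \<in> V'}"
  have take: "vec m (\<lambda>i. mp_value (a @\<^sub>v b) (mp_var i)) = a" if "a \<in> carrier_vec m" for a b :: "'a vec"
    using that by (intro vec_take) (auto simp: index_append_vec)
  have "?W = etale_set m g \<inter> V" using etale_openD[OF V] by (auto simp: etale_set_def V'_def take)
  then show "\<exists>W. etale_open m W \<and> a \<in> W \<and> W \<subseteq> U \<inter> V"
    using etale_open_image[OF g(1) V'] g a by (intro exI[of _ ?W]) auto
qed

lemma etale_open_UN: "(\<And>x. x \<in> X \<Longrightarrow> etale_open m (U x)) \<Longrightarrow> etale_open m (\<Union>x\<in>X. U x)"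
  using etale_open_Union[of "U ` X" m] by blast

section \<open>Transport of open sets along field automorphisms\<close>

definition mp_map :: "('k::comm_ring_1 \<Rightarrow> 'k) \<Rightarrow> 'k mpoly \<Rightarrow> 'k mpoly" where
  "mp_map s = mp_extend (\<lambda>c. mp_const (s c)) mp_var"

text \<open>Applying s to the coefficients of a system commutes with derivatives and determinants. A
  ring homomorphism on a field is injective, so zeros and nonzero values are both preserved, and
  surjectivity makes every solution of the new system the image of an old one.\<close>

lemma etale_open_hom:
  fixes s :: "'k::field \<Rightarrow> 'k"
  assumes s: "comm_ring_hom s" "surj s" and U: "etale_open m U"
  shows "etale_open m (map_vec s ` U)"
  unfolding etale_open_def
proof safe
  interpret s: comm_ring_hom s by fact
  have sc: "comm_ring_hom (\<lambda>c. mp_const (s c))" by (rule comm_ring_hom_comp[OF comm_ring_hom_const s(1)])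
  interpret map: comm_ring_hom "mp_map s" unfolding mp_map_def by (rule comm_ring_hom_mp_extend[OF sc])
  have mc: "mp_map s (mp_const c) = mp_const (s c)" for c
    unfolding mp_map_def by (rule mp_extend_const[OF sc])
  have mv: "mp_map s (mp_var i) = mp_var i" for i
    unfolding mp_map_def by (rule mp_extend_var[OF sc])
  have s_0: "s x = 0 \<longleftrightarrow> x = 0" for x
  proof
    assume "s x = 0"
    then have "s (x * inverse x) = 0" by (simp add: s.hom_mult)
    then show "x = 0" by (cases "x = 0") auto
  qed simp
  have d: "mp_deriv i (mp_map s p) = mp_map s (mp_deriv i p)" for i p
  proof -
    obtain n where "p \<in> polys n" using ex_polys by blast
    then show ?thesis
      by (induction rule: polys_induct) (auto simp: mc mv map.hom_add map.hom_mult deriv_add deriv_mult deriv_var)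
  qed
  have val: "mp_value (map_vec s c) (mp_map s p) = s (mp_value c p)" if "p \<in> polys n" "c \<in> carrier_vec n" for c p n
    unfolding mp_value_ev
    by (rule polys_hom_eq[OF that(1) comm_ring_hom_comp[OF comm_ring_hom_ev map.comm_ring_hom_axioms]
          comm_ring_hom_comp[OF s(1) comm_ring_hom_ev]]) (use that(2) in \<open>auto simp: mc mv\<close>)
  have polys: "p \<in> polys n \<Longrightarrow> mp_map s p \<in> polys n" for p n
    by (induction rule: polys_induct) (auto simp: mc mv map.hom_add map.hom_mult intro: polys_intros)
  fix a assume a: "a \<in> U"
  then show "map_vec s a \<in> carrier_vec m" using etale_openD[OF U] by auto
  obtain g where g: "system m g" "a \<in> etale_set m g" "etale_set m g \<subseteq> U" using U a by (auto simp: etale_open_def)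
  let ?r = "dim_vec g"
  define g' where "g' = map_vec (mp_map s) g"
  have dim: "dim_vec g' = ?r" by (simp add: g'_def)
  have sys: "system m g'" using g(1) by (auto simp: system_def g'_def polys)
  have "jacobian m g' = map_mat (mp_map s) (jacobian m g)"
    by (rule eq_matI) (auto simp: jacobian_def g'_def d)
  then have det: "det (jacobian m g') = mp_map s (det (jacobian m g))" by simp
  have iff: "etale_zero m g' (map_vec s c) \<longleftrightarrow> etale_zero m g c" if "c \<in> carrier_vec (m + ?r)" for c
  proof -
    note c = that
    have "mp_value (map_vec s c) (mp_map s (det (jacobian m g))) = s (mp_value c (det (jacobian m g)))"
      using g(1) that by (intro val[of _ "m + ?r"] det_jacobian_polys) (auto simp: system_def)
    moreover have "mp_value (map_vec s c) (g' $ i) = s (mp_value c (g $ i))" if "i < ?r" for i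
      using g(1) that c by (auto simp: g'_def system_def intro!: val[of _ "m + ?r"])
    ultimately show ?thesis by (simp add: etale_zero_def det dim s_0)
  qed
  have app: "map_vec s (a @\<^sub>v b) = map_vec s a @\<^sub>v map_vec s b" for a b
    by (rule eq_vecI) (auto simp: index_append_vec)
  have surj: "\<exists>b \<in> carrier_vec n. c = map_vec s b" if "c \<in> carrier_vec n" for c n
    using that surj_f_inv_f[OF s(2)] by (intro bexI[of _ "map_vec (inv_into UNIV s) c"] eq_vecI) auto
  have "map_vec s a \<in> etale_set m g'"
  proof -
    obtain b where b: "a \<in> carrier_vec m" "b \<in> carrier_vec ?r" "etale_zero m g (a @\<^sub>v b)"
      using g(2) by (auto simp: etale_set_def)
    then have "etale_zero m g' (map_vec s a @\<^sub>v map_vec s b)" unfolding app[symmetric] by (subst iff) auto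
    then show ?thesis using b by (auto simp: etale_set_def dim)
  qed
  moreover have "etale_set m g' \<subseteq> map_vec s ` U"
  proof
    fix x assume "x \<in> etale_set m g'"
    then obtain y where xy: "x \<in> carrier_vec m" "y \<in> carrier_vec ?r" "etale_zero m g' (x @\<^sub>v y)"
      by (auto simp: etale_set_def dim)
    obtain a b where ab: "a \<in> carrier_vec m" "b \<in> carrier_vec ?r" "x = map_vec s a" "y = map_vec s b"
      using surj xy by meson
    then have "etale_zero m g (a @\<^sub>v b)" using xy(3) by (simp add: iff flip: app)
    then have "a \<in> etale_set m g" using ab by (auto simp: etale_set_def)
    then show "x \<in> map_vec s ` U" using g(3) ab by auto
  qed
  ultimately show "\<exists>g. system m g \<and> map_vec s a \<in> etale_set m g \<and> etale_set m g \<subseteq> map_vec s ` U"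
    using sys by blast
qed

section \<open>Etale morphisms with prescribed image\<close>

subsection \<open>Ideals of the polynomial rings\<close>

lemma poly_ring_simps [simp]:
  "carrier (poly_ring n) = polys n" "monoid.mult (poly_ring n) = (*)"
  "one (poly_ring n) = 1" "zero (poly_ring n) = 0" "add (poly_ring n) = (+)"
  by (simp_all add: poly_ring_def)

lemma cring_poly_ring: "cring (poly_ring n)"
proof (rule cringI)
  show "abelian_group (poly_ring n)"
    by (rule abelian_groupI) (auto simp: algebra_simps intro: polys_intros intro!: bexI[of _ "- _"])
  show "comm_monoid (poly_ring n)"
    by (rule comm_monoidI) (auto simp: algebra_simps intro: polys_intros)
qed (auto simp: algebra_simps)

text \<open>Passage from the record-based ideals of the definitions to the set-based ones, for which
  the Noetherian results are stated.\<close>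

lemma ideal_poly_ring:
  fixes I :: "'k::comm_ring_1 mpoly set"
  shows "ideal I (poly_ring n) \<longleftrightarrow> idl (polys n) I"
proof
  assume "ideal I (poly_ring n)"
  then interpret I: ideal I "poly_ring n" .
  note closed = I.a_subset additive_subgroup.zero_closed[OF I.additive_subgroup_axioms]
    additive_subgroup.a_closed[OF I.additive_subgroup_axioms] I.I_l_closed
  note closed = closed[unfolded poly_ring_simps]
  show "idl (polys n) I"
    unfolding idl_def using closed by (intro conjI ballI)
next
  assume I: "idl (polys n) I"
  interpret R: cring "poly_ring n" by (rule cring_poly_ring)
  have inv: "a_inv (poly_ring n) a = - a" if "a \<in> polys n" for a
    using that by (intro R.minus_equality) (auto intro: polys_uminus)
  show "ideal I (poly_ring n)"
  proof (rule idealI)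
    show "ring (poly_ring n)" by (rule R.ring_axioms)
    show "subgroup I (add_monoid (poly_ring n))"
    proof
      fix a assume "a \<in> I"
      then show "m_inv (add_monoid (poly_ring n)) a \<in> I"
        using inv[of a] idlD(1)[OF I] idl_uminus[OF subring_polys I] by (auto simp: a_inv_def)
    qed (use I in \<open>auto simp: idl_def\<close>)
  next
    fix a x :: "'k mpoly" assume "a \<in> I" "x \<in> carrier (poly_ring n)"
    then have "x * a \<in> I" using idlD(4)[OF I] by simp
    then show "x \<otimes>\<^bsub>poly_ring n\<^esub> a \<in> I" "a \<otimes>\<^bsub>poly_ring n\<^esub> x \<in> I" by (simp_all add: mult.commute)
  qed
qed

lemma genideal_poly_ring:
  assumes "S \<subseteq> polys n"
  shows "genideal (poly_ring n) S = gen (polys n) S"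
  unfolding genideal_def ideal_poly_ring
proof (rule antisym)
  have "idl (polys n) (gen (polys n) S)" "S \<subseteq> gen (polys n) S"
    using assms by (auto intro: idl_gen subring_polys gen_base)
  then show "\<Inter> {I. idl (polys n) I \<and> S \<subseteq> I} \<subseteq> gen (polys n) S" by blast
  show "gen (polys n) S \<subseteq> \<Inter> {I. idl (polys n) I \<and> S \<subseteq> I}" by (intro Inter_greatest gen_least) auto
qed

lemma prime_1_notin: "primeideal P (poly_ring n) \<Longrightarrow> 1 \<notin> P"
  using ideal.one_imp_carrier[of P "poly_ring n"] primeideal.I_notcarr[of P "poly_ring n"] primeideal.axioms(1)[of P "poly_ring n"]
  by auto

lemma affine_variety_iff:
  "affine_variety (n, I) \<longleftrightarrow> idl (polys n) I \<and> (\<forall>p \<in> polys n. \<forall>k. p ^ k \<in> I \<longrightarrow> p \<in> I)"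
  by (simp add: ideal_poly_ring)

lemma gen_subst:
  assumes "p \<in> gen (polys n) S" "idl (polys m) J" "\<And>i. i < n \<Longrightarrow> \<sigma> i \<in> polys m"
    and "\<And>s. s \<in> S \<Longrightarrow> mp_subst \<sigma> s \<in> J"
  shows "mp_subst \<sigma> p \<in> J"
  using assms(1)
proof (induction rule: gen.induct)
  case (step r s p)
  have "mp_subst \<sigma> r * mp_subst \<sigma> s \<in> J"
    by (rule idlD(4)[OF assms(2) polys_subst[OF step(1) assms(3)] assms(4)[OF step(2)]])
  then show ?case using idlD(3)[OF assms(2)] step by (simp add: subst.hom_add subst.hom_mult)
qed (use assms in \<open>auto simp: idlD\<close>)

subsection \<open>Affine varieties as glued varieties\<close>

definition diagonal :: "nat \<Rightarrow> 'k::field mpoly set \<Rightarrow> 'k mpoly set" where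
  "diagonal n I = {p \<in> polys (n + n). mp_subst (\<lambda>k. mp_var (if k < n then k else k - n)) p \<in> I}"

text \<open>Reflexivity of the gluing relation forces the overlap of the chart with itself to be the
  diagonal.\<close>

definition single_chart :: "'k::field affine \<Rightarrow> 'k gluing" where
  "single_chart X = ([X], \<lambda>_ _. diagonal (fst X) (snd X))"

lemma idl_diagonal:
  fixes I :: "'k::field mpoly set"
  shows "idl (polys n) I \<Longrightarrow> idl (polys (n + n)) (diagonal n I)"
  unfolding idl_def
proof (intro conjI ballI)
  assume I: "I \<subseteq> polys n \<and> 0 \<in> I \<and> (\<forall>a\<in>I. \<forall>b\<in>I. a + b \<in> I) \<and> (\<forall>r\<in>polys n. \<forall>a\<in>I. r * a \<in> I)"
  fix r a :: "'k mpoly" assume "r \<in> polys (n + n)" "a \<in> diagonal n I"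
  moreover from this(1) have "mp_subst (\<lambda>k. mp_var (if k < n then k else k - n)) r \<in> polys n"
    by (rule polys_subst) auto
  ultimately show "r * a \<in> diagonal n I"
    using I by (auto simp: diagonal_def subst.hom_mult intro: polys_mult)
qed (auto simp: diagonal_def subst.hom_add intro: polys_add)

text \<open>Each projection of the diagonal to the chart is an isomorphism, so h = 1 serves at every
  prime. The offset \<open>off\<close> selects the projection.\<close>

lemma diagonal_immersion:
  assumes I: "idl (polys n) I" and off: "off = 0 \<or> off = n"
  shows "open_immersion (n + n, diagonal n I) (n, I) (vec n (\<lambda>k. mp_var (off + k)))"
proof -
  let ?\<delta> = "\<lambda>k. mp_var (if k < n then k else k - n) :: 'a mpoly"
  let ?\<phi> = "vec n (\<lambda>k. mp_var (off + k)) :: 'a mpoly vec"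
  let ?\<phi>' = "?\<phi> @\<^sub>v vec 1 (\<lambda>_. mp_var (n + n))"
  let ?\<psi> = "vec (Suc (n + n)) (\<lambda>i. if i < n + n then ?\<delta> i else mp_var n) :: 'a mpoly vec"
  let ?S = "diagonal n I \<union> {mp_var (n + n) * 1 - 1}" and ?T = "I \<union> {mp_var n * 1 - 1}"
  have S: "?S \<subseteq> polys (Suc (n + n))"
    by (auto simp: diagonal_def intro: polys_diff polys_mono)
  have T: "?T \<subseteq> polys (Suc n)"
    using idlD(1)[OF I] by (auto intro: polys_diff polys_mono)
  have \<phi>: "mp_subst (($) ?\<phi>) p \<in> diagonal n I" if "p \<in> I" for p
  proof -
    have p: "p \<in> polys n" using that idlD(1)[OF I] by auto
    have "mp_subst (($) ?\<phi>) p \<in> polys (n + n)" using p off by (intro polys_subst) auto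
    moreover have "mp_subst ?\<delta> (mp_subst (($) ?\<phi>) p) = p"
      unfolding subst_subst using p off by (intro subst_id) auto
    ultimately show ?thesis using that by (simp add: diagonal_def)
  qed
  have \<phi>': "mp_subst (($) ?\<phi>') p = mp_subst (($) ?\<phi>) p" if "p \<in> polys n" for p
    using that by (rule subst_cong) (auto simp: index_append_vec)
  have g1: "idl (polys (Suc (n + n))) (gen (polys (Suc (n + n))) ?S)" by (rule idl_gen[OF subring_polys S])
  have g2: "idl (polys (Suc n)) (gen (polys (Suc n)) ?T)" by (rule idl_gen[OF subring_polys T])
  have m1: "mp_subst (($) ?\<phi>') p \<in> gen (polys (Suc (n + n))) ?S" if "p \<in> gen (polys (Suc n)) ?T" for p
  proof (rule gen_subst[OF that g1])
    fix i assume "i < Suc n" then show "?\<phi>' $ i \<in> polys (Suc (n + n))" using off by (auto simp: index_append_vec)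
  next
    fix s assume "s \<in> ?T"
    then consider "s \<in> I" | "s = mp_var n * 1 - 1" by blast
    then show "mp_subst (($) ?\<phi>') s \<in> gen (polys (Suc (n + n))) ?S"
    proof cases
      case 1
      then have "mp_subst (($) ?\<phi>') s \<in> diagonal n I" using \<phi> \<phi>' idlD(1)[OF I] by auto
      then show ?thesis by (intro gen_base subring_polys) auto
    next
      case 2
      then have "mp_subst (($) ?\<phi>') s = mp_var (n + n) * 1 - 1"
        by (simp add: subst.hom_minus index_append_vec)
      then show ?thesis by (intro gen_base subring_polys) auto
    qed
  qed
  have m2: "mp_subst (($) ?\<psi>) p \<in> gen (polys (Suc n)) ?T" if "p \<in> gen (polys (Suc (n + n))) ?S" for p
  proof (rule gen_subst[OF that g2])
    fix i assume "i < Suc (n + n)" then show "?\<psi> $ i \<in> polys (Suc n)" by auto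
  next
    fix s assume "s \<in> ?S"
    then consider "s \<in> diagonal n I" | "s = mp_var (n + n) * 1 - 1" by blast
    then show "mp_subst (($) ?\<psi>) s \<in> gen (polys (Suc n)) ?T"
    proof cases
      case 1
      then have "mp_subst (($) ?\<psi>) s = mp_subst ?\<delta> s"
        by (intro subst_cong[of s "n + n"]) (auto simp: diagonal_def)
      then have "mp_subst (($) ?\<psi>) s \<in> I" using 1 by (simp add: diagonal_def)
      then show ?thesis by (intro gen_base subring_polys) auto
    next
      case 2
      then have "mp_subst (($) ?\<psi>) s = mp_var n * 1 - 1"
        by (simp add: subst.hom_minus)
      then show ?thesis by (intro gen_base subring_polys) auto
    qed
  qed
  have diff: "mp_subst (($) ?\<phi>') (?\<psi> $ i) - mp_var i \<in> gen (polys (Suc (n + n))) ?S" if i: "i < Suc (n + n)" for i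
  proof (cases "i < n + n")
    case True
    have "mp_subst (($) ?\<phi>') (?\<psi> $ i) = mp_var (off + (if i < n then i else i - n))"
      using True by (auto simp: index_append_vec)
    moreover have "mp_var (off + (if i < n then i else i - n)) - mp_var i \<in> diagonal n I"
    proof -
      let ?d = "\<lambda>k. if k < n then k else k - n"
      have "?d (off + ?d i) = ?d i" using True off by auto
      then have "mp_subst ?\<delta> (mp_var (off + ?d i) - mp_var i) = 0"
        by (simp only: subst.hom_minus subst_var diff_self)
      moreover have "mp_var (off + ?d i) - mp_var i \<in> polys (n + n)"
        using True off by (intro polys_diff) auto
      ultimately show ?thesis using idlD(2)[OF I] by (simp only: diagonal_def mem_Collect_eq)
    qed
    ultimately have "mp_subst (($) ?\<phi>') (?\<psi> $ i) - mp_var i \<in> diagonal n I" by simp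
    then show ?thesis by (intro gen_base subring_polys) auto
  next
    case False
    then have "i = n + n" using i by simp
    then have "mp_subst (($) ?\<phi>') (?\<psi> $ i) - mp_var i = 0" by (simp add: index_append_vec)
    then show ?thesis by simp
  qed
  have diff2: "mp_subst (($) ?\<psi>) (?\<phi>' $ i) - mp_var i = 0" if i: "i < Suc n" for i
  proof (cases "i < n")
    case True
    then have "?\<phi>' $ i = mp_var (off + i)" by simp
    moreover have "?\<psi> $ (off + i) = mp_var i" using True off by auto
    ultimately show ?thesis by (simp only: subst_var diff_self)
  next
    case False
    then have "i = n" using i by simp
    then have "?\<phi>' $ i = mp_var (n + n)" by simp
    moreover have "?\<psi> $ (n + n) = mp_var i" using \<open>i = n\<close> by simp
    ultimately show ?thesis by (simp only: subst_var diff_self)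
  qed
  have c1: "?\<phi>' \<in> carrier_vec (Suc n)"
    using append_carrier_vec[of ?\<phi> n "vec 1 (\<lambda>_. mp_var (n + n))" 1] by simp
  have c2: "\<forall>i<Suc n. ?\<phi>' $ i \<in> polys (Suc (n + n))"
    using off by (auto simp: index_append_vec)
  have c3: "\<forall>p\<in>gen (polys (Suc n)) ?T. mp_subst (($) ?\<phi>') p \<in> gen (polys (Suc (n + n))) ?S"
    by (rule ballI) (rule m1)
  have mor1: "affine_morphism (Suc (n + n), gen (polys (Suc (n + n))) ?S) (Suc n, gen (polys (Suc n)) ?T) ?\<phi>'"
    unfolding affine_morphism.simps by (rule conjI[OF c1 conjI[OF c2 c3]])
  have d1: "?\<psi> \<in> carrier_vec (Suc (n + n))"
    by simp
  have d2: "\<forall>i<Suc (n + n). ?\<psi> $ i \<in> polys (Suc n)"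
    by auto
  have d3: "\<forall>p\<in>gen (polys (Suc (n + n))) ?S. mp_subst (($) ?\<psi>) p \<in> gen (polys (Suc n)) ?T"
    by (rule ballI) (rule m2)
  have mor2: "affine_morphism (Suc n, gen (polys (Suc n)) ?T) (Suc (n + n), gen (polys (Suc (n + n))) ?S) ?\<psi>"
    unfolding affine_morphism.simps by (rule conjI[OF d1 conjI[OF d2 d3]])
  have e1: "\<forall>i<Suc (n + n). mp_subst (($) ?\<phi>') (?\<psi> $ i) - mp_var i \<in> gen (polys (Suc (n + n))) ?S"
    using diff by blast
  have e2: "\<forall>i<Suc n. mp_subst (($) ?\<psi>) (?\<phi>' $ i) - mp_var i \<in> gen (polys (Suc n)) ?T"
    by (intro allI impI, subst diff2) simp_all
  have "affine_iso (basic_open (n + n, diagonal n I) 1) (basic_open (n, I) 1) ?\<phi>'"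
    unfolding basic_open.simps genideal_poly_ring[OF S] genideal_poly_ring[OF T] affine_iso.simps
    by (rule conjI[OF mor1], rule exI[of _ ?\<psi>], rule conjI[OF mor2 conjI[OF e1 e2]])
  moreover have "affine_morphism (n + n, diagonal n I) (n, I) ?\<phi>"
    using \<phi> off by auto
  ultimately show ?thesis
    unfolding open_immersion.simps using prime_1_notin
    by (intro conjI ballI bexI[of _ 1]) auto
qed

lemma variety_single_chart:
  assumes "affine_variety (n, I)"
  shows "variety (single_chart (n, I))"
proof -
  let ?\<delta> = "\<lambda>k. mp_var (if k < n then k else k - n) :: 'a mpoly"
  let ?D = "diagonal n I"
  have I: "idl (polys n) I" and rad: "\<And>p k. p \<in> polys n \<Longrightarrow> p ^ k \<in> I \<Longrightarrow> p \<in> I"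
    using assms unfolding affine_variety_iff by blast+
  have D: "idl (polys (n + n)) ?D" by (rule idl_diagonal[OF I])
  have av: "affine_variety (n + n, ?D)"
    unfolding affine_variety_iff
  proof (intro conjI ballI allI impI)
    fix p k assume p: "p \<in> polys (n + n)" "p ^ k \<in> ?D"
    then have "mp_subst ?\<delta> p ^ k \<in> I" by (simp add: diagonal_def subst.hom_power)
    moreover have "mp_subst ?\<delta> p \<in> polys n" using p(1) by (rule polys_subst) auto
    ultimately have "mp_subst ?\<delta> p \<in> I" by (rule rad[rotated])
    then show "p \<in> ?D" using p by (simp add: diagonal_def)
  qed (rule D)
  have imm: "open_immersion (n + n, ?D) (n, I) (vec n mp_var)"
    "open_immersion (n + n, ?D) (n, I) (vec n (\<lambda>k. mp_var (n + k)))"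
    using diagonal_immersion[OF I, of 0] diagonal_immersion[OF I, of n] by simp_all
  have sym: "mp_subst (\<lambda>k. mp_var (if k < n then n + k else k - n)) p \<in> ?D" if "p \<in> ?D" for p
  proof -
    have p: "p \<in> polys (n + n)" "mp_subst ?\<delta> p \<in> I" using that by (auto simp: diagonal_def)
    have "mp_subst ?\<delta> (mp_subst (\<lambda>k. mp_var (if k < n then n + k else k - n)) p) = mp_subst ?\<delta> p"
      unfolding subst_subst using p(1) by (rule subst_cong) auto
    moreover have "mp_subst (\<lambda>k. mp_var (if k < n then n + k else k - n)) p \<in> polys (n + n)"
      using p(1) by (rule polys_subst) auto
    ultimately show ?thesis using p by (simp add: diagonal_def)
  qed
  have trans: "mp_subst (\<lambda>k. mp_var (if k < n then k else n + k)) p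
      \<in> genideal (poly_ring (n + n + n)) (?D \<union> mp_subst (\<lambda>k. mp_var (n + k)) ` ?D)" if p: "p \<in> ?D" for p
  proof -
    let ?S = "?D \<union> mp_subst (\<lambda>k. mp_var (n + k)) ` ?D"
    let ?R = "polys (n + n + n) :: 'a mpoly set"
    have S: "?S \<subseteq> ?R"
      using idlD(1)[OF D] by (auto intro!: polys_subst[of _ "n + n"] intro: polys_mono)
    have g: "idl ?R (gen ?R ?S)" by (rule idl_gen[OF subring_polys S])
    have pp: "p \<in> polys (n + n)" using p by (auto simp: diagonal_def)
    \<comment> \<open>Modulo the equations x = y of the first factor, p(x, z) turns into p(y, z),
      which is an equation of the second factor.\<close>
    have "mp_subst (\<lambda>k. mp_var (if k < n then k else n + k)) p - mp_subst (\<lambda>k. mp_var (n + k)) p \<in> gen ?R ?S"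
      using pp g
    proof (rule subst_diff_idl)
      fix i assume i: "i < n + n"
      show "mp_var (if i < n then i else n + i) - mp_var (n + i) \<in> gen ?R ?S"
      proof (cases "i < n")
        case True
        then have "mp_var i - mp_var (n + i) \<in> ?D"
          using idlD(2)[OF I] by (auto simp: diagonal_def subst.hom_minus intro!: polys_diff)
        then show ?thesis using True by (auto intro!: gen_base subring_polys)
      qed simp
    qed auto
    moreover have "mp_subst (\<lambda>k. mp_var (n + k)) p \<in> gen ?R ?S"
      using p by (intro gen_base subring_polys) auto
    ultimately have "(mp_subst (\<lambda>k. mp_var (if k < n then k else n + k)) p - mp_subst (\<lambda>k. mp_var (n + k)) p)
      + mp_subst (\<lambda>k. mp_var (n + k)) p \<in> gen ?R ?S" by (rule gen_add)
    then show ?thesis by (simp add: genideal_poly_ring[OF S])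
  qed
  show ?thesis
    unfolding variety_def
    using assms av imm sym trans
    by (simp add: single_chart_def n_charts_def chart_def chart_dim_def overlap_def overlap_scheme_def
        diagonal_def[symmetric] Let_def del: affine_variety.simps open_immersion.simps)
qed

lemma etale_morphism_single_chart:
  assumes I: "idl (polys n) I" and e: "etale_affine (n, I) V \<phi>"
  shows "etale_morphism (single_chart (n, I)) V (\<lambda>_. \<phi>)"
proof -
  obtain m J where V: "V = (m, J)" by (cases V)
  have \<phi>: "\<phi> $ k \<in> polys n" if "k < m" for k
    using e that by (simp add: etale_affine_def V)
  have "\<phi> $ k - mp_subst (\<lambda>l. mp_var (n + l)) (\<phi> $ k) \<in> diagonal n I" if k: "k < m" for k
  proof -
    have "mp_subst (\<lambda>i. mp_var (if i < n then i else i - n)) (\<phi> $ k) = \<phi> $ k"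
      by (rule subst_id[OF \<phi>[OF k]]) auto
    moreover have "mp_subst (\<lambda>i. mp_var (if i < n then i else i - n)) (mp_subst (\<lambda>l. mp_var (n + l)) (\<phi> $ k)) = \<phi> $ k"
      unfolding subst_subst by (rule subst_id[OF \<phi>[OF k]]) auto
    moreover have "\<phi> $ k - mp_subst (\<lambda>l. mp_var (n + l)) (\<phi> $ k) \<in> polys (n + n)"
      by (intro polys_diff polys_subst[OF \<phi>[OF k]] polys_mono[OF \<phi>[OF k]]) auto
    ultimately show ?thesis using idlD(2)[OF I] by (simp add: diagonal_def subst.hom_minus)
  qed
  then show ?thesis
    using e by (simp add: etale_morphism_def single_chart_def n_charts_def chart_def chart_dim_def overlap_def V)
qed

lemma K_image_single_chart:
  "K_image (single_chart X) (\<lambda>_. \<phi>) = morphism_value \<phi> ` affine_points X"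
  by (auto simp: K_image_def glued_points_def single_chart_def n_charts_def chart_def)

subsection \<open>Localisation\<close>

lemma comm_ring_hom_to_fract: "comm_ring_hom (to_fract :: 'a::idom \<Rightarrow> _)"
  by (rule comm_ring_homI) (auto simp: to_fract_def One_fract_def)

text \<open>Localisation keeps a radical ideal radical. Powers of h clear the new variable,
  relations are read off in the fraction field with the new variable sent to 1/h, and the way back
  uses that x_n h is 1 modulo the ideal.\<close>

lemma radical_localisation:
  fixes h :: "'k::field mpoly"
  assumes P: "idl (polys n) P" and rad: "\<And>p k. p \<in> polys n \<Longrightarrow> p ^ k \<in> P \<Longrightarrow> p \<in> P"
    and h: "h \<in> polys n" "h \<noteq> 0"
    and p: "p \<in> polys (Suc n)" "p ^ e \<in> gen (polys (Suc n)) (P \<union> {mp_var n * h - 1})"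
  shows "p \<in> gen (polys (Suc n)) (P \<union> {mp_var n * h - 1})"
proof -
  let ?R = "polys (Suc n) :: 'k mpoly set"
  let ?u = "mp_var n * h - 1"
  let ?I = "gen ?R (P \<union> {?u})"
  have u: "?u \<in> ?R" using h by (auto intro!: polys_diff polys_mult intro: polys_mono)
  have PR: "P \<union> {?u} \<subseteq> ?R" using idlD(1)[OF P] u by (auto intro: polys_mono)
  have I: "idl ?R ?I" by (rule idl_gen[OF subring_polys PR])
  interpret tf: comm_ring_hom "to_fract :: 'k mpoly \<Rightarrow> _" by (rule comm_ring_hom_to_fract)
  define H where "H = to_fract h"
  have H: "H \<noteq> 0" using h by (simp add: H_def)
  have tc: "comm_ring_hom (\<lambda>c :: 'k. to_fract (mp_const c))"
    by (rule comm_ring_hom_comp[OF comm_ring_hom_to_fract comm_ring_hom_const])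
  define \<eta> where "\<eta> = mp_extend (\<lambda>c :: 'k. to_fract (mp_const c)) (\<lambda>i. if i < n then to_fract (mp_var i) else 1 / H)"
  interpret \<eta>: comm_ring_hom \<eta> unfolding \<eta>_def by (rule comm_ring_hom_mp_extend[OF tc])
  have \<eta>c: "\<eta> (mp_const c) = to_fract (mp_const c)" for c unfolding \<eta>_def by (rule mp_extend_const[OF tc])
  have \<eta>v: "\<eta> (mp_var i) = (if i < n then to_fract (mp_var i) else 1 / H)" for i unfolding \<eta>_def by (rule mp_extend_var[OF tc])
  have \<eta>: "\<eta> q = to_fract q" if "q \<in> polys n" for q
    using that by (rule polys_hom_eq) (auto simp: \<eta>c \<eta>v \<eta>.comm_ring_hom_axioms comm_ring_hom_to_fract)
  have \<eta>u: "\<eta> q = 0" if "q \<in> gen ?R {?u}" for q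
    using that
    by (induction rule: gen.induct) (auto simp: \<eta>.hom_add \<eta>.hom_mult \<eta>.hom_minus \<eta>v \<eta>[OF h(1)] H simp flip: H_def)
  have gu: "gen ?R {?u} \<subseteq> ?I" by (rule gen_mono) auto
  \<comment> \<open>Modulo \<open>mp_var n * h - 1\<close>, multiplication by a power of h removes
    the new variable.\<close>
  have homog: "\<exists>L s. s \<in> polys n \<and> q * h ^ L - s \<in> gen ?R {?u}" if "q \<in> ?R" for q
    using that
  proof (induction rule: polys_induct)
    case (const c)
    show ?case by (rule exI[of _ 0], rule exI[of _ "mp_const c"]) simp
  next
    case (var i)
    show ?case
    proof (cases "i < n")
      case True
      then show ?thesis by (intro exI[of _ 0] exI[of _ "mp_var i"]) simp
    next
      case False
      then have "i = n" using var by simp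
      then show ?thesis by (intro exI[of _ 1]) (auto intro!: gen_base subring_polys)
    qed
  next
    case (add q r)
    then obtain L s M t where qr: "s \<in> polys n" "q * h ^ L - s \<in> gen ?R {?u}"
      "t \<in> polys n" "r * h ^ M - t \<in> gen ?R {?u}" by blast
    have hR: "h ^ k \<in> ?R" for k using h by (auto intro!: polys_power intro: polys_mono)
    have "h ^ M * (q * h ^ L - s) + h ^ L * (r * h ^ M - t) \<in> gen ?R {?u}"
      using qr hR by (intro gen_add gen_mult subring_polys)
    moreover have "h ^ M * (q * h ^ L - s) + h ^ L * (r * h ^ M - t) = (q + r) * h ^ (L + M) - (h ^ M * s + h ^ L * t)"
      by (simp add: power_add algebra_simps)
    moreover have "h ^ M * s + h ^ L * t \<in> polys n" using qr h by (intro polys_intros) auto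
    ultimately show ?case by metis
  next
    case (mult q r)
    then obtain L s M t where qr: "s \<in> polys n" "q * h ^ L - s \<in> gen ?R {?u}"
      "t \<in> polys n" "r * h ^ M - t \<in> gen ?R {?u}" by blast
    have hR: "h ^ k \<in> ?R" for k using h by (auto intro!: polys_power intro: polys_mono)
    have "r * h ^ M * (q * h ^ L - s) + s * (r * h ^ M - t) \<in> gen ?R {?u}"
      using qr hR mult(2) polys_mono[of s n "Suc n"] by (intro gen_add gen_mult subring_polys polys_mult) auto
    moreover have "r * h ^ M * (q * h ^ L - s) + s * (r * h ^ M - t) = (q * r) * h ^ (L + M) - s * t"
      by (simp add: power_add algebra_simps)
    moreover have "s * t \<in> polys n" using qr by (intro polys_intros) auto
    ultimately show ?case by metis
  qed
  have homog': "\<exists>L s. s \<in> polys n \<and> q * h ^ L - s \<in> gen ?R {?u} \<and> \<eta> q * H ^ L = to_fract s" if "q \<in> ?R" for q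
  proof -
    from homog[OF that] obtain L s where Ls: "s \<in> polys n" "q * h ^ L - s \<in> gen ?R {?u}" by blast
    have "\<eta> (q * h ^ L - s) = 0" by (rule \<eta>u[OF Ls(2)])
    then have "\<eta> q * H ^ L = to_fract s"
      using \<eta>[OF Ls(1)] \<eta>[OF h(1)] by (simp add: \<eta>.hom_minus \<eta>.hom_mult \<eta>.hom_power H_def)
    then show ?thesis using Ls by blast
  qed
  \<comment> \<open>The elements whose image in the localisation has a numerator in P. They form an
    ideal containing the generators, which converts membership in the localised ideal into an
    equation between polynomials in the old variables.\<close>
  define Z where "Z = {q \<in> ?R. \<exists>L s. s \<in> P \<and> \<eta> q * H ^ L = to_fract s}"
  have ZI: "q \<in> Z" if "q \<in> ?R" "s \<in> P" "\<eta> q * H ^ L = to_fract s" for q L s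
    using that unfolding Z_def by blast
  have "idl ?R Z" unfolding idl_def
  proof (intro conjI ballI)
    show "0 \<in> Z" unfolding Z_def using idlD(2)[OF P] by (auto intro!: exI[of _ 0])
    fix q r assume "q \<in> Z" "r \<in> Z"
    then obtain L s M t where qr: "q \<in> ?R" "r \<in> ?R" "s \<in> P" "\<eta> q * H ^ L = to_fract s" "t \<in> P" "\<eta> r * H ^ M = to_fract t"
      by (auto simp: Z_def)
    have "\<eta> (q + r) * H ^ (L + M) = H ^ M * (\<eta> q * H ^ L) + H ^ L * (\<eta> r * H ^ M)"
      by (simp add: \<eta>.hom_add power_add algebra_simps)
    also have "\<dots> = to_fract (h ^ M * s + h ^ L * t)"
      unfolding qr by (simp add: H_def tf.hom_add tf.hom_mult tf.hom_power)
    finally have E: "\<eta> (q + r) * H ^ (L + M) = to_fract (h ^ M * s + h ^ L * t)" .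
    have "h ^ M * s + h ^ L * t \<in> P" using qr h by (intro idlD(3)[OF P] idlD(4)[OF P] polys_power)
    then show "q + r \<in> Z" using qr by (intro ZI[OF _ _ E] polys_add)
  next
    fix r q assume "r \<in> ?R" "q \<in> Z"
    then obtain L s where q: "q \<in> ?R" "s \<in> P" "\<eta> q * H ^ L = to_fract s" by (auto simp: Z_def)
    obtain M t where r: "t \<in> polys n" "\<eta> r * H ^ M = to_fract t" using homog'[OF \<open>r \<in> ?R\<close>] by blast
    have "\<eta> (r * q) * H ^ (M + L) = (\<eta> r * H ^ M) * (\<eta> q * H ^ L)"
      by (simp add: \<eta>.hom_mult power_add algebra_simps)
    also have "\<dots> = to_fract (t * s)" unfolding q r by (simp add: tf.hom_mult)
    finally have E: "\<eta> (r * q) * H ^ (M + L) = to_fract (t * s)" .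
    show "r * q \<in> Z" using q r \<open>r \<in> ?R\<close> by (intro ZI[OF _ _ E] polys_mult idlD(4)[OF P])
  qed (auto simp: Z_def)
  moreover have "P \<union> {?u} \<subseteq> Z"
  proof -
    have "q \<in> Z" if "q \<in> P" for q
      using that PR \<eta>[of q] idlD(1)[OF P] by (intro ZI[of q q 0]) auto
    moreover have "?u \<in> Z"
    proof (rule ZI[OF u idlD(2)[OF P], of 0])
      have "\<eta> ?u = 0" by (intro \<eta>u gen_base subring_polys) simp
      then show "\<eta> ?u * H ^ 0 = to_fract 0" by simp
    qed
    ultimately show ?thesis by blast
  qed
  ultimately have "?I \<subseteq> Z" by (rule gen_least)
  then have "p ^ e \<in> Z" using p(2) by blast
  then obtain L s where Ls: "s \<in> P" "\<eta> p ^ e * H ^ L = to_fract s" by (auto simp: Z_def \<eta>.hom_power)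
  obtain M t where Mt: "t \<in> polys n" "p * h ^ M - t \<in> gen ?R {?u}" "\<eta> p * H ^ M = to_fract t"
    using homog'[OF p(1)] by blast
  show ?thesis
  proof (cases "e = 0")
    case True
    then show ?thesis using idlD(4)[OF I p(1), of 1] p(2) by simp
  next
    case False
    have "to_fract (t ^ e * h ^ L) = (\<eta> p * H ^ M) ^ e * H ^ L"
      by (simp only: Mt(3)[symmetric] tf.hom_mult tf.hom_power H_def[symmetric])
    also have "\<dots> = (\<eta> p ^ e * H ^ L) * H ^ (M * e)" by (simp add: power_mult_distrib power_mult ac_simps)
    also have "\<dots> = to_fract (h ^ (M * e) * s)" by (simp only: Ls(2)[symmetric] tf.hom_mult tf.hom_power H_def[symmetric] mult.commute)
    finally have "t ^ e * h ^ L = h ^ (M * e) * s" by (simp only: to_fract_eq_iff)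
    then have "t ^ e * h ^ L \<in> P" using Ls h by (simp add: idlD(4)[OF P] polys_power)
    \<comment> \<open>Raising the power of h from L to L e, possible as e > 0, completes an e-th
      power, to which the radicality of P applies.\<close>
    from idlD(4)[OF P polys_power[OF h(1)] this]
    have "h ^ (L * e - L) * (t ^ e * h ^ L) \<in> P" .
    moreover have "h ^ (L * e - L) * (t ^ e * h ^ L) = (t * h ^ L) ^ e"
    proof -
      have "h ^ (L * e - L) * h ^ L = h ^ (L * e)" using False by (simp flip: power_add)
      then have "t ^ e * (h ^ (L * e - L) * h ^ L) = t ^ e * (h ^ L) ^ e" by (simp only: power_mult)
      then show ?thesis by (simp only: power_mult_distrib ac_simps)
    qed
    ultimately have "(t * h ^ L) ^ e \<in> P" by simp
    then have "t * h ^ L \<in> P" by (rule rad[OF polys_mult[OF Mt(1) polys_power[OF h(1)]]])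
    then have "t * h ^ L \<in> ?I" by (intro gen_base subring_polys) auto
    moreover have "h ^ L * (p * h ^ M - t) \<in> ?I"
      using Mt gu h by (intro gen_mult subring_polys) (auto intro!: polys_power intro: polys_mono)
    ultimately have "t * h ^ L + h ^ L * (p * h ^ M - t) \<in> ?I" by (rule gen_add)
    then have "mp_var n ^ (L + M) * (t * h ^ L + h ^ L * (p * h ^ M - t)) \<in> ?I"
      by (intro gen_mult subring_polys polys_power) auto
    moreover have "mp_var n ^ (L + M) * (t * h ^ L + h ^ L * (p * h ^ M - t)) = p * (mp_var n * h) ^ (L + M)"
      by (simp add: power_mult_distrib power_add algebra_simps)
    ultimately have 1: "p * (mp_var n * h) ^ (L + M) \<in> ?I" by simp
    have "(mp_var n * h) ^ k - 1 \<in> ?I" for k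
    proof (induction k)
      case (Suc k)
      have "?u \<in> ?I" by (intro gen_base subring_polys) auto
      then have "(mp_var n * h) * ((mp_var n * h) ^ k - 1) + ?u \<in> ?I"
        using Suc h by (intro gen_add gen_mult subring_polys polys_mult) (auto intro: polys_mono)
      then show ?case by (simp add: algebra_simps)
    qed simp
    then have "p * ((mp_var n * h) ^ (L + M) - 1) \<in> ?I" using p by (intro gen_mult subring_polys)
    with 1 have "p * (mp_var n * h) ^ (L + M) - p * ((mp_var n * h) ^ (L + M) - 1) \<in> ?I"
      by (rule idl_diff[OF subring_polys I])
    then show ?thesis by (simp add: algebra_simps)
  qed
qed

subsection \<open>Comparison with the etale topology\<close>

lemma basic_open_eq:
  assumes "idl (polys n) I" "h \<in> polys n"
  shows "basic_open (n, I) h = (Suc n, gen (polys (Suc n)) (I \<union> {mp_var n * h - 1}))"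
proof -
  have "I \<union> {mp_var n * h - 1} \<subseteq> polys (Suc n)"
    using idlD(1)[OF assms(1)] assms(2) by (auto intro!: polys_diff polys_mult intro: polys_mono)
  then show ?thesis by (simp add: genideal_poly_ring)
qed

text \<open>Smoothness is formulated on principal open subschemes; inverting 1 covers a chart that
  is standard as a whole.\<close>

lemma iso_basic_open_1:
  fixes I :: "'k::field mpoly set"
  assumes I: "idl (polys n) I"
  shows "affine_iso (basic_open (n, I) 1) (n, I) (vec n mp_var)"
proof -
  let ?\<alpha> = "vec n mp_var :: 'k mpoly vec"
  let ?\<psi> = "vec (Suc n) (\<lambda>i. if i < n then mp_var i else 1) :: 'k mpoly vec"
  let ?S = "I \<union> {mp_var n * 1 - 1}"
  let ?G = "gen (polys (Suc n)) ?S"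
  have S: "?S \<subseteq> polys (Suc n)" using idlD(1)[OF I] by (auto intro: polys_diff polys_mono)
  have \<alpha>: "mp_subst (($) ?\<alpha>) p = p" if "p \<in> polys n" for p using that by (rule subst_id) simp
  have \<psi>: "mp_subst (($) ?\<psi>) p = p" if "p \<in> polys n" for p using that by (rule subst_id) simp
  have c2: "\<forall>i<n. ?\<alpha> $ i \<in> polys (Suc n)" by auto
  have c3: "\<forall>p\<in>I. mp_subst (($) ?\<alpha>) p \<in> ?G"
  proof
    fix p assume p: "p \<in> I"
    then have "p \<in> ?G" by (intro gen_base subring_polys) auto
    then show "mp_subst (($) ?\<alpha>) p \<in> ?G" using \<alpha> p idlD(1)[OF I] by (metis subsetD)
  qed
  have d2: "\<forall>i<Suc n. ?\<psi> $ i \<in> polys n" by auto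
  have d3: "\<forall>p\<in>?G. mp_subst (($) ?\<psi>) p \<in> I"
  proof
    fix p assume "p \<in> ?G"
    then show "mp_subst (($) ?\<psi>) p \<in> I"
    proof (rule gen_subst[OF _ I])
      fix s assume "s \<in> ?S"
      then consider "s \<in> I" | "s = mp_var n * 1 - 1" by blast
      then show "mp_subst (($) ?\<psi>) s \<in> I"
      proof cases
        case 1
        then show ?thesis using \<psi> idlD(1)[OF I] by (metis subsetD)
      next
        case 2
        then have "mp_subst (($) ?\<psi>) s = 0" by (simp add: subst.hom_minus)
        then show ?thesis using idlD(2)[OF I] by (simp only:)
      qed
    qed simp
  qed
  have e1: "\<forall>i<Suc n. mp_subst (($) ?\<alpha>) (?\<psi> $ i) - mp_var i \<in> ?G"
  proof (intro allI impI)
    fix i assume i: "i < Suc n"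
    show "mp_subst (($) ?\<alpha>) (?\<psi> $ i) - mp_var i \<in> ?G"
    proof (cases "i < n")
      case True
      then have "mp_subst (($) ?\<alpha>) (?\<psi> $ i) - mp_var i = 0" by simp
      then show ?thesis by (simp only: gen.zero)
    next
      case False
      then have "i = n" using i by simp
      then have "mp_subst (($) ?\<alpha>) (?\<psi> $ i) - mp_var i = mp_const (- 1) * (mp_var n * 1 - 1)"
        by (simp add: mpc.hom_uminus)
      moreover have "mp_const (- 1) * (mp_var n * 1 - 1) \<in> ?G"
        by (intro gen_mult gen_base subring_polys polys_const) auto
      ultimately show ?thesis by (simp only:)
    qed
  qed
  have e2: "\<forall>i<n. mp_subst (($) ?\<psi>) (?\<alpha> $ i) - mp_var i \<in> I"
    using idlD(2)[OF I] by simp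
  have mor1: "affine_morphism (Suc n, ?G) (n, I) ?\<alpha>"
    unfolding affine_morphism.simps by (rule conjI[OF _ conjI[OF c2 c3]]) simp
  have mor2: "affine_morphism (n, I) (Suc n, ?G) ?\<psi>"
    unfolding affine_morphism.simps by (rule conjI[OF _ conjI[OF d2 d3]]) simp
  show ?thesis
    unfolding basic_open.simps genideal_poly_ring[OF S] affine_iso.simps
    by (rule conjI[OF mor1], rule exI[of _ ?\<psi>], rule conjI[OF mor2 conjI[OF e1 e2]])
qed

lemma gen_ev_0:
  assumes "p \<in> gen R S" "\<And>s. s \<in> S \<Longrightarrow> mp_value v s = 0"
  shows "mp_value v p = 0"
  using assms(1)
  by (induction rule: gen.induct) (use assms(2) in \<open>auto simp: mp_value_ev ev.hom_add ev.hom_mult\<close>)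

lemma gen_insert_0:
  assumes "S \<subseteq> polys n"
  shows "gen (polys n) ({0} \<union> S) = gen (polys n) S"
proof (rule antisym)
  show "gen (polys n) ({0} \<union> S) \<subseteq> gen (polys n) S"
    by (rule gen_least[OF idl_gen[OF subring_polys assms]])
      (use gen_base[OF subring_polys] in auto)
qed (rule gen_mono, auto)

text \<open>The chart is given by the radical of (g), localised at h' = h dJ. The factor h makes the
  radical agree with (g), and dJ makes the map etale. Taking u as a further equation turns the
  localisation into the square system g', so the chart is standard over affine space.\<close>

lemma etale_neighbourhood:
  fixes g :: "'k::field mpoly vec"
  assumes g: "system m g" and a: "a \<in> etale_set m g"
  shows "\<exists>X \<phi>. affine_variety X \<and> etale_affine X (affine_space m) \<phi> \<and>
    a \<in> morphism_value \<phi> ` affine_points X \<and> morphism_value \<phi> ` affine_points X \<subseteq> etale_set m g"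
proof -
  let ?r = "dim_vec g"
  define N where "N = m + ?r"
  let ?R = "polys (Suc N) :: 'k mpoly set"
  obtain b where b: "a \<in> carrier_vec m" "b \<in> carrier_vec ?r" "etale_zero m g (a @\<^sub>v b)"
    using a by (auto simp: etale_set_def)
  have gN: "g $ i \<in> polys N" if "i < ?r" for i using g that by (auto simp: system_def N_def)
  define dJ where "dJ = det (jacobian m g)"
  have dJ: "dJ \<in> polys N" unfolding dJ_def using gN by (rule det_jacobian_polys)
  define P where "P = rad_gen N (set\<^sub>v g)"
  have gP: "set\<^sub>v g \<subseteq> polys N" using gN by (auto simp: vec_set_def)
  have P: "idl (polys N) P" unfolding P_def by (rule idl_rad_gen[OF gP])
  have radP: "p \<in> P" if "p \<in> polys N" "p ^ k \<in> P" for p k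
  proof -
    from that(2) obtain e where "(p ^ k) ^ e \<in> gen (polys N) (set\<^sub>v g)"
      unfolding P_def rad_gen_def by blast
    then have "p ^ (k * e) \<in> gen (polys N) (set\<^sub>v g)" by (simp add: power_mult)
    then show ?thesis using that(1) unfolding P_def rad_gen_def by blast
  qed
  have "\<exists>h \<in> polys N. ev (($) (a @\<^sub>v b)) h \<noteq> 0 \<and> (\<forall>p \<in> P. h * p \<in> gen (polys N) (set\<^sub>v g))"
    unfolding P_def N_def
    by (rule etale_locally_reduced) (use g b in \<open>auto simp: system_def etale_zero_def mp_value_ev\<close>)
  then obtain h where h: "h \<in> polys N" "mp_value (a @\<^sub>v b) h \<noteq> 0" "\<And>p. p \<in> P \<Longrightarrow> h * p \<in> gen (polys N) (set\<^sub>v g)"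
    unfolding mp_value_ev by blast
  define h' where "h' = h * dJ"
  have h': "h' \<in> polys N" unfolding h'_def by (rule polys_mult[OF h(1) dJ])
  have h'v: "mp_value (a @\<^sub>v b) h' \<noteq> 0"
    using h b by (simp add: h'_def dJ_def etale_zero_def mp_value_ev ev.hom_mult)
  then have h'0: "h' \<noteq> 0" by (auto simp: mp_value_ev)
  define u where "u = mp_var N * h' - 1"
  have hR: "h \<in> ?R" "dJ \<in> ?R" "h' \<in> ?R" using h h' dJ by (auto intro: polys_mono)
  have u: "u \<in> ?R" unfolding u_def using hR by (auto intro!: polys_diff polys_mult)
  define g' where "g' = g @\<^sub>v vec 1 (\<lambda>_. u)"
  have dim: "dim_vec g' = Suc ?r" by (simp add: g'_def)
  have g'S: "set\<^sub>v g' = set\<^sub>v g \<union> {u}"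
  proof -
    have "set\<^sub>v g' = (\<lambda>i. g' $ i) ` ({..<?r} \<union> {?r})" unfolding vec_set_def dim lessThan_Suc by auto
    also have "\<dots> = (\<lambda>i. g' $ i) ` {..<?r} \<union> {g' $ ?r}" by auto
    also have "(\<lambda>i. g' $ i) ` {..<?r} = (\<lambda>i. g $ i) ` {..<?r}"
      by (intro image_cong) (auto simp: g'_def index_append_vec)
    also have "g' $ ?r = u" by (simp add: g'_def index_append_vec)
    finally show ?thesis by (simp add: vec_set_def)
  qed
  have g'R: "set\<^sub>v g' \<subseteq> ?R" unfolding g'S using gP u by (auto intro: polys_mono)
  define I where "I = gen ?R (P \<union> {u})"
  have PR: "P \<union> {u} \<subseteq> ?R" using idlD(1)[OF P] u by (auto intro: polys_mono)
  have I: "idl ?R I" unfolding I_def by (rule idl_gen[OF subring_polys PR])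
  have uI: "u \<in> I" unfolding I_def by (intro gen_base subring_polys) simp
  have PI: "p \<in> I" if "p \<in> P" for p unfolding I_def using that by (intro gen_base subring_polys) simp
  have IA: "I = gen ?R (set\<^sub>v g')"
  proof (rule antisym)
    have A: "idl ?R (gen ?R (set\<^sub>v g'))" by (rule idl_gen[OF subring_polys g'R])
    have uA: "u \<in> gen ?R (set\<^sub>v g')" by (intro gen_base subring_polys) (simp add: g'S)
    have *: "q \<in> gen ?R (set\<^sub>v g')" if "q \<in> gen (polys N) (set\<^sub>v g)" for q using that
    proof (induction rule: gen.induct)
      case (step r s q)
      have "r \<in> ?R" using step(1) by (rule polys_mono) simp
      then show ?case using step by (intro gen.step) (auto simp: g'S)
    qed simp
    show "I \<subseteq> gen ?R (set\<^sub>v g')" unfolding I_def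
    proof (rule gen_least[OF A], rule subsetI)
      fix p assume "p \<in> P \<union> {u}"
      then consider "p \<in> P" | "p = u" by blast
      then show "p \<in> gen ?R (set\<^sub>v g')"
      proof cases
        case 1
        then have pR: "p \<in> ?R" using PR by blast
        \<comment> \<open>Modulo u, p equals x_N dJ h p, and h p lies in (g).\<close>
        have "mp_var N * dJ \<in> ?R" using hR by (intro polys_mult) auto
        then have "mp_var N * dJ * (h * p) \<in> gen ?R (set\<^sub>v g')"
          by (rule gen_mult[OF subring_polys *[OF h(3)[OF 1]]])
        moreover have "p * u \<in> gen ?R (set\<^sub>v g')" by (rule gen_mult[OF subring_polys uA pR])
        ultimately have "mp_var N * dJ * (h * p) - p * u \<in> gen ?R (set\<^sub>v g')"
          by (rule idl_diff[OF subring_polys A])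
        then show ?thesis by (simp add: u_def h'_def algebra_simps)
      qed (use uA in simp)
    qed
    have "s \<in> P" if "s \<in> set\<^sub>v g" for s
    proof -
      have "s ^ 1 \<in> gen (polys N) (set\<^sub>v g)" using that by (simp add: gen_base subring_polys)
      then show ?thesis using that gP unfolding P_def rad_gen_def by blast
    qed
    then show "gen ?R (set\<^sub>v g') \<subseteq> I"
      by (intro gen_least[OF I]) (auto simp: g'S uI intro: PI)
  qed
  have av: "affine_variety (Suc N, I)"
    unfolding affine_variety_iff
  proof (intro conjI ballI allI impI)
    fix p k assume p: "p \<in> ?R" "p ^ k \<in> I"
    have rad: "\<And>q j. q \<in> polys N \<Longrightarrow> q ^ j \<in> P \<Longrightarrow> q \<in> P" by (rule radP)
    show "p \<in> I"
      using radical_localisation[OF P rad h' h'0 p(1) p(2)[unfolded I_def u_def]] unfolding I_def u_def .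
  qed (rule I)
  have rz: "relative_zeros 0 (m, {0}) g' = (Suc N, I)"
  proof -
    have e: "m + dim_vec g' + 0 = Suc N" by (simp add: dim N_def)
    have "{g' $ i |i. i < dim_vec g'} = set\<^sub>v g'" by (auto simp: vec_set_def)
    then show ?thesis
      unfolding relative_zeros.simps Let_def e IA
      using g'R by (simp only: genideal_poly_ring gen_insert_0 Un_subset_iff polys_0 empty_subsetI insert_subset simp_thms)
  qed
  have detg': "det (jacobian m g') = dJ * h'"
  proof -
    have "mp_deriv N u = h'" using deriv_polys_0[OF h', of N]
      by (simp add: u_def deriv_diff deriv_mult deriv_var)
    then have "det (jacobian N (vec 1 (\<lambda>_. u))) = h'"
      by (subst det_single) (auto simp: jacobian_def)
    then show ?thesis unfolding g'_def by (simp add: det_jacobian_append[OF g] N_def dJ_def)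
  qed
  have ss: "standard_smooth 0 (m, {0}) g'"
  proof -
    have e: "m + dim_vec g' + 0 = Suc N" by (simp add: dim N_def)
    \<comment> \<open>The Jacobian determinant dJ h' has the inverse x_N^2 h, because h dJ = h' and
      x_N inverts h'.\<close>
    have "mp_var N * mp_var N * h * (dJ * h') - 1 = (mp_var N * h' + 1) * u"
      by (simp add: u_def h'_def algebra_simps)
    moreover have "(mp_var N * h' + 1) * u \<in> I"
      using uI hR by (intro idlD(4)[OF I] polys_add polys_mult) auto
    ultimately have "mp_var N * mp_var N * h * det (mat (dim_vec g') (dim_vec g') (\<lambda>(i, j). mp_deriv (m + j) (g' $ i))) - 1 \<in> I"
      using detg' by (simp add: jacobian_def)
    moreover have "mp_var N * mp_var N * h \<in> ?R" using hR by (intro polys_mult) auto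
    moreover have "\<forall>i<dim_vec g'. g' $ i \<in> ?R" using g'R by (auto simp: vec_set_def)
    ultimately show ?thesis unfolding standard_smooth.simps Let_def e rz by auto
  qed
  define \<phi> :: "'k mpoly vec" where "\<phi> = vec m mp_var"
  have et: "etale_affine (Suc N, I) (affine_space m) \<phi>"
    unfolding etale_affine_def affine_space_def
  proof (intro conjI ballI)
    show "affine_morphism (Suc N, I) (m, {0}) \<phi>"
      using idlD(2)[OF I] by (auto simp: \<phi>_def N_def)
    fix Q assume Q: "Q \<in> spec (Suc N, I)"
    have A: "1 \<notin> Q" using Q prime_1_notin by auto
    have B: "affine_iso (basic_open (Suc N, I) 1) (relative_zeros 0 (m, {0}) g') (vec (Suc N) mp_var)"
      unfolding rz by (rule iso_basic_open_1[OF I])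
    have C: "\<forall>i<m. vec (Suc N) mp_var $ i - \<phi> $ i \<in> snd (basic_open (Suc N, I) 1)"
    proof (intro allI impI)
      fix i assume "i < m"
      then have "vec (Suc N) mp_var $ i - \<phi> $ i = 0" by (simp add: \<phi>_def N_def)
      moreover have "0 \<in> snd (basic_open (Suc N, I) 1)"
        by (simp add: basic_open_eq[OF I] del: basic_open.simps)
      ultimately show "vec (Suc N) mp_var $ i - \<phi> $ i \<in> snd (basic_open (Suc N, I) 1)" by (simp only:)
    qed
    show "smooth_at 0 (Suc N, I) (m, {0}) \<phi> Q"
      unfolding smooth_at.simps
      by (rule bexI[of _ 1], rule conjI, rule A, rule exI[of _ g'], rule exI[of _ "vec (Suc N) mp_var"],
          intro conjI, rule ss, rule B, rule C, rule polys_1)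
  qed
  have mv: "morphism_value \<phi> v = vec m (\<lambda>i. v $ i)" for v
    by (rule eq_vecI) (auto simp: morphism_value_def \<phi>_def mp_value_ev)
  have a_in: "a \<in> morphism_value \<phi> ` affine_points (Suc N, I)"
  proof -
    let ?c = "a @\<^sub>v b"
    let ?v = "?c @\<^sub>v vec 1 (\<lambda>_. 1 / mp_value ?c h')"
    have c: "?c \<in> carrier_vec N" using b by (simp add: N_def)
    have app: "mp_value ?v p = mp_value ?c p" if "p \<in> polys N" for p by (rule mp_value_append[OF that c])
    have "mp_value ?v p = 0" if "p \<in> I" for p
      using that unfolding I_def
    proof (rule gen_ev_0)
      fix s assume "s \<in> P \<union> {u}"
      then consider "s \<in> P" | "s = u" by blast
      then show "mp_value ?v s = 0"
      proof cases
        case 1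
        then obtain e where s: "s \<in> polys N" "s ^ e \<in> gen (polys N) (set\<^sub>v g)" by (auto simp: P_def rad_gen_def)
        have "mp_value ?c (s ^ e) = 0"
          using s(2) by (rule gen_ev_0) (use b in \<open>auto simp: etale_zero_def vec_set_def\<close>)
        then have "mp_value ?c s = 0" by (simp add: mp_value_ev ev.hom_power)
        then show ?thesis using app s by simp
      next
        case 2
        have "?v $ N = 1 / mp_value ?c h'" using c b by (simp add: index_append_vec N_def)
        moreover have "mp_value ?v h' = mp_value ?c h'" by (rule app[OF h'])
        ultimately show ?thesis using h'v unfolding 2 u_def by (simp add: mp_value_ev ev.hom_minus ev.hom_mult)
      qed
    qed
    moreover have "?v \<in> carrier_vec (Suc N)" using c append_carrier_vec[of ?c N "vec 1 (\<lambda>_. 1 / mp_value ?c h')" 1] by simp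
    moreover have "morphism_value \<phi> ?v = a" unfolding mv using b by (intro eq_vecI) (auto simp: index_append_vec)
    ultimately show ?thesis by (intro image_eqI[of _ _ ?v]) auto
  qed
  have sub: "morphism_value \<phi> ` affine_points (Suc N, I) \<subseteq> etale_set m g"
  proof safe
    fix v assume v: "v \<in> affine_points (Suc N, I)"
    let ?c = "vec m (\<lambda>i. v $ i) @\<^sub>v vec ?r (\<lambda>j. v $ (m + j))"
    have app: "mp_value ?c p = mp_value v p" if "p \<in> polys N" for p
      using that by (rule mp_value_cong) (auto simp: index_append_vec N_def)
    have v0: "mp_value v p = 0" if "p \<in> I" for p using v that by simp
    have "mp_value ?c (g $ i) = 0" if "i < ?r" for i
    proof -
      have "g $ i \<in> set\<^sub>v g" using that by (auto simp: vec_set_def)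
      then have "g $ i \<in> I" unfolding IA by (intro gen_base subring_polys) (simp add: g'S)
      then show ?thesis using app[OF gN[OF that]] v0 by simp
    qed
    moreover have "mp_value v u = 0" by (rule v0[OF uI])
    then have "mp_value v dJ \<noteq> 0" by (auto simp: u_def h'_def mp_value_ev ev.hom_minus ev.hom_mult)
    then have "mp_value ?c dJ \<noteq> 0" using app[OF dJ] by simp
    ultimately have "etale_zero m g ?c" by (simp add: etale_zero_def dJ_def)
    then show "morphism_value \<phi> v \<in> etale_set m g" unfolding mv etale_set_def by auto
  qed
  show ?thesis using av et a_in sub by blast
qed

theorem etale_open_imp_openin:
  fixes U :: "'k::field vec set"
  assumes "etale_open m U"
  shows "openin (etale_topology (affine_space m)) U"
proof (subst openin_subopen, intro ballI)
  fix a assume "a \<in> U"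
  then obtain g where g: "system m g" "a \<in> etale_set m g" "etale_set m g \<subseteq> U"
    using assms by (auto simp: etale_open_def)
  obtain X \<phi> where X: "affine_variety X" "etale_affine X (affine_space m) \<phi>"
    "a \<in> morphism_value \<phi> ` affine_points X" "morphism_value \<phi> ` affine_points X \<subseteq> etale_set m g"
    using etale_neighbourhood[OF g(1,2)] by blast
  obtain n I where nI: "X = (n, I)" by (cases X)
  have "variety (single_chart X)" using X(1) unfolding nI by (rule variety_single_chart)
  moreover have "etale_morphism (single_chart X) (affine_space m) (\<lambda>_. \<phi>)"
    using X(1,2) unfolding nI affine_variety_iff by (intro etale_morphism_single_chart) auto
  ultimately have "openin (etale_topology (affine_space m)) (morphism_value \<phi> ` affine_points X)"
    unfolding etale_topology_def K_image_single_chart[symmetric]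
    by (intro topology_generated_by_Basis) blast
  then show "\<exists>T. openin (etale_topology (affine_space m)) T \<and> a \<in> T \<and> T \<subseteq> U"
    using X g by blast
qed

lemma prime_point_ideal: "primeideal (point_ideal n a) (poly_ring n)"
proof (rule primeidealI)
  show "ideal (point_ideal n a) (poly_ring n)"
    unfolding ideal_poly_ring idl_def
    by (auto simp: point_ideal_def mp_value_ev ev.hom_add ev.hom_mult intro: polys_intros)
  have "1 \<notin> point_ideal n a" by (simp add: point_ideal_def mp_value_ev)
  then show "carrier (poly_ring n) \<noteq> point_ideal n a" by auto
qed (auto simp: cring_poly_ring point_ideal_def mp_value_ev ev.hom_mult)

lemma mp_value_subst: "mp_value a (mp_subst \<sigma> p) = ev (\<lambda>i. mp_value a (\<sigma> i)) p"
  by (simp add: mp_value_ev ev_subst)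

lemma mp_value_morphism:
  "p \<in> polys (dim_vec \<phi>) \<Longrightarrow> mp_value (morphism_value \<phi> a) p = mp_value a (mp_subst (($) \<phi>) p)"
  unfolding mp_value_subst unfolding mp_value_ev by (rule ev_cong) (auto simp: morphism_value_def mp_value_ev)

text \<open>Smoothness at the prime of a provides a neighbourhood isomorphic to the zeros of a
  system g over V. The inverse isomorphism \<open>\<psi>\<close> turns solutions of g above points
  of V into K-points of the source, which yields the inclusion.\<close>

lemma etale_image_neighbourhood:
  fixes I :: "'k::field mpoly set"
  assumes I: "idl (polys n) I" and J: "idl (polys m) J" and \<phi>: "etale_affine (n, I) (m, J) \<phi>"
    and a: "a \<in> affine_points (n, I)"
  shows "\<exists>g. system m g \<and> morphism_value \<phi> a \<in> etale_set m g \<and>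
    etale_set m g \<inter> affine_points (m, J) \<subseteq> morphism_value \<phi> ` affine_points (n, I)"
proof -
  have ac: "a \<in> carrier_vec n" and a0: "\<And>p. p \<in> I \<Longrightarrow> mp_value a p = 0" using a by auto
  have mor: "\<phi> \<in> carrier_vec m" "\<And>i. i < m \<Longrightarrow> \<phi> $ i \<in> polys n"
    using \<phi> by (auto simp: etale_affine_def)
  have "I \<subseteq> point_ideal n a" using idlD(1)[OF I] a0 by (auto simp: point_ideal_def)
  then have "point_ideal n a \<in> spec (n, I)" by (simp add: prime_point_ideal)
  then have "smooth_at 0 (n, I) (m, J) \<phi> (point_ideal n a)" using \<phi> unfolding etale_affine_def by blast
  then obtain h g \<alpha> where h: "h \<in> polys n" "h \<notin> point_ideal n a" and ss: "standard_smooth 0 (m, J) g"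
    and iso: "affine_iso (basic_open (n, I) h) (relative_zeros 0 (m, J) g) \<alpha>"
    and \<alpha>\<phi>: "\<And>i. i < m \<Longrightarrow> \<alpha> $ i - \<phi> $ i \<in> snd (basic_open (n, I) h)"
    unfolding smooth_at.simps by blast
  have ha: "mp_value a h \<noteq> 0" using h by (simp add: point_ideal_def)
  let ?r = "dim_vec g"
  define N where "N = m + ?r"
  have e: "m + ?r + 0 = N" by (simp add: N_def)
  have g: "system m g" using ss by (auto simp: system_def Let_def)
  have gS: "{g $ i | i. i < ?r} = set\<^sub>v g" by (auto simp: vec_set_def)
  have SN: "J \<union> set\<^sub>v g \<subseteq> polys N"
    using idlD(1)[OF J] g by (auto simp: system_def N_def vec_set_def intro: polys_mono)
  define A where "A = gen (polys N) (J \<union> set\<^sub>v g)"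
  have rz: "relative_zeros 0 (m, J) g = (N, A)"
    unfolding relative_zeros.simps Let_def e gS genideal_poly_ring[OF SN] A_def ..
  define B where "B = gen (polys (Suc n)) (I \<union> {mp_var n * h - 1})"
  have bo: "basic_open (n, I) h = (Suc n, B)" unfolding B_def by (rule basic_open_eq[OF I h(1)])
  obtain u where u: "u * det (jacobian m g) - 1 \<in> A"
    using ss rz by (auto simp: Let_def jacobian_def e)
  obtain \<psi> where \<alpha>: "\<alpha> \<in> carrier_vec N" "\<And>i. i < N \<Longrightarrow> \<alpha> $ i \<in> polys (Suc n)"
      "\<And>p. p \<in> A \<Longrightarrow> mp_subst (($) \<alpha>) p \<in> B"
    and \<psi>: "\<psi> \<in> carrier_vec (Suc n)" "\<And>i. i < Suc n \<Longrightarrow> \<psi> $ i \<in> polys N"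
      "\<And>p. p \<in> B \<Longrightarrow> mp_subst (($) \<psi>) p \<in> A"
    and \<psi>\<alpha>: "\<And>i. i < N \<Longrightarrow> mp_subst (($) \<psi>) (\<alpha> $ i) - mp_var i \<in> A"
    using iso unfolding rz bo affine_iso.simps affine_morphism.simps by (elim conjE exE) (rule that; blast)
  have BR: "idl (polys (Suc n)) B" unfolding B_def
    using idlD(1)[OF I] h(1) by (intro idl_gen subring_polys) (auto intro!: polys_diff polys_mult intro: polys_mono)
  have AR: "idl (polys N) A" unfolding A_def by (rule idl_gen[OF subring_polys SN])
  \<comment> \<open>The point above a in the principal open subscheme h \<noteq> 0.\<close>
  let ?a = "a @\<^sub>v vec 1 (\<lambda>_. 1 / mp_value a h)"
  have app: "mp_value ?a p = mp_value a p" if "p \<in> polys n" for p by (rule mp_value_append[OF that ac])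
  have B0: "mp_value ?a p = 0" if "p \<in> B" for p
    using that unfolding B_def
  proof (rule gen_ev_0)
    fix s assume "s \<in> I \<union> {mp_var n * h - 1}"
    then consider "s \<in> I" | "s = mp_var n * h - 1" by blast
    then show "mp_value ?a s = 0"
    proof cases
      case 1
      then show ?thesis using app[of s] a0 idlD(1)[OF I] by auto
    next
      case 2
      have "?a $ n = 1 / mp_value a h" using ac by (simp add: index_append_vec)
      then show ?thesis using app[OF h(1)] ha unfolding 2 by (simp add: mp_value_ev ev.hom_minus ev.hom_mult)
    qed
  qed
  have dim\<alpha>: "dim_vec \<alpha> = N" "dim_vec \<psi> = Suc n" "dim_vec \<phi> = m" using \<alpha> \<psi> mor by auto
  have in_set: "morphism_value \<phi> a \<in> etale_set m g"
  proof -
    let ?b = "morphism_value \<alpha> ?a"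
    have bN: "?b \<in> carrier_vec N" using \<alpha>(1) by (simp add: morphism_value_def)
    have A0: "mp_value ?b p = 0" if "p \<in> A" for p
      using that B0[OF \<alpha>(3)[OF that]] idlD(1)[OF AR] by (subst mp_value_morphism) (auto simp: dim\<alpha>)
    obtain b1 b2 where b: "?b = b1 @\<^sub>v b2" "b1 \<in> carrier_vec m" "b2 \<in> carrier_vec ?r"
      using bN unfolding N_def by (rule split_vec)
    have "b1 = morphism_value \<phi> a"
    proof (rule eq_vecI)
      fix i assume "i < dim_vec (morphism_value \<phi> a)"
      then have i: "i < m" using mor by (simp add: morphism_value_def)
      have "b1 $ i = ?b $ i" using b i by (simp add: index_append_vec)
      also have "\<dots> = mp_value ?a (\<alpha> $ i)" using i dim\<alpha> by (simp add: morphism_value_def N_def)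
      also have "\<dots> = mp_value ?a (\<phi> $ i)"
        using B0[of "\<alpha> $ i - \<phi> $ i"] \<alpha>\<phi>[OF i] unfolding bo by (simp add: mp_value_ev ev.hom_minus)
      also have "\<dots> = mp_value a (\<phi> $ i)" by (rule app[OF mor(2)[OF i]])
      finally show "b1 $ i = morphism_value \<phi> a $ i" using i dim\<alpha> by (simp add: morphism_value_def)
    qed (use b mor in \<open>auto simp: morphism_value_def\<close>)
    moreover have "etale_zero m g ?b"
      unfolding etale_zero_def
    proof (intro conjI allI impI)
      fix i assume "i < ?r"
      then have "g $ i \<in> A" unfolding A_def by (intro gen_base subring_polys) (auto simp: vec_set_def)
      then show "mp_value ?b (g $ i) = 0" by (rule A0)
    next
      show "mp_value ?b (det (jacobian m g)) \<noteq> 0"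
        using A0[OF u] by (auto simp: mp_value_ev ev.hom_minus ev.hom_mult)
    qed
    ultimately show ?thesis using b unfolding etale_set_def by auto
  qed
  have "v \<in> morphism_value \<phi> ` affine_points (n, I)" if v: "v \<in> etale_set m g" "v \<in> affine_points (m, J)" for v
  proof -
    obtain y where vy: "v \<in> carrier_vec m" "y \<in> carrier_vec ?r" "etale_zero m g (v @\<^sub>v y)"
      using v(1) by (auto simp: etale_set_def)
    let ?w = "v @\<^sub>v y"
    have A0: "mp_value ?w p = 0" if "p \<in> A" for p
      using that unfolding A_def
    proof (rule gen_ev_0)
      fix s assume "s \<in> J \<union> set\<^sub>v g"
      then consider "s \<in> J" | "s \<in> set\<^sub>v g" by blast
      then show "mp_value ?w s = 0"
      proof cases
        case 1
        then have "mp_value v s = 0" "s \<in> polys m" using v(2) idlD(1)[OF J] by auto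
        then show ?thesis using mp_value_append[of s m v y] vy by simp
      next
        case 2
        then show ?thesis using vy(3) by (auto simp: etale_zero_def vec_set_def)
      qed
    qed
    let ?c = "morphism_value \<psi> ?w"
    have B0': "mp_value ?c p = 0" if "p \<in> B" for p
      using that A0[OF \<psi>(3)[OF that]] idlD(1)[OF BR] by (subst mp_value_morphism) (auto simp: dim\<alpha>)
    let ?a' = "vec n (\<lambda>i. ?c $ i)"
    have app': "mp_value ?a' p = mp_value ?c p" if "p \<in> polys n" for p
      using that by (rule mp_value_cong) simp
    have "mp_value ?a' p = 0" if "p \<in> I" for p
    proof -
      have "p \<in> B" unfolding B_def using that by (intro gen_base subring_polys) simp
      then show ?thesis using B0' app'[of p] idlD(1)[OF I] that by auto
    qed
    then have a': "?a' \<in> affine_points (n, I)" by simp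
    have "morphism_value \<phi> ?a' = v"
    proof (rule eq_vecI)
      fix i assume "i < dim_vec v"
      then have i: "i < m" "i < N" using vy by (auto simp: N_def)
      have "morphism_value \<phi> ?a' $ i = mp_value ?a' (\<phi> $ i)" using i dim\<alpha> by (simp add: morphism_value_def)
      also have "\<dots> = mp_value ?c (\<phi> $ i)" by (rule app'[OF mor(2)[OF i(1)]])
      also have "\<dots> = mp_value ?c (\<alpha> $ i)"
        using B0'[of "\<alpha> $ i - \<phi> $ i"] \<alpha>\<phi>[OF i(1)] unfolding bo by (simp add: mp_value_ev ev.hom_minus)
      also have "\<dots> = mp_value ?w (mp_subst (($) \<psi>) (\<alpha> $ i))"
        using \<alpha>(2)[OF i(2)] by (intro mp_value_morphism) (simp add: dim\<alpha>)
      also have "\<dots> = ?w $ i"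
        using A0[OF \<psi>\<alpha>[OF i(2)]] by (simp add: mp_value_ev ev.hom_minus)
      also have "\<dots> = v $ i" using i vy by (simp add: index_append_vec)
      finally show "morphism_value \<phi> ?a' $ i = v $ i" .
    qed (use vy dim\<alpha> in \<open>auto simp: morphism_value_def\<close>)
    then show ?thesis using a' by (metis image_eqI)
  qed
  then show ?thesis using g in_set by blast
qed

text \<open>U is the union of all sets \<open>etale_set m g\<close> whose trace on V lies in the
  image. By the local result these cover the image.\<close>

lemma K_image_eq:
  fixes J :: "'k::field mpoly set"
  assumes J: "idl (polys m) J" and X: "variety X" "etale_morphism X (m, J) \<Phi>"
  shows "\<exists>U. etale_open m U \<and> K_image X \<Phi> = U \<inter> affine_points (m, J)"
proof -
  have chart: "\<exists>n I. chart X i = (n, I) \<and> idl (polys n) I \<and> etale_affine (n, I) (m, J) (\<Phi> i)" if "i < n_charts X" for i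
  proof -
    obtain n I where nI: "chart X i = (n, I)" by (cases "chart X i")
    have "affine_variety (chart X i)" "etale_affine (chart X i) (m, J) (\<Phi> i)"
      using X \<open>i < n_charts X\<close> by (auto simp: variety_def etale_morphism_def)
    then show ?thesis unfolding nI affine_variety_iff by blast
  qed
  let ?G = "{g. system m g \<and> etale_set m g \<inter> affine_points (m, J) \<subseteq> K_image X \<Phi>}"
  let ?U = "\<Union>g\<in>?G. etale_set m g"
  have "etale_open m ?U" by (rule etale_open_UN) (auto intro: etale_open_etale_set)
  moreover have "?U \<inter> affine_points (m, J) \<subseteq> K_image X \<Phi>" by blast
  moreover have "K_image X \<Phi> \<subseteq> ?U \<inter> affine_points (m, J)"
  proof
    fix x assume "x \<in> K_image X \<Phi>"
    then obtain i a where ia: "i < n_charts X" "a \<in> affine_points (chart X i)" "x = morphism_value (\<Phi> i) a"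
      by (auto simp: K_image_def glued_points_def)
    obtain n I where nI: "chart X i = (n, I)" "idl (polys n) I" "etale_affine (n, I) (m, J) (\<Phi> i)"
      using chart[OF ia(1)] by blast
    have sub: "morphism_value (\<Phi> i) ` affine_points (n, I) \<subseteq> K_image X \<Phi>"
    proof safe
      fix b assume "b \<in> affine_points (n, I)"
      then show "morphism_value (\<Phi> i) b \<in> K_image X \<Phi>"
        unfolding K_image_def using ia(1) nI(1) by (intro image_eqI[of _ _ "(i, b)"]) (auto simp: glued_points_def)
    qed
    have aI: "a \<in> affine_points (n, I)" using ia(2) unfolding nI(1) .
    obtain g where g: "system m g" "x \<in> etale_set m g"
        "etale_set m g \<inter> affine_points (m, J) \<subseteq> morphism_value (\<Phi> i) ` affine_points (n, I)"
      using etale_image_neighbourhood[OF nI(2) J nI(3) aI] unfolding ia(3) by blast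
    have mor: "\<Phi> i \<in> carrier_vec m" "\<And>p. p \<in> J \<Longrightarrow> mp_subst (($) (\<Phi> i)) p \<in> I"
      using nI(3) by (auto simp: etale_affine_def)
    have "mp_value x p = 0" if "p \<in> J" for p
    proof -
      have "p \<in> polys (dim_vec (\<Phi> i))" using that idlD(1)[OF J] mor(1) by auto
      then show ?thesis using aI mor(2)[OF that] unfolding ia(3) by (simp add: mp_value_morphism)
    qed
    moreover have "x \<in> carrier_vec m" using mor(1) by (simp add: ia(3) morphism_value_def)
    ultimately have "x \<in> affine_points (m, J)" by simp
    then show "x \<in> ?U \<inter> affine_points (m, J)" using g sub by blast
  qed
  ultimately show ?thesis by blast
qed

theorem openin_etale_topology:
  fixes J :: "'k::field mpoly set"
  assumes J: "idl (polys m) J" and D: "openin (etale_topology (m, J)) D"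
  shows "\<exists>U. etale_open m U \<and> D = U \<inter> affine_points (m, J)"
  using D unfolding etale_topology_def openin_topology_generated_by_iff
proof (induction rule: generate_topology_on.induct)
  case Empty
  show ?case by (rule exI[of _ "{}"]) (auto simp: etale_open_def)
next
  case (Int a b)
  then obtain U V where "etale_open m U" "a = U \<inter> affine_points (m, J)" "etale_open m V" "b = V \<inter> affine_points (m, J)"
    by blast
  then show ?case by (intro exI[of _ "U \<inter> V"]) (auto intro: etale_open_Int)
next
  case (UN K)
  then obtain U where U: "\<And>k. k \<in> K \<Longrightarrow> etale_open m (U k)" "\<And>k. k \<in> K \<Longrightarrow> k = U k \<inter> affine_points (m, J)"
    by metis
  have "\<Union>K = (\<Union>k\<in>K. U k) \<inter> affine_points (m, J)" using U(2) by blast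
  moreover have "etale_open m (\<Union>k\<in>K. U k)" using U(1) by (rule etale_open_UN)
  ultimately show ?case by blast
next
  case (Basis s)
  then show ?case using K_image_eq[OF J] by blast
qed

section \<open>Triangular systems for prime ideals\<close>

text \<open>Records the properties of a power of the characteristic exponent. It includes q = 1, so
  characteristic 0 needs no separate treatment.\<close>

definition power_automorphism :: "'k::field itself \<Rightarrow> nat \<Rightarrow> bool" where
  "power_automorphism _ q \<longleftrightarrow> q > 0 \<and> comm_ring_hom (\<lambda>x :: 'k. x ^ q) \<and> surj (\<lambda>x :: 'k. x ^ q)"

definition perfect :: "'k::field itself \<Rightarrow> bool" where
  "perfect T \<longleftrightarrow> (CHAR('k) > 0 \<longrightarrow> power_automorphism T CHAR('k))"

lemma power_automorphism_1: "power_automorphism TYPE('k::field) 1"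
  unfolding power_automorphism_def by (auto intro: comm_ring_hom_id)

lemma power_automorphism_mult:
  assumes "power_automorphism TYPE('k::field) p" "power_automorphism TYPE('k) q"
  shows "power_automorphism TYPE('k) (p * q)"
proof -
  have pq: "(\<lambda>x :: 'k. x ^ (p * q)) = (\<lambda>x. (x ^ p) ^ q)" by (simp add: power_mult)
  have hom: "comm_ring_hom (\<lambda>x :: 'k. x ^ p)" "comm_ring_hom (\<lambda>x :: 'k. x ^ q)"
    and surj: "surj (\<lambda>x :: 'k. x ^ p)" "surj (\<lambda>x :: 'k. x ^ q)" and pos: "p > 0" "q > 0"
    using assms by (simp_all add: power_automorphism_def)
  have "comm_ring_hom (\<lambda>x :: 'k. (x ^ p) ^ q)" by (rule comm_ring_hom_comp[OF hom(2) hom(1)])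
  moreover have "surj (\<lambda>x :: 'k. (x ^ p) ^ q)"
    using comp_surj[OF surj(1) surj(2)] by (simp add: comp_def)
  ultimately show ?thesis unfolding power_automorphism_def pq using pos by simp
qed

section \<open>Polynomials in X^q and pseudo-division\<close>

definition poly_expand :: "nat \<Rightarrow> 'a::comm_ring_1 poly \<Rightarrow> 'a poly" where
  "poly_expand q A = (\<Sum>k\<le>degree A. monom (coeff A k) (k * q))"

lemma poly_poly_expand: "poly (poly_expand q A) x = poly A (x ^ q)"
  by (simp add: poly_expand_def poly_sum poly_monom poly_altdef[of A] power_mult[symmetric] mult.commute)

lemma coeff_poly_expand:
  assumes "q > 0"
  shows "coeff (poly_expand q A) (k * q) = coeff A k"
proof -
  have "coeff (poly_expand q A) (k * q) = (\<Sum>j\<le>degree A. if j = k then coeff A j else 0)"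
    unfolding poly_expand_def coeff_sum using assms by (intro sum.cong) auto
  also have "\<dots> = coeff A k" by (simp add: coeff_eq_0)
  finally show ?thesis .
qed

lemma degree_poly_expand: "degree (poly_expand q A) \<le> degree A * q"
  unfolding poly_expand_def
proof (rule degree_sum_le)
  fix k assume "k \<in> {..degree A}"
  then have "k * q \<le> degree A * q" by simp
  then show "degree (monom (coeff A k) (k * q)) \<le> degree A * q"
    using degree_monom_le[of "coeff A k" "k * q"] by linarith
qed simp

lemma poly_over_sum:
  "subring_set R \<Longrightarrow> (\<And>i. i \<in> X \<Longrightarrow> f i \<in> poly_over R) \<Longrightarrow> sum f X \<in> poly_over R"
  using subring_poly_over[of R]
  by (induction X rule: infinite_finite_induct) (auto simp: subring_setD)

lemma poly_over_expand: "subring_set R \<Longrightarrow> A \<in> poly_over R \<Longrightarrow> poly_expand q A \<in> poly_over R"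
  unfolding poly_expand_def by (intro poly_over_sum poly_over_monom) (auto simp: poly_over_def)

lemma poly_over_pderiv: "subring_set R \<Longrightarrow> A \<in> poly_over R \<Longrightarrow> pderiv A \<in> poly_over R"
proof -
  assume R: "subring_set R" and A: "A \<in> poly_over R"
  have "of_nat k \<in> R" for k using R by (induction k) (auto simp: subring_setD)
  then show ?thesis using R A by (auto simp: poly_over_def coeff_pderiv intro!: subring_setD simp del: of_nat_Suc)
qed

lemma poly_over_smult: "subring_set R \<Longrightarrow> r \<in> R \<Longrightarrow> A \<in> poly_over R \<Longrightarrow> smult r A \<in> poly_over R"
  by (auto simp: poly_over_def subring_setD)

text \<open>The leading coefficient is not inverted; a power of it on the left keeps all quotients
  over R. The divisor enters through a degree bound d and its coefficient at d, so that
  \<open>poly_expand q A\<close> can be used with d = degree A * q directly.\<close>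

lemma pseudo_division:
  fixes B C :: "'a::comm_ring_1 poly"
  assumes R: "subring_set R" and B: "B \<in> poly_over R" "degree B \<le> d" "d > 0" and C: "C \<in> poly_over R"
  shows "\<exists>e Q S. Q \<in> poly_over R \<and> S \<in> poly_over R \<and> degree S < d \<and> smult (coeff B d ^ e) C = B * Q + S"
  using C
proof (induction "degree C" arbitrary: C rule: less_induct)
  case less
  have PR: "subring_set (poly_over R)" by (rule subring_poly_over[OF R])
  let ?l = "coeff B d"
  have l: "?l \<in> R" using B by (simp add: poly_over_def)
  show ?case
  proof (cases "degree C < d")
    case True
    then show ?thesis using less.prems PR by (intro exI[of _ 0] exI[of _ 0] exI[of _ C]) (simp add: subring_setD)
  next
    case False
    let ?n = "degree C"
    let ?M = "monom (lead_coeff C) (?n - d)"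
    have M: "?M \<in> poly_over R" using less.prems R by (intro poly_over_monom) (auto simp: poly_over_def)
    define C' where "C' = smult ?l C - B * ?M"
    have C': "C' \<in> poly_over R"
      using subring_setD[OF PR] poly_over_smult[OF R l less.prems] B(1) M unfolding C'_def
      by (metis add_uminus_conv_diff)
    have "degree (B * ?M) \<le> ?n"
      using degree_mult_le[of B ?M] degree_monom_le[of "lead_coeff C" "?n - d"] B(2) False by linarith
    then have "degree C' \<le> ?n"
      unfolding C'_def by (intro degree_diff_le) (auto intro: order.trans[OF degree_smult_le])
    moreover have "coeff C' ?n = 0"
    proof -
      have "coeff (B * ?M) ?n = ?l * lead_coeff C"
        using False unfolding mult.commute[of B ?M] coeff_monom_mult by (simp add: mult.commute)
      then show ?thesis by (simp add: C'_def)
    qed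
    moreover have "degree C' \<noteq> ?n \<or> C' = 0" using \<open>coeff C' ?n = 0\<close> by (metis leading_coeff_0_iff)
    ultimately have "degree C' < ?n" using False B(3) by auto
    from less.hyps[OF this C'] obtain e Q S where
      eQS: "Q \<in> poly_over R" "S \<in> poly_over R" "degree S < d" "smult (?l ^ e) C' = B * Q + S" by blast
    have "smult (?l ^ Suc e) C = smult (?l ^ e) (C' + B * ?M)" by (simp add: C'_def mult.commute)
    also have "\<dots> = B * Q + S + smult (?l ^ e) (B * ?M)" by (simp only: smult_add_right eQS(4))
    also have "\<dots> = B * (Q + smult (?l ^ e) ?M) + S" by (simp add: algebra_simps)
    finally have eq: "smult (?l ^ Suc e) C = B * (Q + smult (?l ^ e) ?M) + S" .
    have le: "?l ^ k \<in> R" for k using R l by (induction k) (auto simp: subring_setD)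
    have "Q + smult (?l ^ e) ?M \<in> poly_over R"
      using subring_setD(3)[OF PR eQS(1) poly_over_smult[OF R le M]] .
    then show ?thesis using eQS eq by blast
  qed
qed

section \<open>Free and algebraic coordinates modulo a prime ideal\<close>

definition prime_idl :: "nat \<Rightarrow> 'k::field mpoly set \<Rightarrow> bool" where
  "prime_idl M P \<longleftrightarrow> idl (polys M) P \<and> 1 \<notin> P \<and> (\<forall>a\<in>polys M. \<forall>b\<in>polys M. a * b \<in> P \<longrightarrow> a \<in> P \<or> b \<in> P)"

text \<open>Transcendence of x_i over the preceding coordinates modulo P, phrased without passing to
  a residue field.\<close>

definition free_coord :: "'k::field mpoly set \<Rightarrow> nat \<Rightarrow> bool" where
  "free_coord P i \<longleftrightarrow> (\<forall>C \<in> poly_over (polys i). poly C (mp_var i) \<in> P \<longrightarrow> (\<forall>k. coeff C k \<in> P))"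

text \<open>The \<open>i\<close>-th coordinate is algebraic over the preceding ones, \<open>A(X\<^sup>q)\<close> being a polynomial of minimal
  degree that annihilates it and \<open>A\<close> being separable.\<close>

definition algebraic_coord :: "'k::field mpoly set \<Rightarrow> nat \<Rightarrow> 'k mpoly poly \<Rightarrow> nat \<Rightarrow> bool" where
  "algebraic_coord P i A q \<longleftrightarrow> A \<in> poly_over (polys i) \<and> power_automorphism TYPE('k) q \<and>
     poly A (mp_var i ^ q) \<in> P \<and> lead_coeff A \<notin> P \<and> poly (pderiv A) (mp_var i ^ q) \<notin> P \<and> degree A * q > 0 \<and>
     (\<forall>C \<in> poly_over (polys i). degree C < degree A * q \<longrightarrow> poly C (mp_var i) \<in> P \<longrightarrow> (\<forall>k. coeff C k \<in> P))"

lemma poly_in_idl: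
  assumes P: "idl (polys M) P" and i: "i < M" and C: "\<And>k. coeff C k \<in> P" and x: "x \<in> polys M"
  shows "poly C x \<in> P"
  unfolding poly_altdef
proof (rule idl_sum[OF P])
  fix k
  have "x ^ k * coeff C k \<in> P" using x C by (intro idlD(4)[OF P] polys_power)
  then show "coeff C k * x ^ k \<in> P" by (simp add: mult.commute)
qed

text \<open>Let d be the least degree of a nontrivial relation. Among the relations A(X^q) of degree
  d choose one with A of least degree. If the derivative of A vanished at x_i^q modulo P, minimality
  of d would put all its coefficients into P; then A would be a polynomial in X^p modulo P, against
  the choice of A.\<close>

lemma free_or_algebraic:
  fixes P :: "'k::field mpoly set"
  assumes perf: "perfect TYPE('k)" and P: "prime_idl M P" and i: "i < M"
  shows "free_coord P i \<or> (\<exists>A q. algebraic_coord P i A q)"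
proof (rule disjCI)
  assume "\<nexists>A q. algebraic_coord P i A q"
  then have no: "\<And>A q. \<not> algebraic_coord P i A q" by blast
  have I: "idl (polys M) P"
    using P by (auto simp: prime_idl_def)
  let ?R = "polys i :: 'k mpoly set"
  let ?T = "\<lambda>C. C \<in> poly_over ?R \<and> poly C (mp_var i) \<in> P \<and> (\<exists>k. coeff C k \<notin> P)"
  show "free_coord P i"
  proof (rule ccontr)
    assume "\<not> free_coord P i"
    then obtain C0 where "?T C0" by (auto simp: free_coord_def)
    then obtain B where B: "?T B" and Bmin: "\<And>C. ?T C \<Longrightarrow> degree B \<le> degree C"
      using ex_has_least_nat[of ?T C0 degree] by blast
    define d where "d = degree B"
    have small: "coeff C k \<in> P" if "C \<in> poly_over ?R" "degree C < d" "poly C (mp_var i) \<in> P" for C k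
      using Bmin[of C] that unfolding d_def by fastforce
    have xi: "mp_var i \<in> polys M" using i by simp
    \<comment> \<open>A leading term with coefficient in P could be dropped, leaving a nontrivial
      relation of smaller degree.\<close>
    have lc: "lead_coeff B \<notin> P"
    proof
      assume lcP: "lead_coeff B \<in> P"
      define C where "C = B - monom (lead_coeff B) (degree B)"
      have mP: "monom (lead_coeff B) (degree B) \<in> poly_over ?R"
        using B by (intro poly_over_monom subring_polys) (auto simp: poly_over_def)
      have C1: "C \<in> poly_over ?R"
        using B mP subring_setD[OF subring_poly_over[OF subring_polys[of i]]] unfolding C_def
        by (metis add_uminus_conv_diff)
      have "poly (monom (lead_coeff B) (degree B)) (mp_var i) \<in> P"
        using lcP idlD(2)[OF I] by (intro poly_in_idl[OF I i _ xi]) auto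
      then have C2: "poly C (mp_var i) \<in> P" unfolding C_def poly_diff using B by (intro idl_diff[OF subring_polys I]) auto
      obtain k where k: "coeff B k \<notin> P" using B by blast
      then have "k \<noteq> degree B" using lcP by blast
      then have C3: "coeff C k \<notin> P" using k by (simp add: C_def)
      have "degree C \<noteq> degree B \<or> C = 0"
      proof -
        have "coeff C (degree B) = 0" by (simp add: C_def)
        then show ?thesis by (metis leading_coeff_0_iff)
      qed
      moreover have "degree C \<le> degree B" unfolding C_def by (intro degree_diff_le degree_monom_le) auto
      moreover have "C \<noteq> 0" using C3 idlD(2)[OF I] by auto
      ultimately have "degree C < d" unfolding d_def by auto
      then show False using small[OF C1 _ C2, of k] C3 by blast
    qed
    have d0: "d > 0"
    proof (rule ccontr)
      assume "\<not> d > 0"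
      then have "degree B = 0" by (simp add: d_def)
      then obtain b where "B = [:b:]" by (metis degree_eq_zeroE)
      then show False using B lc by simp
    qed
    let ?X = "\<lambda>A. A \<in> poly_over ?R \<and> lead_coeff A \<notin> P \<and>
      (\<exists>q. power_automorphism TYPE('k) q \<and> degree A * q = d \<and> poly A (mp_var i ^ q) \<in> P)"
    have "?X B" using B lc power_automorphism_1 by (auto simp: d_def intro!: exI[of _ 1])
    then obtain A where A: "?X A" and Amin: "\<And>C. ?X C \<Longrightarrow> degree A \<le> degree C"
      using ex_has_least_nat[of ?X B degree] by blast
    obtain q where q: "power_automorphism TYPE('k) q" "degree A * q = d" "poly A (mp_var i ^ q) \<in> P" using A by blast
    have AR: "A \<in> poly_over ?R" and lA: "lead_coeff A \<notin> P" using A by blast+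
    have q0: "q > 0" using q(1) by (simp add: power_automorphism_def)
    define e where "e = degree A"
    have e0: "e > 0" using q(2) d0 by (cases e) (auto simp: e_def)
    have min: "\<forall>C \<in> poly_over ?R. degree C < degree A * q \<longrightarrow> poly C (mp_var i) \<in> P \<longrightarrow> (\<forall>k. coeff C k \<in> P)"
      unfolding q(2) using small by blast
    have "poly (pderiv A) (mp_var i ^ q) \<in> P"
      using no[of A q] AR q lA min d0 unfolding algebraic_coord_def by auto
    then have pd: "poly (poly_expand q (pderiv A)) (mp_var i) \<in> P" by (simp add: poly_poly_expand)
    \<comment> \<open>The relation given by the derivative has degree below d and is therefore
      trivial.\<close>
    have "degree (poly_expand q (pderiv A)) < d"
    proof -
      have "degree (pderiv A) \<le> e - 1" by (rule degree_le) (auto simp: coeff_pderiv e_def coeff_eq_0)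
      then have "degree (pderiv A) < degree A" using e0 by (simp add: e_def)
      then have "degree (pderiv A) * q < degree A * q" using q0 by simp
      then show ?thesis using degree_poly_expand[of q "pderiv A"] q(2) by linarith
    qed
    then have "coeff (poly_expand q (pderiv A)) (k * q) \<in> P" for k
      using AR pd by (intro small poly_over_expand poly_over_pderiv subring_polys)
    then have "coeff (pderiv A) k \<in> P" for k using coeff_poly_expand[OF q0] by metis
    then have dP: "of_nat (Suc k) * coeff A (Suc k) \<in> P" for k by (metis coeff_pderiv)
    have kP: "coeff A k \<in> P" if "of_nat k \<noteq> (0 :: 'k)" for k
    proof -
      from that obtain j where j: "k = Suc j" by (cases k) auto
      have "mp_const (1 / of_nat k) * (of_nat k * coeff A k) \<in> P"
        unfolding j by (rule idlD(4)[OF I polys_const dP])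
      moreover have "mp_const (1 / of_nat k) * (of_nat k * coeff A k) = mp_const (1 / of_nat k * of_nat k) * coeff A k"
        by (simp only: mpc.hom_mult mpc.hom_of_nat mult.assoc)
      ultimately show ?thesis using that by simp
    qed
    let ?p = "CHAR('k)"
    have "of_nat e = (0 :: 'k)" using kP[of e] lA by (auto simp: e_def)
    then have pe: "?p dvd e" by (simp add: of_nat_eq_0_iff_char_dvd)
    then have p0: "?p > 0" using e0 by (cases "?p = 0") auto
    then have padm: "power_automorphism TYPE('k) ?p" using perf by (simp add: perfect_def)
    have p1: "?p > 1" using prime_CHAR_semidom[OF p0] prime_gt_1_nat by blast
    \<comment> \<open>The coefficients of A at multiples of p; the others lie in P, so A2(X^p)
      agrees with A modulo P.\<close>
    define A2 where "A2 = (\<Sum>k\<le>e div ?p. monom (coeff A (?p * k)) k)"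
    have A2c: "coeff A2 k = (if k \<le> e div ?p then coeff A (?p * k) else 0)" for k
      unfolding A2_def coeff_sum by (simp add: sum.delta)
    have A2R: "A2 \<in> poly_over ?R" using AR by (auto simp: poly_over_def A2c)
    have A2l: "coeff A2 (e div ?p) = lead_coeff A" using pe by (simp add: A2c e_def)
    have A2d: "degree A2 = e div ?p"
    proof (rule antisym)
      show "degree A2 \<le> e div ?p" by (rule degree_le) (simp add: A2c)
      have "lead_coeff A \<noteq> 0" using lA idlD(2)[OF I] by auto
      then show "e div ?p \<le> degree A2" using A2l by (intro le_degree) simp
    qed
    have "poly A2 (mp_var i ^ (?p * q)) \<in> P"
    proof -
      let ?y = "mp_var i ^ q :: 'k mpoly"
      have y: "?y \<in> polys M" using xi by (rule polys_power)
      have "poly A ?y = (\<Sum>k\<le>e. coeff A k * ?y ^ k)" by (simp add: poly_altdef e_def)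
      also have "\<dots> = (\<Sum>k\<in>{k\<in>{..e}. ?p dvd k}. coeff A k * ?y ^ k) + (\<Sum>k\<in>{k\<in>{..e}. \<not> ?p dvd k}. coeff A k * ?y ^ k)"
        by (subst sum.union_disjoint[symmetric]) (auto intro!: sum.cong)
      also have "(\<Sum>k\<in>{k\<in>{..e}. ?p dvd k}. coeff A k * ?y ^ k) = (\<Sum>k\<le>e div ?p. coeff A (?p * k) * ?y ^ (?p * k))"
        by (rule sum.reindex_bij_witness[of _ "\<lambda>k. ?p * k" "\<lambda>k. k div ?p"])
          (use p0 in \<open>auto simp: div_le_mono less_eq_div_iff_mult_less_eq mult.commute\<close>)
      also have "\<dots> = poly A2 (mp_var i ^ (?p * q))"
        by (simp add: A2_def poly_sum poly_monom power_mult[symmetric] ac_simps)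
      finally have eq: "poly A2 (mp_var i ^ (?p * q)) = poly A ?y - (\<Sum>k\<in>{k\<in>{..e}. \<not> ?p dvd k}. coeff A k * ?y ^ k)"
        by simp
      have "(\<Sum>k\<in>{k\<in>{..e}. \<not> ?p dvd k}. coeff A k * ?y ^ k) \<in> P"
      proof (rule idl_sum[OF I])
        fix k assume "k \<in> {k\<in>{..e}. \<not> ?p dvd k}"
        then have "coeff A k \<in> P" by (intro kP) (simp add: of_nat_eq_0_iff_char_dvd)
        then have "?y ^ k * coeff A k \<in> P" by (rule idlD(4)[OF I polys_power[OF y]])
        then show "coeff A k * ?y ^ k \<in> P" by (simp add: mult.commute)
      qed
      then show ?thesis unfolding eq using q(3) by (intro idl_diff[OF subring_polys I])
    qed
    moreover have "degree A2 * (?p * q) = d" using pe q(2) by (simp add: A2d e_def mult.assoc[symmetric])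
    ultimately have "?X A2" using A2R A2l A2d lA power_automorphism_mult[OF padm q(1)] by auto
    then have "e \<le> e div ?p" using Amin[of A2] by (simp add: A2d e_def)
    then show False using e0 p1 by (metis div_less_dividend leD)
  qed
qed

interpretation val: comm_ring_hom "mp_value a" for a :: "'k::comm_ring_1 vec"
  unfolding mp_value_ev[abs_def] by (rule comm_ring_hom_ev)

lemma val_const [simp]: "mp_value a (mp_const c) = c"
  by (simp add: mp_value_ev)

lemma val_var [simp]: "mp_value a (mp_var i) = a $ i"
  by (simp add: mp_value_ev)

lemma val_poly: "mp_value a (poly C x) = (\<Sum>k\<le>degree C. mp_value a (coeff C k) * mp_value a x ^ k)"
  by (simp add: poly_altdef val.hom_sum val.hom_mult val.hom_power)

text \<open>Where their leading coefficients do not vanish, the triangular equations imply all of P.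
  By induction on the number of variables, an element of P is pseudo-divided by A(X^q). The
  remainder is a relation of too small a degree, so its coefficients lie in P and involve fewer
  variables.\<close>

lemma triangular_zeros:
  fixes P :: "'k::field mpoly set"
  assumes P: "prime_idl M P"
    and fr: "\<And>i. i < M \<Longrightarrow> i \<notin> T \<Longrightarrow> free_coord P i"
    and alg: "\<And>i. i < M \<Longrightarrow> i \<in> T \<Longrightarrow> algebraic_coord P i (A i) (q i)"
    and c: "\<And>i. i < M \<Longrightarrow> i \<in> T \<Longrightarrow> mp_value c (poly (A i) (mp_var i ^ q i)) = 0"
      "\<And>i. i < M \<Longrightarrow> i \<in> T \<Longrightarrow> mp_value c (lead_coeff (A i)) \<noteq> 0"
    and p: "p \<in> P"
  shows "mp_value c p = 0"
proof -
  have I: "idl (polys M) P" using P by (simp add: prime_idl_def)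
  have "\<forall>p \<in> P \<inter> polys j. mp_value c p = 0" if "j \<le> M" for j
    using that
  proof (induction j)
    case 0
    show ?case
    proof
      fix p assume p: "p \<in> P \<inter> polys 0"
      then obtain a where a: "p = mp_const a" using polys_0E by blast
      have "a = 0"
      proof (rule ccontr)
        assume "a \<noteq> 0"
        have "mp_const (1 / a) * mp_const a \<in> P" using p a by (intro idlD(4)[OF I]) auto
        then show False using \<open>a \<noteq> 0\<close> P by (simp add: prime_idl_def flip: mpc.hom_mult)
      qed
      then show "mp_value c p = 0" by (simp add: a)
    qed
  next
    case (Suc j)
    then have j: "j < M" and IH: "\<And>p. p \<in> P \<Longrightarrow> p \<in> polys j \<Longrightarrow> mp_value c p = 0" by auto
    show ?case
    proof
      fix p assume p: "p \<in> P \<inter> polys (Suc j)"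
      then obtain C where C: "C \<in> poly_over (polys j)" "p = poly C (mp_var j)" using polys_Suc_poly by blast
      have vanish: "mp_value c (poly S (mp_var j)) = 0"
        if "S \<in> poly_over (polys j)" "\<And>k. coeff S k \<in> P" for S
        unfolding val_poly using that IH by (intro sum.neutral) (auto simp: poly_over_def)
      show "mp_value c p = 0"
      proof (cases "j \<in> T")
        case False
        then have "coeff C k \<in> P" for k using fr[OF j] C p by (auto simp: free_coord_def)
        then show ?thesis unfolding C(2) using C(1) by (intro vanish)
      next
        case True
        note al = alg[OF j True, unfolded algebraic_coord_def]
        let ?q = "q j" and ?A = "A j"
        have q0: "?q > 0" using al by (auto simp: power_automorphism_def)
        let ?B = "poly_expand ?q ?A"
        let ?d = "degree ?A * ?q"
        have BR: "?B \<in> poly_over (polys j)" using al by (intro poly_over_expand subring_polys) auto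
        have pos: "?d > 0" using al by blast
        from pseudo_division[OF subring_polys BR degree_poly_expand pos C(1)]
        obtain e Q S where eQS: "Q \<in> poly_over (polys j)" "S \<in> poly_over (polys j)" "degree S < ?d"
          "smult (coeff ?B ?d ^ e) C = ?B * Q + S" by blast
        have l: "coeff ?B ?d = lead_coeff ?A" by (rule coeff_poly_expand[OF q0])
        have lR: "lead_coeff ?A \<in> polys M" using al j by (auto simp: poly_over_def intro: polys_mono)
        have "poly (smult (coeff ?B ?d ^ e) C) (mp_var j) = poly (?B * Q + S) (mp_var j)" by (simp only: eQS(4))
        then have eq: "lead_coeff ?A ^ e * p = poly ?A (mp_var j ^ ?q) * poly Q (mp_var j) + poly S (mp_var j)"
          by (simp add: l C(2) poly_poly_expand)
        have "poly Q (mp_var j) * poly ?A (mp_var j ^ ?q) \<in> P"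
          using al j poly_over_polys_Suc[OF eQS(1)] by (intro idlD(4)[OF I]) (auto intro: polys_mono)
        moreover have "lead_coeff ?A ^ e * p \<in> P" using p lR by (intro idlD(4)[OF I] polys_power) auto
        ultimately have "lead_coeff ?A ^ e * p - poly Q (mp_var j) * poly ?A (mp_var j ^ ?q) \<in> P"
          by (intro idl_diff[OF subring_polys I])
        moreover have "lead_coeff ?A ^ e * p - poly Q (mp_var j) * poly ?A (mp_var j ^ ?q) = poly S (mp_var j)"
          unfolding eq by (simp add: mult.commute)
        ultimately have "poly S (mp_var j) \<in> P" by (simp only:)
        then have "\<And>k. coeff S k \<in> P" using al eQS by blast
        then have "mp_value c (poly S (mp_var j)) = 0" using eQS(2) by (intro vanish)
        moreover have "mp_value c (lead_coeff ?A ^ e * p) = mp_value c (poly ?A (mp_var j ^ ?q) * poly Q (mp_var j) + poly S (mp_var j))"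
          by (simp only: eq)
        ultimately have "mp_value c (lead_coeff ?A) ^ e * mp_value c p = 0"
          using c(1)[OF j True] by (simp add: val.hom_mult val.hom_add val.hom_power)
        then show ?thesis using c(2)[OF j True] by simp
      qed
    qed
  qed
  from this[of M] show ?thesis using p idlD(1)[OF I] by auto
qed

section \<open>Discrete, infinite and perfect fields\<close>

text \<open>A point is a finite intersection of preimages of 0 under translated coordinates.\<close>

lemma etale_open_point:
  fixes a :: "'k::field vec"
  assumes 0: "etale_open 1 {0\<^sub>v 1 :: 'k vec}" and a: "a \<in> carrier_vec m"
  shows "etale_open m {a}"
proof -
  have z: "vec 1 (\<lambda>_. y) = 0\<^sub>v 1 \<longleftrightarrow> y = (0 :: 'k)" for y
    by (auto simp: vec_eq_iff)
  have "etale_open m {x \<in> carrier_vec m. \<forall>i<k. x $ i = a $ i}" if "k \<le> m" for k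
    using that
  proof (induction k)
    case 0
    show ?case using etale_open_carrier[of m] by simp
  next
    case (Suc k)
    let ?V = "{x \<in> carrier_vec m. vec 1 (\<lambda>_. mp_value x (mp_var k - mp_const (a $ k))) \<in> {0\<^sub>v 1}}"
    have "etale_open m ?V" using Suc.prems by (intro etale_open_vimage 0) (auto intro: polys_diff)
    then have "etale_open m ({x \<in> carrier_vec m. \<forall>i<k. x $ i = a $ i} \<inter> ?V)"
      using Suc by (intro etale_open_Int) auto
    also have "{x \<in> carrier_vec m. \<forall>i<k. x $ i = a $ i} \<inter> ?V = {x \<in> carrier_vec m. \<forall>i<Suc k. x $ i = a $ i}"
      using z by (auto simp: val.hom_minus less_Suc_eq)
    finally show ?case .
  qed
  from this[of m] have "etale_open m {x \<in> carrier_vec m. \<forall>i<m. x $ i = a $ i}" by simp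
  also have "{x \<in> carrier_vec m. \<forall>i<m. x $ i = a $ i} = {a}" using a by (auto intro!: eq_vecI)
  finally show ?thesis .
qed

lemma etale_open_discrete:
  fixes S :: "'k::field vec set"
  assumes "etale_open 1 {0\<^sub>v 1 :: 'k vec}" "S \<subseteq> carrier_vec m"
  shows "etale_open m S"
proof -
  have "S = (\<Union>a\<in>S. {a})" by blast
  moreover have "etale_open m (\<Union>a\<in>S. {a})"
    by (rule etale_open_UN, rule etale_open_point[OF assms(1)]) (use assms(2) in auto)
  ultimately show ?thesis by simp
qed

text \<open>The product of all x - a with a \<noteq> 0 is nonzero exactly at x = 0.\<close>

lemma finite_field_discrete:
  assumes "finite (UNIV :: 'k::field set)"
  shows "etale_open 1 {0\<^sub>v 1 :: 'k vec}"
proof -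
  define q :: "'k mpoly" where "q = (\<Prod>a\<in>UNIV - {0}. mp_var 0 - mp_const a)"
  have "q \<in> polys 1" unfolding q_def by (intro polys_prod polys_diff) auto
  then have "etale_open 1 {x \<in> carrier_vec 1. mp_value x q \<noteq> 0}" by (rule etale_open_nonzero)
  also have "{x \<in> carrier_vec 1. mp_value x q \<noteq> 0} = {0\<^sub>v 1}"
  proof -
    have iff: "mp_value x q \<noteq> 0 \<longleftrightarrow> x $ 0 = 0" for x
      using assms by (auto simp: q_def val.hom_prod val.hom_minus)
    have "x = 0\<^sub>v 1" if "x \<in> carrier_vec 1" "x $ 0 = 0" for x :: "'k vec"
      using that by (intro eq_vecI) auto
    then show ?thesis unfolding iff by (intro equalityI subsetI) auto
  qed
  finally show ?thesis .
qed

section \<open>Nonvanishing loci over an infinite field\<close>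

definition restrict_line :: "'k::field vec \<Rightarrow> 'k vec \<Rightarrow> 'k mpoly \<Rightarrow> 'k poly" where
  "restrict_line a b = mp_extend (\<lambda>c. [:c:]) (\<lambda>i. [:a $ i, b $ i - a $ i:])"

lemma comm_ring_hom_restrict_line: "comm_ring_hom (restrict_line a b)"
  unfolding restrict_line_def by (rule comm_ring_hom_mp_extend, rule comm_ring_homI) auto

lemma poly_restrict_line:
  assumes "p \<in> polys m"
  shows "poly (restrict_line a b p) t = mp_value (vec m (\<lambda>i. a $ i + t * (b $ i - a $ i))) p"
proof -
  have c: "comm_ring_hom (\<lambda>c :: 'a. [:c:])" by (rule comm_ring_homI) auto
  have p: "comm_ring_hom (\<lambda>q. poly q t)" by (rule comm_ring_homI) auto
  show ?thesis
    by (rule polys_hom_eq[OF assms comm_ring_hom_comp[OF p comm_ring_hom_restrict_line] val.comm_ring_hom_axioms])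
      (auto simp: restrict_line_def mp_extend_const[OF c] mp_extend_var[OF c])
qed

lemma infinite_poly_nonroot:
  assumes "infinite (UNIV :: 'k::field set)" "(F :: 'k poly) \<noteq> 0"
  shows "\<exists>t. poly F t \<noteq> 0"
proof (rule ccontr)
  assume "\<nexists>t. poly F t \<noteq> 0"
  then have "{t. poly F t = 0} = UNIV" by blast
  then show False using poly_roots_finite[OF assms(2)] assms(1) by simp
qed

text \<open>On the line through a and b both factors restrict to nonzero univariate polynomials.
  Their product has finitely many roots, which do not exhaust an infinite field. This is the
  irreducibility of K^m.\<close>

lemma nonzero_mult:
  fixes p q :: "'k::field mpoly"
  assumes inf: "infinite (UNIV :: 'k set)" and pq: "p \<in> polys m" "q \<in> polys m"
    and a: "a \<in> carrier_vec m" "mp_value a p \<noteq> 0" and b: "b \<in> carrier_vec m" "mp_value b q \<noteq> 0"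
  shows "\<exists>x \<in> carrier_vec m. mp_value x (p * q) \<noteq> 0"
proof -
  have "vec m (\<lambda>i. a $ i + 0 * (b $ i - a $ i)) = a" "vec m (\<lambda>i. a $ i + 1 * (b $ i - a $ i)) = b"
    using a b by (auto intro!: eq_vecI)
  then have "poly (restrict_line a b p) 0 \<noteq> 0" "poly (restrict_line a b q) 1 \<noteq> 0"
    using a b by (simp_all only: poly_restrict_line[OF pq(1)] poly_restrict_line[OF pq(2)] not_False_eq_True)
  then have "restrict_line a b p * restrict_line a b q \<noteq> 0" by auto
  then obtain t where "poly (restrict_line a b p * restrict_line a b q) t \<noteq> 0"
    using infinite_poly_nonroot[OF inf] by blast
  then show ?thesis
    by (intro bexI[of _ "vec m (\<lambda>i. a $ i + t * (b $ i - a $ i))"])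
      (auto simp: poly_restrict_line[OF pq(1)] poly_restrict_line[OF pq(2)] val.hom_mult)
qed

section \<open>The p-th powers as a definable set\<close>

primrec power_term :: "'k ring_term \<Rightarrow> nat \<Rightarrow> 'k::field ring_term" where
  "power_term t 0 = TParam 1"
| "power_term t (Suc n) = TMult t (power_term t n)"

lemma term_value_power: "term_value e (power_term t n) = term_value e t ^ n"
  by (induction n) auto

lemma term_vars_power: "term_vars (power_term t n) \<subseteq> term_vars t"
  by (induction n) auto

text \<open>An infinite ez set contains a nonempty etale open one. Inside \<open>K\<^sup>p\<close>, which is an additive group,
  a translate of the latter is an etale open neighbourhood \<open>V\<close> of \<open>0\<close>, and \<open>V \<inter> cV = {0}\<close> if \<open>c\<close> is not
  a \<open>p\<close>-th power.\<close>

lemma perfect_or_discrete: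
  assumes ez: "ez_field TYPE('k::field)" and nd: "\<not> etale_open 1 {0\<^sub>v 1 :: 'k vec}"
  shows "perfect TYPE('k)"
  unfolding perfect_def
proof
  let ?p = "CHAR('k)"
  assume p0: "?p > 0"
  have inf: "infinite (UNIV :: 'k set)" using nd finite_field_discrete by blast
  have prime: "prime ?p" using prime_CHAR_semidom[OF p0] .
  have hom: "comm_ring_hom (\<lambda>x :: 'k. x ^ ?p)"
    by (rule comm_ring_homI) (auto simp: power_mult_distrib freshmans_dream[OF prime refl])
  interpret F: comm_ring_hom "\<lambda>x :: 'k. x ^ ?p" by (rule hom)
  have inj: "inj (\<lambda>x :: 'k. x ^ ?p)"
  proof (rule injI)
    fix x y :: 'k assume "x ^ ?p = y ^ ?p"
    then have "(x - y) ^ ?p = 0" by (simp add: F.hom_minus)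
    then show "x = y" by simp
  qed
  have "surj (\<lambda>x :: 'k. x ^ ?p)"
  proof (rule ccontr)
    assume "\<not> surj (\<lambda>x :: 'k. x ^ ?p)"
    then obtain c :: 'k where c: "\<And>x. c \<noteq> x ^ ?p" by (auto simp: surj_def)
    have c0: "c \<noteq> 0" using c[of 0] p0 by (auto simp: power_0_left)
    define S :: "'k vec set" where "S = {a \<in> carrier_vec 1. \<exists>x. a $ 0 = x ^ ?p}"
    have "definable 1 S"
      unfolding definable_def
    proof (intro exI conjI)
      let ?A = "FEx 1 (FEq (TVar 0) (power_term (TVar 1) ?p)) :: 'k ring_formula"
      show "free_vars ?A \<subseteq> {..<1}" using term_vars_power[of "TVar 1 :: 'k ring_term" ?p] by auto
      show "S = {a \<in> carrier_vec 1. sat (($) a) ?A}" by (auto simp: S_def term_value_power)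
    qed
    then have "ez_set 1 S" using ez by (auto simp: ez_field_def)
    then obtain \<D> where \<D>: "finite \<D>" "S = \<Union>\<D>"
      "\<And>D. D \<in> \<D> \<Longrightarrow> \<exists>I. affine_variety (1, I) \<and> openin (etale_topology (1, I)) D"
      unfolding ez_set_def by blast
    have "infinite S"
    proof
      assume "finite S"
      moreover have "inj (\<lambda>x :: 'k. vec 1 (\<lambda>_. x ^ ?p))"
      proof (rule injI)
        fix x y :: 'k assume "vec 1 (\<lambda>_. x ^ ?p) = vec 1 (\<lambda>_. y ^ ?p)"
        then have "x ^ ?p = y ^ ?p" by (auto simp: vec_eq_iff)
        then show "x = y" using inj by (auto dest: injD)
      qed
      moreover have "range (\<lambda>x :: 'k. vec 1 (\<lambda>_. x ^ ?p)) \<subseteq> S" by (auto simp: S_def)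
      ultimately show False using inf by (meson finite_imageD finite_subset)
    qed
    then obtain D where D: "D \<in> \<D>" "infinite D" using \<D> by (metis finite_Union)
    obtain I where I: "affine_variety (1, I)" "openin (etale_topology (1, I)) D" using \<D>(3)[OF D(1)] by blast
    have idl: "idl (polys 1) I" using I(1) unfolding affine_variety_iff by blast
    obtain U where U: "etale_open 1 U" "D = U \<inter> affine_points (1, I)" using openin_etale_topology[OF idl I(2)] by blast
    \<comment> \<open>The closed set contains infinitely many points of the line, so its equations
      vanish identically.\<close>
    have "affine_points (1, I) = carrier_vec 1"
    proof -
      have "mp_value x p = 0" if p: "p \<in> I" and x: "x \<in> carrier_vec 1" for p x
      proof -
        have pp: "p \<in> polys 1" using p idlD(1)[OF idl] by blast
        let ?f = "restrict_line (0\<^sub>v 1) (vec 1 (\<lambda>_. 1)) p"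
        have line: "poly ?f (y $ 0) = mp_value y p" if "y \<in> carrier_vec 1" for y
        proof -
          have "vec 1 (\<lambda>i. 0\<^sub>v 1 $ i + y $ 0 * (vec 1 (\<lambda>_. 1) $ i - 0\<^sub>v 1 $ i)) = y"
            using that by (intro eq_vecI) auto
          then show ?thesis by (simp only: poly_restrict_line[OF pp])
        qed
        have "?f = 0"
        proof (rule ccontr)
          assume "?f \<noteq> 0"
          then have "finite {t. poly ?f t = 0}" by (rule poly_roots_finite)
          moreover have "(\<lambda>y. y $ 0) ` D \<subseteq> {t. poly ?f t = 0}" using U(2) p line by auto
          moreover have "inj_on (\<lambda>y. y $ 0) D"
          proof (rule inj_onI)
            fix y z assume "y \<in> D" "z \<in> D" "y $ 0 = z $ 0"
            then show "y = z" using U(2) by (intro eq_vecI) auto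
          qed
          ultimately show False using D(2) by (meson finite_imageD finite_subset)
        qed
        then show ?thesis using line[OF x] by simp
      qed
      then show ?thesis by auto
    qed
    then have DU: "etale_open 1 D" using U etale_openD[OF U(1)] by (simp add: Int_absorb2)
    obtain d where d: "d \<in> D" using D(2) by fastforce
    have DS: "D \<subseteq> S" using D(1) \<D>(2) by blast
    then obtain e where e: "d \<in> carrier_vec 1" "d $ 0 = e ^ ?p" using d by (auto simp: S_def)
    define V where "V = {x \<in> carrier_vec 1. vec 1 (\<lambda>_. mp_value x (mp_var 0 + mp_const (d $ 0))) \<in> D}"
    have V: "etale_open 1 V" unfolding V_def by (intro etale_open_vimage DU polys_add) auto
    \<comment> \<open>This is c V: the condition says that x / c lies in V.\<close>
    define W where "W = {x \<in> carrier_vec 1. vec 1 (\<lambda>_. mp_value x (mp_const (1 / c) * mp_var 0)) \<in> V}"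
    have W: "etale_open 1 W" unfolding W_def by (intro etale_open_vimage V polys_mult) auto
    \<comment> \<open>The points of D, d among them, are p-th powers, and differences of p-th powers
      are again such because x^p is additive.\<close>
    have V_power: "\<exists>y. x $ 0 = y ^ ?p" if "x \<in> V" for x
    proof -
      have "vec 1 (\<lambda>_. x $ 0 + d $ 0) \<in> S" using that DS by (auto simp: V_def val.hom_add)
      then obtain z where "x $ 0 + d $ 0 = z ^ ?p" by (auto simp: S_def)
      then have "x $ 0 = (z - e) ^ ?p" using e by (simp add: F.hom_minus eq_diff_eq)
      then show ?thesis ..
    qed
    have "V \<inter> W = {0\<^sub>v 1}"
    proof safe
      fix x assume x: "x \<in> V" "x \<in> W"
      then have xc: "x \<in> carrier_vec 1" by (simp add: V_def)
      have "vec 1 (\<lambda>_. 1 / c * x $ 0) \<in> V" using x(2) by (simp add: W_def val.hom_mult)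
      from V_power[OF this] obtain z where z: "1 / c * x $ 0 = z ^ ?p" by auto
      obtain y where y: "x $ 0 = y ^ ?p" using V_power[OF x(1)] by blast
      have "x $ 0 = 0"
      proof (rule ccontr)
        assume "x $ 0 \<noteq> 0"
        then have "c = (y / z) ^ ?p" using c0 unfolding power_divide y[symmetric] z[symmetric] by simp
        then show False using c by blast
      qed
      then show "x = 0\<^sub>v 1" using xc by (intro eq_vecI) auto
    next
      have "vec 1 (\<lambda>_. d $ 0) = d" using e by (intro eq_vecI) auto
      then show "0\<^sub>v 1 \<in> V" using d by (simp add: V_def val.hom_add)
      moreover have "vec 1 (\<lambda>_. 0) = (0\<^sub>v 1 :: 'k vec)" by (intro eq_vecI) auto
      ultimately show "0\<^sub>v 1 \<in> W" by (simp add: W_def val.hom_mult)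
    qed
    then show False using etale_open_Int[OF V W] nd by simp
  qed
  then show "power_automorphism TYPE('k) ?p" using p0 hom by (simp add: power_automorphism_def)
qed

section \<open>Projections of etale open subsets of varieties\<close>

lemma deriv_poly:
  "C \<in> poly_over (polys j) \<Longrightarrow> mp_deriv j (poly C (mp_var j)) = poly (pderiv C) (mp_var j)"
proof (induction C)
  case (pCons a C)
  have "a \<in> polys j" using pCons.prems by (auto simp: poly_over_def dest: spec[of _ 0])
  then have "mp_deriv j a = 0" by (rule deriv_polys_0) simp
  moreover have "C \<in> poly_over (polys j)"
    unfolding poly_over_def
  proof safe
    fix i show "coeff C i \<in> polys j" using pCons.prems unfolding poly_over_def by (auto dest: spec[of _ "Suc i"])
  qed
  ultimately show ?case
    using pCons.IH by (simp add: deriv_add deriv_mult deriv_var pderiv_pCons)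
qed simp

lemma val_append_poly:
  assumes "C \<in> poly_over (polys j)" "a \<in> carrier_vec j"
  shows "mp_value (a @\<^sub>v b) (poly C x) = (\<Sum>k\<le>degree C. mp_value a (coeff C k) * mp_value (a @\<^sub>v b) x ^ k)"
proof -
  have "mp_value (a @\<^sub>v b) (coeff C k) = mp_value a (coeff C k)" for k
    using assms by (intro mp_value_append[of _ j]) (auto simp: poly_over_def)
  then show ?thesis unfolding val_poly by simp
qed

text \<open>The projection is the union over w of the slices of U, and each slice is a preimage
  under the polynomial map a \<mapsto> (a, w).\<close>

lemma etale_open_project_free:
  fixes U :: "'k::field vec set"
  assumes U: "etale_open (Suc j) U"
  shows "etale_open j {a \<in> carrier_vec j. \<exists>w. a @\<^sub>v vec 1 (\<lambda>_. w) \<in> U}"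
proof -
  let ?V = "\<lambda>w. {a \<in> carrier_vec j. vec (Suc j) (\<lambda>i. mp_value a (if i < j then mp_var i else mp_const w)) \<in> U}"
  have "etale_open j (\<Union>w. ?V w)" by (intro etale_open_UN etale_open_vimage U) auto
  moreover have eq: "vec (Suc j) (\<lambda>i. mp_value a (if i < j then mp_var i else mp_const w)) = a @\<^sub>v vec 1 (\<lambda>_. w)"
    if "a \<in> carrier_vec j" for a w
    using that by (intro eq_vecI) (auto simp: index_append_vec)
  have "?V w = {a \<in> carrier_vec j. a @\<^sub>v vec 1 (\<lambda>_. w) \<in> U}" for w
    by (intro Collect_cong conj_cong refl) (simp only: eq)
  then have "(\<Union>w. ?V w) = (\<Union>w. {a \<in> carrier_vec j. a @\<^sub>v vec 1 (\<lambda>_. w) \<in> U})" by (simp only:)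
  also have "\<dots> = {a \<in> carrier_vec j. \<exists>w. a @\<^sub>v vec 1 (\<lambda>_. w) \<in> U}" by blast
  ultimately show ?thesis by (simp only:)
qed

text \<open>In the unknown t = w^q the equation A(t) = 0 is separable at the points in question and
  defines an etale system. What remains is to express (a, w) \<in> U as an etale open condition on
  (a, t).\<close>

lemma etale_open_project_algebraic:
  fixes U :: "'k::field vec set"
  assumes A: "A \<in> poly_over (polys j)" and q: "power_automorphism TYPE('k) q" and U: "etale_open (Suc j) U"
  shows "etale_open j {a \<in> carrier_vec j. \<exists>w. a @\<^sub>v vec 1 (\<lambda>_. w) \<in> U \<and>
    mp_value (a @\<^sub>v vec 1 (\<lambda>_. w)) (poly A (mp_var j ^ q)) = 0 \<and>
    mp_value (a @\<^sub>v vec 1 (\<lambda>_. w)) (poly (pderiv A) (mp_var j ^ q)) \<noteq> 0}" (is "etale_open j ?W")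
proof -
  let ?s = "\<lambda>x :: 'k. x ^ q"
  have s: "comm_ring_hom ?s" "surj ?s" using q by (auto simp: power_automorphism_def)
  interpret s: comm_ring_hom ?s by (rule s(1))
  have s_inj: "x = y" if "x ^ q = y ^ q" for x y :: 'k
  proof -
    have "(x - y) ^ q = 0" using that by (simp add: s.hom_minus)
    then show ?thesis by simp
  qed
  have sU: "etale_open (Suc j) (map_vec ?s ` U)" by (rule etale_open_hom[OF s U])
  \<comment> \<open>The points (a, w^q) with (a, w) \<in> U. Raising the coordinates of a to the
    power q as well, the condition reads (a^q, w^q) \<in> s(U), and s(U) is etale open.\<close>
  define V where "V = {c \<in> carrier_vec (Suc j). vec (Suc j) (\<lambda>i. mp_value c (if i < j then mp_var i ^ q else mp_var i)) \<in> map_vec ?s ` U}"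
  have V: "etale_open (Suc j) V" unfolding V_def by (intro etale_open_vimage sU) (auto intro!: polys_power)
  define g :: "'k mpoly vec" where "g = vec 1 (\<lambda>_. poly A (mp_var j))"
  have dim: "dim_vec g = 1" by (simp add: g_def)
  have g: "system j g" using poly_over_polys_Suc[OF A] by (simp add: system_def g_def)
  have det: "det (jacobian j g) = poly (pderiv A) (mp_var j)"
    by (subst det_single) (auto simp: jacobian_def g_def deriv_poly[OF A])
  have A': "pderiv A \<in> poly_over (polys j)" by (rule poly_over_pderiv[OF subring_polys A])
  have "etale_open (j + dim_vec g) V" using V by (simp add: dim)
  from etale_open_image[OF g this]
  have "etale_open j {a \<in> carrier_vec j. \<exists>b \<in> carrier_vec 1. etale_zero j g (a @\<^sub>v b) \<and> a @\<^sub>v b \<in> V}" by (simp add: dim)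
  also have "{a \<in> carrier_vec j. \<exists>b \<in> carrier_vec 1. etale_zero j g (a @\<^sub>v b) \<and> a @\<^sub>v b \<in> V} = ?W"
  proof -
    have iff: "etale_zero j g (a @\<^sub>v vec 1 (\<lambda>_. w ^ q)) \<and> a @\<^sub>v vec 1 (\<lambda>_. w ^ q) \<in> V \<longleftrightarrow>
      a @\<^sub>v vec 1 (\<lambda>_. w) \<in> U \<and> mp_value (a @\<^sub>v vec 1 (\<lambda>_. w)) (poly A (mp_var j ^ q)) = 0 \<and>
      mp_value (a @\<^sub>v vec 1 (\<lambda>_. w)) (poly (pderiv A) (mp_var j ^ q)) \<noteq> 0"
      if a: "a \<in> carrier_vec j" for a w
    proof -
      have last: "(a @\<^sub>v vec 1 (\<lambda>_. y)) $ j = y" for y using a by (simp add: index_append_vec)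
      have e: "mp_value (a @\<^sub>v vec 1 (\<lambda>_. w ^ q)) (poly C (mp_var j)) = mp_value (a @\<^sub>v vec 1 (\<lambda>_. w)) (poly C (mp_var j ^ q))"
        if "C \<in> poly_over (polys j)" for C
        unfolding val_append_poly[OF that a] val.hom_power val_var last ..
      have z: "etale_zero j g (a @\<^sub>v vec 1 (\<lambda>_. w ^ q)) \<longleftrightarrow>
        mp_value (a @\<^sub>v vec 1 (\<lambda>_. w)) (poly A (mp_var j ^ q)) = 0 \<and>
        mp_value (a @\<^sub>v vec 1 (\<lambda>_. w)) (poly (pderiv A) (mp_var j ^ q)) \<noteq> 0"
        unfolding etale_zero_def det e[OF A'] e[OF A, symmetric] by (auto simp: g_def)
      have eq: "vec (Suc j) (\<lambda>i. mp_value (a @\<^sub>v vec 1 (\<lambda>_. w ^ q)) (if i < j then mp_var i ^ q else mp_var i))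
        = map_vec ?s (a @\<^sub>v vec 1 (\<lambda>_. w))"
        using a by (intro eq_vecI) (auto simp: index_append_vec val.hom_power)
      have img: "map_vec ?s u \<in> map_vec ?s ` U \<longleftrightarrow> u \<in> U" for u
      proof
        assume "map_vec ?s u \<in> map_vec ?s ` U"
        then obtain v where v: "v \<in> U" "map_vec ?s u = map_vec ?s v" by blast
        have d: "dim_vec u = dim_vec v" using arg_cong[OF v(2), of dim_vec] by simp
        have "u = v"
        proof (rule eq_vecI)
          fix i assume i: "i < dim_vec v"
          have "map_vec ?s u $ i = map_vec ?s v $ i" by (simp only: v(2))
          then show "u $ i = v $ i" using i d by (auto intro: s_inj)
        qed (rule d)
        then show "u \<in> U" using v by simp
      qed blast
      have "a @\<^sub>v vec 1 (\<lambda>_. w ^ q) \<in> carrier_vec (Suc j)"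
        using append_carrier_vec[OF a, of "vec 1 (\<lambda>_. w ^ q)" 1] by simp
      then have "a @\<^sub>v vec 1 (\<lambda>_. w ^ q) \<in> V \<longleftrightarrow> a @\<^sub>v vec 1 (\<lambda>_. w) \<in> U"
        by (simp only: V_def mem_Collect_eq eq img simp_thms)
      then show ?thesis using z by blast
    qed
    have b: "\<exists>w. b = vec 1 (\<lambda>_. w ^ q)" if "b \<in> carrier_vec 1" for b :: "'k vec"
    proof -
      obtain w where "b $ 0 = w ^ q" using s(2) by (metis surjD)
      then have "b = vec 1 (\<lambda>_. w ^ q)" using that by (intro eq_vecI) auto
      then show ?thesis ..
    qed
    show ?thesis
    proof (rule Collect_cong, rule conj_cong[OF refl])
      fix a :: "'k vec" assume a: "a \<in> carrier_vec j"
      have "(\<exists>b \<in> carrier_vec 1. etale_zero j g (a @\<^sub>v b) \<and> a @\<^sub>v b \<in> V) \<longleftrightarrow>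
        (\<exists>w. etale_zero j g (a @\<^sub>v vec 1 (\<lambda>_. w ^ q)) \<and> a @\<^sub>v vec 1 (\<lambda>_. w ^ q) \<in> V)"
        using b by (metis vec_carrier)
      then show "(\<exists>b \<in> carrier_vec 1. etale_zero j g (a @\<^sub>v b) \<and> a @\<^sub>v b \<in> V) \<longleftrightarrow>
        (\<exists>w. a @\<^sub>v vec 1 (\<lambda>_. w) \<in> U \<and> mp_value (a @\<^sub>v vec 1 (\<lambda>_. w)) (poly A (mp_var j ^ q)) = 0 \<and>
        mp_value (a @\<^sub>v vec 1 (\<lambda>_. w)) (poly (pderiv A) (mp_var j ^ q)) \<noteq> 0)"
        unfolding iff[OF a] .
    qed
  qed
  finally show ?thesis .
qed

abbreviation take_vec :: "nat \<Rightarrow> 'k vec \<Rightarrow> 'k vec" where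
  "take_vec m c \<equiv> vec m (\<lambda>i. c $ i)"

text \<open>Coordinates are eliminated from the last one down to index m, a free one by slicing and
  an algebraic one by its separable equation. In h the leading coefficients ensure that the
  triangular equations describe P, and the derivatives ensure that each elimination is
  etale.\<close>

lemma open_projection:
  fixes P :: "'k::field mpoly set"
  assumes perf: "perfect TYPE('k)" and P: "prime_idl M P" and mM: "m \<le> M"
    and fr: "\<And>i. i < m \<Longrightarrow> free_coord P i"
  shows "\<exists>h \<in> polys M. h \<notin> P \<and> (\<forall>U. etale_open M U \<longrightarrow>
    etale_open m (take_vec m ` {c \<in> U. c \<in> affine_points (M, P) \<and> mp_value c h \<noteq> 0}))"
proof -
  have pr: "\<And>a b. a \<in> polys M \<Longrightarrow> b \<in> polys M \<Longrightarrow> a * b \<in> P \<Longrightarrow> a \<in> P \<or> b \<in> P"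
    and one: "1 \<notin> P" using P by (auto simp: prime_idl_def)
  define T where "T = {i. i < M \<and> \<not> free_coord P i}"
  have T: "finite T" "\<And>i. i \<in> T \<Longrightarrow> m \<le> i \<and> i < M" using fr by (auto simp: T_def intro: leI)
  have "\<forall>i\<in>T. \<exists>A q. algebraic_coord P i A q" using free_or_algebraic[OF perf P] by (auto simp: T_def)
  then obtain A q where Aq: "\<And>i. i \<in> T \<Longrightarrow> algebraic_coord P i (A i) (q i)" by metis
  define b where "b = (\<lambda>i. poly (A i) (mp_var i ^ q i))"
  define d where "d = (\<lambda>i. poly (pderiv (A i)) (mp_var i ^ q i))"
  define l where "l = (\<lambda>i. lead_coeff (A i))"
  have AR: "A i \<in> poly_over (polys i)" "power_automorphism TYPE('k) (q i)" "b i \<in> P" "l i \<notin> P" "d i \<notin> P" if "i \<in> T" for i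
    using Aq[OF that] by (auto simp: algebraic_coord_def b_def d_def l_def)
  have poly_pow: "poly C (mp_var i ^ n) \<in> polys (Suc i)" if "C \<in> poly_over (polys i)" for C i n
    unfolding poly_poly_expand[symmetric] by (intro poly_over_polys_Suc poly_over_expand subring_polys that)
  have bR: "b i \<in> polys (Suc i)" and dR: "d i \<in> polys (Suc i)" if "i \<in> T" for i
    unfolding b_def d_def using AR(1)[OF that] by (intro poly_pow poly_over_pderiv subring_polys; simp)+
  have lM: "l i \<in> polys M" "d i \<in> polys M" if "i \<in> T" for i
    using AR(1)[OF that] T(2)[OF that] dR[OF that] by (auto simp: l_def poly_over_def intro: polys_mono)
  define h where "h = (\<Prod>i\<in>T. l i * d i)"
  have hM: "h \<in> polys M" unfolding h_def using lM by (intro polys_prod polys_mult)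
  have "h \<notin> P" unfolding h_def using T(1) lM AR(4,5)
  proof (induction T)
    case (insert i T)
    have "(\<Prod>i\<in>T. l i * d i) \<in> polys M" using insert by (intro polys_prod polys_mult) auto
    moreover have "l i * d i \<in> polys M" using insert by (intro polys_mult) auto
    moreover have "l i * d i \<notin> P" using pr[of "l i" "d i"] insert by auto
    moreover have "(\<Prod>i\<in>T. l i * d i) \<notin> P" using insert by auto
    ultimately show ?case using pr insert(1,2) by auto
  qed (use one in simp)
  have hv: "mp_value c (l i) \<noteq> 0" "mp_value c (d i) \<noteq> 0" if "mp_value c h \<noteq> 0" "i \<in> T" for c i
    using that T(1) by (auto simp: h_def val.hom_prod val.hom_mult)
  have "etale_open m (take_vec m ` {c \<in> U. c \<in> affine_points (M, P) \<and> mp_value c h \<noteq> 0})" if U: "etale_open M U" for U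
  proof -
    have UM: "U \<subseteq> carrier_vec M" by (rule etale_openD[OF U])
    \<comment> \<open>The equation b i is imposed only for i \<ge> j. Thus E M carries no equation
      and is open, and each step down from Suc j to j adds at most the equation that serves to
      eliminate coordinate j.\<close>
    define E where "E = (\<lambda>j. take_vec j ` {c \<in> U. mp_value c h \<noteq> 0 \<and> (\<forall>i\<in>T. j \<le> i \<longrightarrow> mp_value c (b i) = 0)})"
    have "etale_open m (E m)"
      using mM
    proof (induction rule: inc_induct)
      case base
      have "take_vec M c = c" if "c \<in> U" for c using that UM by (intro eq_vecI) auto
      then have "E M = U \<inter> {c \<in> carrier_vec M. mp_value c h \<noteq> 0}"
        using UM T(2) unfolding E_def by (force simp: image_iff)
      then show ?case using etale_open_Int[OF U etale_open_nonzero[OF hM]] by simp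
    next
      case (step j)
      have take: "take_vec (Suc j) c = take_vec j c @\<^sub>v vec 1 (\<lambda>_. c $ j)" for c :: "'k vec"
        by (rule eq_vecI) (auto simp: index_append_vec less_Suc_eq)
      have val: "mp_value c p = mp_value (take_vec (Suc j) c) p" if "p \<in> polys (Suc j)" for c :: "'k vec" and p
        using that by (rule mp_value_cong) simp
      have split: "a = take_vec j c \<and> w = c $ j" if "a @\<^sub>v vec 1 (\<lambda>_. w) = take_vec (Suc j) c" "a \<in> carrier_vec j" for a w and c :: "'k vec"
      proof -
        have eq: "(a @\<^sub>v vec 1 (\<lambda>_. w)) $ i = take_vec (Suc j) c $ i" for i by (simp only: that(1))
        have "a $ i = c $ i" if "i < j" for i using eq[of i] that \<open>a \<in> carrier_vec j\<close> by (simp add: index_append_vec)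
        moreover have "w = c $ j" using eq[of j] \<open>a \<in> carrier_vec j\<close> by (simp add: index_append_vec)
        ultimately show ?thesis using \<open>a \<in> carrier_vec j\<close> by (auto intro!: eq_vecI)
      qed
      show ?case
      proof (cases "j \<in> T")
        case True
        let ?W = "{a \<in> carrier_vec j. \<exists>w. a @\<^sub>v vec 1 (\<lambda>_. w) \<in> E (Suc j) \<and>
          mp_value (a @\<^sub>v vec 1 (\<lambda>_. w)) (b j) = 0 \<and> mp_value (a @\<^sub>v vec 1 (\<lambda>_. w)) (d j) \<noteq> 0}"
        have "E j = ?W"
        proof (rule antisym; rule subsetI)
          fix a assume "a \<in> E j"
          then obtain c where c: "a = take_vec j c" "c \<in> U" "mp_value c h \<noteq> 0" "\<And>i. i \<in> T \<Longrightarrow> j \<le> i \<Longrightarrow> mp_value c (b i) = 0"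
            by (auto simp: E_def)
          have "a @\<^sub>v vec 1 (\<lambda>_. c $ j) \<in> E (Suc j)"
            unfolding E_def c(1) take[symmetric] using c by auto
          moreover have "mp_value (a @\<^sub>v vec 1 (\<lambda>_. c $ j)) (b j) = 0" "mp_value (a @\<^sub>v vec 1 (\<lambda>_. c $ j)) (d j) \<noteq> 0"
            unfolding c(1) take[symmetric] using val[OF bR[OF True], of c] val[OF dR[OF True], of c] c(4)[OF True] hv(2)[OF c(3) True]
            by simp_all
          ultimately show "a \<in> ?W" using c(1) by auto
        next
          fix a assume "a \<in> ?W"
          then obtain w where w: "a \<in> carrier_vec j" "a @\<^sub>v vec 1 (\<lambda>_. w) \<in> E (Suc j)" "mp_value (a @\<^sub>v vec 1 (\<lambda>_. w)) (b j) = 0"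
            by blast
          then obtain c where c: "a @\<^sub>v vec 1 (\<lambda>_. w) = take_vec (Suc j) c" "c \<in> U" "mp_value c h \<noteq> 0"
            "\<And>i. i \<in> T \<Longrightarrow> Suc j \<le> i \<Longrightarrow> mp_value c (b i) = 0" by (auto simp: E_def)
          have "mp_value c (b j) = 0" using w(3) unfolding c(1) val[OF bR[OF True], of c, symmetric] .
          then have "\<forall>i\<in>T. j \<le> i \<longrightarrow> mp_value c (b i) = 0" using c(4) by (metis le_eq_less_or_eq Suc_leI)
          then show "a \<in> E j" using split[OF c(1) w(1)] c unfolding E_def by blast
        qed
        then show ?thesis
          using etale_open_project_algebraic[OF AR(1,2)[OF True] step.IH] by (simp add: b_def d_def)
      next
        case False
        let ?W = "{a \<in> carrier_vec j. \<exists>w. a @\<^sub>v vec 1 (\<lambda>_. w) \<in> E (Suc j)}"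
        have "E j = ?W"
        proof (rule antisym; rule subsetI)
          fix a assume "a \<in> E j"
          then obtain c where c: "a = take_vec j c" "c \<in> U" "mp_value c h \<noteq> 0" "\<And>i. i \<in> T \<Longrightarrow> j \<le> i \<Longrightarrow> mp_value c (b i) = 0"
            by (auto simp: E_def)
          have "a @\<^sub>v vec 1 (\<lambda>_. c $ j) \<in> E (Suc j)"
            unfolding E_def c(1) take[symmetric] using c by auto
          then show "a \<in> ?W" using c(1) by auto
        next
          fix a assume "a \<in> ?W"
          then obtain w where w: "a \<in> carrier_vec j" "a @\<^sub>v vec 1 (\<lambda>_. w) \<in> E (Suc j)" by blast
          then obtain c where c: "a @\<^sub>v vec 1 (\<lambda>_. w) = take_vec (Suc j) c" "c \<in> U" "mp_value c h \<noteq> 0"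
            "\<And>i. i \<in> T \<Longrightarrow> Suc j \<le> i \<Longrightarrow> mp_value c (b i) = 0" by (auto simp: E_def)
          then have "\<forall>i\<in>T. j \<le> i \<longrightarrow> mp_value c (b i) = 0" using False by (metis le_eq_less_or_eq Suc_leI)
          then show "a \<in> E j" using split[OF c(1) w(1)] c unfolding E_def by blast
        qed
        then show ?thesis using etale_open_project_free[OF step.IH] by simp
      qed
    qed
    \<comment> \<open>Off the zeros of h the triangular equations have exactly the zeros of P as
      solutions.\<close>
    moreover have "{c \<in> U. mp_value c h \<noteq> 0 \<and> (\<forall>i\<in>T. m \<le> i \<longrightarrow> mp_value c (b i) = 0)} =
      {c \<in> U. c \<in> affine_points (M, P) \<and> mp_value c h \<noteq> 0}"
    proof (rule Collect_cong, rule conj_cong[OF refl])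
      fix c assume c: "c \<in> U"
      show "(mp_value c h \<noteq> 0 \<and> (\<forall>i\<in>T. m \<le> i \<longrightarrow> mp_value c (b i) = 0)) = (c \<in> affine_points (M, P) \<and> mp_value c h \<noteq> 0)"
      proof safe
        assume h: "mp_value c h \<noteq> 0" and b0: "\<forall>i\<in>T. m \<le> i \<longrightarrow> mp_value c (b i) = 0"
        have "mp_value c p = 0" if "p \<in> P" for p
        proof (rule triangular_zeros[OF P _ Aq _ _ that])
          show "i < M \<Longrightarrow> i \<notin> T \<Longrightarrow> free_coord P i" for i by (simp add: T_def)
          show "i \<in> T \<Longrightarrow> mp_value c (poly (A i) (mp_var i ^ q i)) = 0" for i
            using b0 T(2)[of i] by (auto simp: b_def)
          show "i \<in> T \<Longrightarrow> mp_value c (lead_coeff (A i)) \<noteq> 0" for i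
            using hv(1)[OF h, of i] by (simp add: l_def)
        qed
        then show "c \<in> affine_points (M, P)" using c UM by auto
      qed (use AR(3) in auto)
    qed
    ultimately show ?thesis by (simp add: E_def)
  qed
  then show ?thesis using hM \<open>h \<notin> P\<close> by blast
qed

section \<open>Generic continuity\<close>

definition vanishing_ideal :: "nat \<Rightarrow> 'k::field vec set \<Rightarrow> 'k mpoly set" where
  "vanishing_ideal M D = {p \<in> polys M. \<forall>c\<in>D. mp_value c p = 0}"

lemma idl_vanishing_ideal: "idl (polys M) (vanishing_ideal M D)"
  by (auto simp: idl_def vanishing_ideal_def val.hom_add val.hom_mult intro: polys_intros)

text \<open>The invariant of the later induction survives a cut by one polynomial: the piece is
  relatively closed in the unchanged open set U, with its own vanishing ideal as the
  equations.\<close>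

lemma relatively_closed_cut:
  fixes D U :: "'k::field vec set"
  assumes D: "D = U \<inter> affine_points (M, vanishing_ideal M D)" and a: "a \<in> polys M"
  shows "{c \<in> D. mp_value c a = 0} = U \<inter> affine_points (M, vanishing_ideal M {c \<in> D. mp_value c a = 0})"
proof (rule antisym; rule subsetI)
  fix c assume "c \<in> {c \<in> D. mp_value c a = 0}"
  then show "c \<in> U \<inter> affine_points (M, vanishing_ideal M {c \<in> D. mp_value c a = 0})"
    using D by (auto simp: vanishing_ideal_def)
next
  fix c assume c: "c \<in> U \<inter> affine_points (M, vanishing_ideal M {c \<in> D. mp_value c a = 0})"
  have "vanishing_ideal M D \<subseteq> vanishing_ideal M {c \<in> D. mp_value c a = 0}" by (auto simp: vanishing_ideal_def)
  then have "c \<in> U \<inter> affine_points (M, vanishing_ideal M D)" using c by auto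
  then have "c \<in> D" using D by blast
  moreover have "a \<in> vanishing_ideal M {c \<in> D. mp_value c a = 0}" using a by (simp add: vanishing_ideal_def)
  then have "mp_value c a = 0" using c by auto
  ultimately show "c \<in> {c \<in> D. mp_value c a = 0}" by blast
qed

text \<open>The projection is an open map on some part G of \<Gamma> through c. G need not be a
  neighbourhood of c in \<Gamma>: when \<Gamma> is a graph, open images of any part through c
  already give continuity at the point below.\<close>

definition open_projection_at :: "'k::field vec set \<Rightarrow> nat \<Rightarrow> nat \<Rightarrow> 'k vec \<Rightarrow> bool" where
  "open_projection_at \<Gamma> m M c \<longleftrightarrow>
     (\<exists>G \<subseteq> \<Gamma>. c \<in> G \<and> (\<forall>U. etale_open M U \<longrightarrow> etale_open m (take_vec m ` (U \<inter> G))))"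

text \<open>Fixing the preceding coordinates as in c leaves a nonzero polynomial in one variable t.
  It has a nonroot over an infinite field, and that nonroot can be written as w^q.\<close>

lemma algebraic_coord_nonzero:
  fixes c :: "'k::field vec"
  assumes inf: "infinite (UNIV :: 'k set)" and A: "A \<in> poly_over (polys i)" and q: "power_automorphism TYPE('k) q"
    and l: "mp_value c (lead_coeff A) \<noteq> 0" and i: "i < m"
  shows "\<exists>x \<in> carrier_vec m. mp_value x (poly A (mp_var i ^ q)) \<noteq> 0"
proof -
  define F where "F = (\<Sum>k\<le>degree A. monom (mp_value c (coeff A k)) k)"
  have "coeff F (degree A) = mp_value c (lead_coeff A)" by (simp add: F_def coeff_sum sum.delta)
  then have "F \<noteq> 0" using l by auto
  then obtain t where t: "poly F t \<noteq> 0" using infinite_poly_nonroot[OF inf] by blast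
  obtain w where w: "t = w ^ q" using q unfolding power_automorphism_def by (metis surjD)
  define x where "x = vec m (\<lambda>k. if k = i then w else c $ k)"
  have "mp_value x (coeff A k) = mp_value c (coeff A k)" for k
    using A i by (intro mp_value_cong[of _ i]) (auto simp: poly_over_def x_def)
  moreover have "x $ i = w" using i by (simp add: x_def)
  ultimately have "mp_value x (poly A (mp_var i ^ q)) = poly F t"
    unfolding val_poly by (simp add: F_def poly_sum poly_monom w val.hom_power)
  then show ?thesis using t by (intro bexI[of _ x]) (auto simp: x_def)
qed

text \<open>Cutting D by a polynomial that does not vanish on it enlarges the vanishing ideal
  strictly, so every such cut is covered by the induction hypothesis. The exceptional polynomials of
  finitely many cuts are multiplied.\<close>

lemma generic_open_projection:
  fixes \<Gamma> D U :: "'k::field vec set"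
  assumes inf: "infinite (UNIV :: 'k set)" and perf: "perfect TYPE('k)" and mM: "m \<le> M"
    and D: "D \<subseteq> \<Gamma>" "etale_open M U" "D = U \<inter> affine_points (M, vanishing_ideal M D)"
  shows "\<exists>q \<in> polys m. (\<exists>x \<in> carrier_vec m. mp_value x q \<noteq> 0) \<and>
    (\<forall>c \<in> D. mp_value c q \<noteq> 0 \<longrightarrow> open_projection_at \<Gamma> m M c)"
  using D
proof (induction "vanishing_ideal M D" arbitrary: D U rule: wf_induct_rule[OF noeth_wf[OF noeth_polys[of M] subring_polys]])
  case (1 D U)
  let ?P = "vanishing_ideal M D"
  let ?good = "open_projection_at \<Gamma> m M"
  have I: "idl (polys M) ?P" by (rule idl_vanishing_ideal)
  have cut: "\<exists>q \<in> polys m. (\<exists>x \<in> carrier_vec m. mp_value x q \<noteq> 0) \<and>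
    (\<forall>c \<in> {c \<in> D. mp_value c a = 0}. mp_value c q \<noteq> 0 \<longrightarrow> ?good c)" if a: "a \<in> polys M" "a \<notin> ?P" for a
  proof (rule 1(1))
    let ?D = "{c \<in> D. mp_value c a = 0}"
    have "?P \<subseteq> vanishing_ideal M ?D" "a \<in> vanishing_ideal M ?D" using a(1) by (auto simp: vanishing_ideal_def)
    then show "(vanishing_ideal M ?D, ?P) \<in> {(J, I). idl (polys M) I \<and> idl (polys M) J \<and> I \<subset> J}"
      using a(2) idl_vanishing_ideal by blast
    show "?D \<subseteq> \<Gamma>" using 1(2) by blast
    show "etale_open M U" by (rule 1(3))
    show "?D = U \<inter> affine_points (M, vanishing_ideal M ?D)" by (rule relatively_closed_cut[OF 1(4) a(1)])
  qed
  consider (empty) "1 \<in> ?P" | (prime) "prime_idl M ?P"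
    | (split) "\<exists>a \<in> polys M. \<exists>b \<in> polys M. a * b \<in> ?P \<and> a \<notin> ?P \<and> b \<notin> ?P"
    using I unfolding prime_idl_def by blast
  then show ?case
  proof cases
    case empty
    then have "D = {}" by (auto simp: vanishing_ideal_def)
    then show ?thesis by (intro bexI[of _ 1]) (auto intro!: exI[of _ "0\<^sub>v m"])
  next
    case split
    then obtain a b where ab: "a \<in> polys M" "b \<in> polys M" "a * b \<in> ?P" "a \<notin> ?P" "b \<notin> ?P" by blast
    obtain p where p: "p \<in> polys m" "\<exists>x \<in> carrier_vec m. mp_value x p \<noteq> 0"
      "\<And>c. c \<in> D \<Longrightarrow> mp_value c a = 0 \<Longrightarrow> mp_value c p \<noteq> 0 \<Longrightarrow> ?good c" using cut[OF ab(1,4)] by blast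
    obtain q where q: "q \<in> polys m" "\<exists>x \<in> carrier_vec m. mp_value x q \<noteq> 0"
      "\<And>c. c \<in> D \<Longrightarrow> mp_value c b = 0 \<Longrightarrow> mp_value c q \<noteq> 0 \<Longrightarrow> ?good c" using cut[OF ab(2,5)] by blast
    have "\<exists>x \<in> carrier_vec m. mp_value x (p * q) \<noteq> 0" using nonzero_mult[OF inf p(1) q(1)] p(2) q(2) by blast
    \<comment> \<open>D is covered by its cuts with a = 0 and b = 0.\<close>
    moreover have "?good c" if "c \<in> D" "mp_value c (p * q) \<noteq> 0" for c
    proof -
      have "mp_value c (a * b) = 0" using ab(3) that(1) by (simp add: vanishing_ideal_def)
      then have "mp_value c a = 0 \<or> mp_value c b = 0" by (simp add: val.hom_mult)
      then show ?thesis using p(3) q(3) that by (auto simp: val.hom_mult)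
    qed
    ultimately show ?thesis using polys_mult[OF p(1) q(1)] by blast
  next
    case prime
    show ?thesis
    proof (cases "\<forall>i<m. free_coord ?P i")
      case True
      then obtain h where h: "h \<in> polys M" "h \<notin> ?P"
        "\<And>U. etale_open M U \<Longrightarrow> etale_open m (take_vec m ` {c \<in> U. c \<in> affine_points (M, ?P) \<and> mp_value c h \<noteq> 0})"
        using open_projection[OF perf prime mM] by blast
      obtain q where q: "q \<in> polys m" "\<exists>x \<in> carrier_vec m. mp_value x q \<noteq> 0"
        "\<And>c. c \<in> D \<Longrightarrow> mp_value c h = 0 \<Longrightarrow> mp_value c q \<noteq> 0 \<Longrightarrow> ?good c" using cut[OF h(1,2)] by blast
      have "?good c" if c: "c \<in> D" "mp_value c h \<noteq> 0" for c
        unfolding open_projection_at_def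
      proof (intro exI conjI allI impI)
        \<comment> \<open>The part of D off h = 0. The open set U is absorbed into the test set V,
          so that the result on all zeros of the prime ideal applies.\<close>
        let ?G = "{c \<in> D. mp_value c h \<noteq> 0}"
        show "?G \<subseteq> \<Gamma>" "c \<in> ?G" using 1(2) c by auto
        fix V :: "'k vec set" assume "etale_open M V"
        then have VU: "etale_open M (V \<inter> U)" using 1(3) by (rule etale_open_Int)
        have eq: "V \<inter> ?G = {c \<in> V \<inter> U. c \<in> affine_points (M, ?P) \<and> mp_value c h \<noteq> 0}" using 1(4) by blast
        show "etale_open m (take_vec m ` (V \<inter> ?G))" unfolding eq by (rule h(3)[OF VU])
      qed
      then show ?thesis using q by blast
    next
      case False
      then obtain i where i: "i < m" "\<not> free_coord ?P i" by blast
      then have iM: "i < M" using mM by simp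
      then obtain A q where A: "algebraic_coord ?P i A q" using free_or_algebraic[OF perf prime iM] i(2) by blast
      \<comment> \<open>This relation involves only coordinates below m and vanishes on D. With it
        as the exceptional polynomial no point of D remains to be treated.\<close>
      let ?b = "poly A (mp_var i ^ q)"
      have AR: "A \<in> poly_over (polys i)" "power_automorphism TYPE('k) q" "?b \<in> ?P" "lead_coeff A \<notin> ?P"
        using A by (auto simp: algebraic_coord_def)
      have "poly (poly_expand q A) (mp_var i) \<in> polys (Suc i)"
        by (intro poly_over_polys_Suc poly_over_expand subring_polys AR(1))
      then have "?b \<in> polys m" using i(1) by (auto simp: poly_poly_expand intro: polys_mono)
      moreover have "\<exists>x \<in> carrier_vec m. mp_value x ?b \<noteq> 0"
      proof -
        have "lead_coeff A \<in> polys M" using AR(1) iM by (auto simp: poly_over_def intro: polys_mono)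
        then obtain c where "mp_value c (lead_coeff A) \<noteq> 0" using AR(4) by (auto simp: vanishing_ideal_def)
        then show ?thesis by (rule algebraic_coord_nonzero[OF inf AR(1,2) _ i(1)])
      qed
      moreover have "mp_value c ?b = 0" if "c \<in> D" for c using AR(3) that by (simp add: vanishing_ideal_def)
      ultimately show ?thesis by blast
    qed
  qed
qed

section \<open>The etale topology on affine space\<close>

lemma openin_affine_space:
  fixes S :: "'k::field vec set"
  shows "openin (etale_topology (affine_space m)) S \<longleftrightarrow> etale_open m S"
proof
  assume "openin (etale_topology (affine_space m)) S"
  moreover have "idl (polys m) {0 :: 'k mpoly}" by (auto simp: idl_def)
  ultimately obtain U where "etale_open m U" "S = U \<inter> affine_points (m, {0})"
    using openin_etale_topology unfolding affine_space_def by blast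
  moreover have "affine_points (m, {0 :: 'k mpoly}) = carrier_vec m" by auto
  ultimately show "etale_open m S" using etale_openD[of m U] by (simp add: Int_absorb2)
qed (rule etale_open_imp_openin)

lemma topspace_affine_space: "topspace (etale_topology (affine_space m)) = (carrier_vec m :: 'k::field vec set)"
proof
  have "openin (etale_topology (affine_space m)) (topspace (etale_topology (affine_space m) :: 'k vec topology))" by simp
  then show "topspace (etale_topology (affine_space m) :: 'k vec topology) \<subseteq> carrier_vec m"
    unfolding openin_affine_space by (rule etale_openD)
  show "carrier_vec m \<subseteq> topspace (etale_topology (affine_space m) :: 'k vec topology)"
    by (rule openin_subset) (simp add: openin_affine_space etale_open_carrier)
qed

section \<open>The Zariski topology\<close>

lemma zariski_basis: "q \<in> polys m \<Longrightarrow> openin (zariski_topology m) {a \<in> carrier_vec m. mp_value a q \<noteq> 0}"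
  unfolding zariski_topology_def by (intro topology_generated_by_Basis) blast

lemma topspace_zariski: "topspace (zariski_topology m) = (carrier_vec m :: 'k::field vec set)"
proof
  show "topspace (zariski_topology m) \<subseteq> (carrier_vec m :: 'k vec set)"
    unfolding zariski_topology_def topology_generated_by_topspace by auto
  have "openin (zariski_topology m) (carrier_vec m :: 'k vec set)" using zariski_basis[of 1 m] by simp
  then show "(carrier_vec m :: 'k vec set) \<subseteq> topspace (zariski_topology m)" by (rule openin_subset)
qed

lemma zariski_neighbourhood:
  fixes T :: "'k::field vec set"
  assumes "openin (zariski_topology m) T" "x \<in> T"
  shows "\<exists>p \<in> polys m. mp_value x p \<noteq> 0 \<and> {a \<in> carrier_vec m. mp_value a p \<noteq> 0} \<subseteq> T"
  using assms unfolding zariski_topology_def openin_topology_generated_by_iff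
proof (induction rule: generate_topology_on.induct)
  case (Int a b)
  then obtain p q where "p \<in> polys m" "mp_value x p \<noteq> 0" "{a \<in> carrier_vec m. mp_value a p \<noteq> 0} \<subseteq> a"
    "q \<in> polys m" "mp_value x q \<noteq> 0" "{a \<in> carrier_vec m. mp_value a q \<noteq> 0} \<subseteq> b" by blast
  then show ?case by (intro bexI[of _ "p * q"]) (auto simp: val.hom_mult intro: polys_mult)
next
  case (UN K)
  then show ?case by blast
qed auto

text \<open>A basic open set p \<noteq> 0 around a point meets q \<noteq> 0, since the product p q
  is again nonzero somewhere.\<close>

lemma zariski_dense:
  fixes q :: "'k::field mpoly"
  assumes inf: "infinite (UNIV :: 'k set)" and q: "q \<in> polys m" "\<exists>x \<in> carrier_vec m. mp_value x q \<noteq> 0"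
  shows "zariski_topology m closure_of {a \<in> carrier_vec m. mp_value a q \<noteq> 0} = carrier_vec m"
proof
  show "zariski_topology m closure_of {a \<in> carrier_vec m. mp_value a q \<noteq> 0} \<subseteq> carrier_vec m"
    using closure_of_subset_topspace[of "zariski_topology m"] by (simp add: topspace_zariski)
  show "carrier_vec m \<subseteq> zariski_topology m closure_of {a \<in> carrier_vec m. mp_value a q \<noteq> 0}"
  proof
    fix x :: "'k vec" assume x: "x \<in> carrier_vec m"
    show "x \<in> zariski_topology m closure_of {a \<in> carrier_vec m. mp_value a q \<noteq> 0}"
      unfolding in_closure_of topspace_zariski
    proof (intro conjI allI impI x)
      fix T assume "x \<in> T \<and> openin (zariski_topology m) T"
      then obtain p where p: "p \<in> polys m" "mp_value x p \<noteq> 0" "{a \<in> carrier_vec m. mp_value a p \<noteq> 0} \<subseteq> T"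
        using zariski_neighbourhood by blast
      obtain y where "y \<in> carrier_vec m" "mp_value y (p * q) \<noteq> 0"
        using nonzero_mult[OF inf p(1) q(1) x p(2)] q(2) by blast
      then show "\<exists>y. y \<in> {a \<in> carrier_vec m. mp_value a q \<noteq> 0} \<and> y \<in> T" using p(3) by (auto simp: val.hom_mult)
    qed
  qed
qed

theorem theoremF:
  fixes f :: "'k::field vec \<Rightarrow> 'k vec" and m n :: nat
  assumes "ez_field TYPE('k)"
    and "definable_function m n f"
  shows "\<exists>U. openin (zariski_topology m) U \<and>
           zariski_topology m closure_of U = carrier_vec m \<and>
           continuous_map (subtopology (etale_topology (affine_space m)) U)
             (etale_topology (affine_space n)) f"
proof -
  have f: "\<And>a. a \<in> carrier_vec m \<Longrightarrow> f a \<in> carrier_vec n" using assms(2) by (auto simp: definable_function_def)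
  have cont: "continuous_map (subtopology (etale_topology (affine_space m)) U) (etale_topology (affine_space n)) f"
    if U: "U \<subseteq> carrier_vec m" and open_vimage: "\<And>W. etale_open n W \<Longrightarrow> etale_open m {x \<in> U. f x \<in> W}" for U
    unfolding continuous_map_def
  proof (intro conjI allI impI funcsetI)
    fix x assume "x \<in> topspace (subtopology (etale_topology (affine_space m)) U)"
    then show "f x \<in> topspace (etale_topology (affine_space n))" using f by (simp add: topspace_affine_space)
  next
    fix W :: "'k vec set" assume "openin (etale_topology (affine_space n)) W"
    then have "etale_open m {x \<in> U. f x \<in> W}" unfolding openin_affine_space by (rule open_vimage)
    moreover have "{x \<in> topspace (subtopology (etale_topology (affine_space m)) U). f x \<in> W} = {x \<in> U. f x \<in> W} \<inter> U"
      using U by (auto simp: topspace_affine_space)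
    ultimately show "openin (subtopology (etale_topology (affine_space m)) U)
        {x \<in> topspace (subtopology (etale_topology (affine_space m)) U). f x \<in> W}"
      unfolding openin_subtopology openin_affine_space by blast
  qed
  show ?thesis
  proof (cases "etale_open 1 {0\<^sub>v 1 :: 'k vec}")
    case True
    have "openin (zariski_topology m) (carrier_vec m :: 'k vec set)"
      by (metis topspace_zariski openin_topspace)
    moreover have "zariski_topology m closure_of carrier_vec m = (carrier_vec m :: 'k vec set)"
      by (metis closure_of_topspace topspace_zariski)
    moreover have "continuous_map (subtopology (etale_topology (affine_space m)) (carrier_vec m)) (etale_topology (affine_space n)) f"
      by (rule cont) (auto intro: etale_open_discrete[OF True])
    ultimately show ?thesis by blast
  next
    case False
    have inf: "infinite (UNIV :: 'k set)" using False finite_field_discrete by blast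
    have perf: "perfect TYPE('k)" by (rule perfect_or_discrete[OF assms(1) False])
    define \<Gamma> where "\<Gamma> = {a @\<^sub>v f a | a. a \<in> carrier_vec m}"
    have "ez_set (m + n) \<Gamma>" using assms unfolding ez_field_def definable_function_def \<Gamma>_def by blast
    then obtain \<D> where \<D>: "finite \<D>" "\<Gamma> = \<Union>\<D>"
      "\<And>D. D \<in> \<D> \<Longrightarrow> \<exists>I. affine_variety (m + n, I) \<and> openin (etale_topology (m + n, I)) D"
      unfolding ez_set_def by blast
    have "\<exists>q \<in> polys m. (\<exists>x \<in> carrier_vec m. mp_value x q \<noteq> 0) \<and>
      (\<forall>c \<in> D. mp_value c q \<noteq> 0 \<longrightarrow> open_projection_at \<Gamma> m (m + n) c)" if D: "D \<in> \<D>" for D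
    proof -
      obtain I where I: "affine_variety (m + n, I)" "openin (etale_topology (m + n, I)) D" using \<D>(3)[OF D] by blast
      have idl: "idl (polys (m + n)) I" using I(1) unfolding affine_variety_iff by blast
      obtain U where U: "etale_open (m + n) U" "D = U \<inter> affine_points (m + n, I)"
        using openin_etale_topology[OF idl I(2)] by blast
      \<comment> \<open>The induction requires the full vanishing ideal in place of the ideal from
        the ez presentation. Enlarging the ideal does not lose points of D.\<close>
      have "I \<subseteq> vanishing_ideal (m + n) D" using idlD(1)[OF idl] U(2) by (auto simp: vanishing_ideal_def)
      then have "D = U \<inter> affine_points (m + n, vanishing_ideal (m + n) D)"
        using U(2) by (auto simp: vanishing_ideal_def)
      moreover have "D \<subseteq> \<Gamma>" using D \<D>(2) by blast
      ultimately show ?thesis using U(1) by (intro generic_open_projection[OF inf perf]) auto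
    qed
    then obtain q where q: "\<And>D. D \<in> \<D> \<Longrightarrow> q D \<in> polys m" "\<And>D. D \<in> \<D> \<Longrightarrow> \<exists>x \<in> carrier_vec m. mp_value x (q D) \<noteq> 0"
      "\<And>D c. D \<in> \<D> \<Longrightarrow> c \<in> D \<Longrightarrow> mp_value c (q D) \<noteq> 0 \<Longrightarrow> open_projection_at \<Gamma> m (m + n) c"
      by metis
    define p where "p = (\<Prod>D\<in>\<D>. q D)"
    have p: "p \<in> polys m" unfolding p_def using q(1) by (rule polys_prod)
    have "\<exists>x \<in> carrier_vec m. mp_value x p \<noteq> 0" unfolding p_def using \<D>(1) q(1,2)
    proof (induction \<D>)
      case empty
      show ?case by (rule bexI[of _ "0\<^sub>v m"]) simp_all
    next
      case (insert D \<D>)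
      have qD: "q D \<in> polys m" and q\<D>: "prod q \<D> \<in> polys m"
        using insert.prems(1) by (auto intro: polys_prod)
      obtain a where a: "a \<in> carrier_vec m" "mp_value a (q D) \<noteq> 0" using insert.prems(2)[of D] by blast
      obtain b where b: "b \<in> carrier_vec m" "mp_value b (prod q \<D>) \<noteq> 0" using insert.IH insert.prems by blast
      have "\<exists>x \<in> carrier_vec m. mp_value x (q D * prod q \<D>) \<noteq> 0" by (rule nonzero_mult[OF inf qD q\<D> a b])
      then show ?case using insert(1,2) by simp
    qed
    let ?U = "{a \<in> carrier_vec m. mp_value a p \<noteq> 0}"
    have "etale_open m {x \<in> ?U. f x \<in> W}" if W: "etale_open n W" for W
    proof (rule etale_openI)
      fix x assume x: "x \<in> {x \<in> ?U. f x \<in> W}"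
      then have xm: "x \<in> carrier_vec m" by blast
      then have "x @\<^sub>v f x \<in> \<Gamma>" by (auto simp: \<Gamma>_def)
      then obtain D where D: "D \<in> \<D>" "x @\<^sub>v f x \<in> D" using \<D>(2) by blast
      have "mp_value x (q D) \<noteq> 0" using x D(1) \<D>(1) by (auto simp: p_def val.hom_prod)
      then have "mp_value (x @\<^sub>v f x) (q D) \<noteq> 0" using mp_value_append[OF q(1)[OF D(1)] xm] by simp
      then have "open_projection_at \<Gamma> m (m + n) (x @\<^sub>v f x)" by (rule q(3)[OF D])
      then obtain G where G: "G \<subseteq> \<Gamma>" "x @\<^sub>v f x \<in> G"
        "\<And>U. etale_open (m + n) U \<Longrightarrow> etale_open m (take_vec m ` (U \<inter> G))" unfolding open_projection_at_def by blast
      \<comment> \<open>The cylinder of points whose last n coordinates lie in W.\<close>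
      define V where "V = {c \<in> carrier_vec (m + n). vec n (\<lambda>i. mp_value c (mp_var (m + i))) \<in> W}"
      have V: "etale_open (m + n) V" unfolding V_def by (intro etale_open_vimage W) auto
      have drop: "vec n (\<lambda>i. mp_value (y @\<^sub>v f y) (mp_var (m + i))) = f y" if "y \<in> carrier_vec m" for y
        using that f[OF that] by (intro eq_vecI) (auto simp: index_append_vec)
      have take: "take_vec m (y @\<^sub>v f y) = y" if "y \<in> carrier_vec m" for y
        using that by (intro eq_vecI) (auto simp: index_append_vec)
      \<comment> \<open>A point of this set lies below some (z, f z) in G with f z \<in> W. Since G
        is part of the graph, the point is z itself, so f maps the whole set into W.\<close>
      let ?N = "take_vec m ` (V \<inter> G) \<inter> ?U"
      have "etale_open m ?N" by (intro etale_open_Int G(3) V etale_open_nonzero p)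
      moreover have "x \<in> ?N"
      proof -
        have "x @\<^sub>v f x \<in> V" using x xm f[OF xm] by (simp add: V_def drop del: val_var)
        then have "take_vec m (x @\<^sub>v f x) \<in> take_vec m ` (V \<inter> G)" using G(2) by blast
        then show ?thesis using x by (simp add: take[OF xm])
      qed
      moreover have "?N \<subseteq> {x \<in> ?U. f x \<in> W}"
      proof
        fix y assume y: "y \<in> ?N"
        then obtain c where c: "c \<in> V" "c \<in> G" "y = take_vec m c" by blast
        then obtain z where z: "z \<in> carrier_vec m" "c = z @\<^sub>v f z" using G(1) by (auto simp: \<Gamma>_def)
        have "y = z" unfolding c(3) z(2) by (rule take[OF z(1)])
        moreover have "f z \<in> W" using c(1) unfolding V_def z(2) mem_Collect_eq drop[OF z(1)] by blast
        ultimately show "y \<in> {x \<in> ?U. f x \<in> W}" using y by blast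
      qed
      ultimately show "\<exists>N. etale_open m N \<and> x \<in> N \<and> N \<subseteq> {x \<in> ?U. f x \<in> W}" by blast
    qed
    then have "continuous_map (subtopology (etale_topology (affine_space m)) ?U) (etale_topology (affine_space n)) f"
      by (intro cont) auto
    then show ?thesis
      using zariski_basis[OF p] zariski_dense[OF inf p \<open>\<exists>x \<in> carrier_vec m. mp_value x p \<noteq> 0\<close>] by blast
  qed
qed

end
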